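(* Let $N$ be an open connected $n$-manifold with a $C^{2}$ foliation by planes $\mathcal{F}$. If $\pi_1(N)$ has an Abelian subgroup of rank greater than one, then $\mathcal{F}$ has at least one leaf which is not closed.
   Context: An open manifold is a non-compact manifold without boundary. A foliation by planes of an $n$-manifold $N$ is a $C^{2}$ codimension-one foliation of $N$ all of whose leaves are diffeomorphic to $\mathbb{R}^{n-1}$. A leaf is closed if it is a closed subset of $N$. For a torsion-free finitely generated group $G$, $\mathrm{rank}(G)$ is the minimal cardinality of a finite set generating $G$; the Abelian subgroup in the claim is one for which this rank is defined, i.e. it is torsion-free and finitely generated. *)

theory Defs
  imports "HOL-Analysis.Analysis" "HOL-Algebra.Generated_Groups"
begin

section \<open>Differentiable manifolds\<close>

text \<open>
  The set \<open>S\<close> is always an open subset of the space or a relatively open subset of a linear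
  subspace \<open>E\<close>. In the latter case the total derivatives within \<open>S\<close> are not unique, but their
  restrictions to \<open>E\<close> are, so the definition says that \<open>f\<close> is of class $C^2$ as a function on
  an open subset of \<open>E\<close>.
\<close>

definition C2_on :: "('v::real_normed_vector \<Rightarrow> 'w::real_normed_vector) \<Rightarrow> 'v set \<Rightarrow> bool" where
  "C2_on f S \<longleftrightarrow>
     (\<exists>(f' :: 'v \<Rightarrow> 'v \<Rightarrow>\<^sub>L 'w) (f'' :: 'v \<Rightarrow> 'v \<Rightarrow>\<^sub>L ('v \<Rightarrow>\<^sub>L 'w)).
        (\<forall>x\<in>S. (f has_derivative blinfun_apply (f' x)) (at x within S)) \<and>
        (\<forall>x\<in>S. (f' has_derivative blinfun_apply (f'' x)) (at x within S)) \<and>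
        continuous_on S f'')"

type_synonym ('a, 'v) chart = "'a set \<times> ('a \<Rightarrow> 'v)"

text \<open>Charts take values in a linear subspace \<open>E\<close>, the model space of the manifold.\<close>

definition chart_on :: "'a topology \<Rightarrow> 'v::real_normed_vector set \<Rightarrow> ('a, 'v) chart \<Rightarrow> bool" where
  "chart_on X E = (\<lambda>(U, \<phi>).
     openin X U \<and> openin (top_of_set E) (\<phi> ` U) \<and>
     homeomorphic_map (subtopology X U) (top_of_set (\<phi> ` U)) \<phi>)"

definition C2_compatible ::
    "('a, 'v::real_normed_vector) chart \<Rightarrow> ('a, 'v) chart \<Rightarrow> bool" where
  "C2_compatible = (\<lambda>(U, \<phi>) (V, \<psi>).
     C2_on (\<psi> \<circ> inv_into U \<phi>) (\<phi> ` (U \<inter> V)) \<and>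
     C2_on (\<phi> \<circ> inv_into V \<psi>) (\<psi> ` (U \<inter> V)))"

definition C2_atlas ::
    "'a topology \<Rightarrow> 'v::real_normed_vector set \<Rightarrow> ('a, 'v) chart set \<Rightarrow> bool" where
  "C2_atlas X E A \<longleftrightarrow>
     (\<forall>c\<in>A. chart_on X E c) \<and> (\<Union>c\<in>A. fst c) = topspace X \<and>
     (\<forall>c\<in>A. \<forall>d\<in>A. C2_compatible c d)"

definition C2_map ::
    "'a topology \<Rightarrow> ('a, 'v::real_normed_vector) chart set \<Rightarrow>
     'b topology \<Rightarrow> ('b, 'w::real_normed_vector) chart set \<Rightarrow> ('a \<Rightarrow> 'b) \<Rightarrow> bool" where
  "C2_map X A Y B g \<longleftrightarrow>
     continuous_map X Y g \<and>
     (\<forall>(U, \<phi>)\<in>A. \<forall>(V, \<psi>)\<in>B. C2_on (\<psi> \<circ> g \<circ> inv_into U \<phi>) (\<phi> ` {p \<in> U. g p \<in> V}))"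

definition C2_diffeomorphic ::
    "'a topology \<Rightarrow> ('a, 'v::real_normed_vector) chart set \<Rightarrow>
     'b topology \<Rightarrow> ('b, 'w::real_normed_vector) chart set \<Rightarrow> bool" where
  "C2_diffeomorphic X A Y B \<longleftrightarrow>
     (\<exists>g h. homeomorphic_maps X Y g h \<and> C2_map X A Y B g \<and> C2_map Y B X A h)"

text \<open>
  A manifold (without boundary) of dimension \<open>CARD('n)\<close> with an atlas \<open>A\<close> of class at least
  $C^2$. A $C^\infty$ atlas is in particular such an atlas.
\<close>

definition manifold :: "'a topology \<Rightarrow> ('a, real ^ 'n) chart set \<Rightarrow> bool" where
  "manifold N A \<longleftrightarrow> Hausdorff_space N \<and> second_countable N \<and> C2_atlas N UNIV A"


section \<open>Codimension-one foliations\<close>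

text \<open>
  The coordinate \<open>k\<close> is the transverse one: $\mathbb{R}^{n} = \mathbb{R}^{n-1} \times \mathbb{R}$ with
  $\mathbb{R}^{n-1}$ the hyperplane below. In this form the case $n = 1$ is included.
\<close>

definition hyperplane :: "'n \<Rightarrow> (real ^ 'n) set" where
  "hyperplane k = {x. x $ k = 0}"

definition hyperplane_proj :: "'n \<Rightarrow> real ^ 'n \<Rightarrow> real ^ 'n" where
  "hyperplane_proj k x = (\<chi> i. if i = k then 0 else x $ i)"

definition plaque :: "'n \<Rightarrow> ('a, real ^ 'n) chart \<Rightarrow> real \<Rightarrow> 'a set" where
  "plaque k c t = {p \<in> fst c. snd c p $ k = t}"

text \<open>
  Changes of foliated charts locally have the form $(x, y) \mapsto (h_1(x, y), h_2(y))$. This can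
  only be required locally, since plaques may intersect in disconnected sets. That the change of
  charts, and hence $h_2$, is of class $C^2$ follows from the compatibility with \<open>A\<close>.
\<close>

definition coherent :: "'a topology \<Rightarrow> 'n \<Rightarrow> ('a, real ^ 'n) chart \<Rightarrow> ('a, real ^ 'n) chart \<Rightarrow> bool" where
  "coherent N k = (\<lambda>(U, \<phi>) (V, \<psi>).
     \<forall>p \<in> U \<inter> V. \<exists>W h\<^sub>2. openin N W \<and> p \<in> W \<and> W \<subseteq> U \<inter> V \<and>
       (\<forall>q\<in>W. \<psi> q $ k = h\<^sub>2 (\<phi> q $ k)))"

text \<open>A $C^2$ codimension-one foliation, given by an atlas \<open>F\<close> of foliated charts.\<close>

definition foliation ::
    "'a topology \<Rightarrow> ('a, real ^ 'n) chart set \<Rightarrow> 'n \<Rightarrow> ('a, real ^ 'n) chart set \<Rightarrow> bool" where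
  "foliation N A k F \<longleftrightarrow>
     (\<forall>c\<in>F. chart_on N UNIV c \<and> (\<exists>a b. snd c ` fst c = box a b)) \<and>
     (\<Union>c\<in>F. fst c) = topspace N \<and>
     (\<forall>c\<in>F. \<forall>d\<in>A. C2_compatible c d) \<and>
     (\<forall>c\<in>F. \<forall>d\<in>F. coherent N k c d)"

definition same_plaque :: "'n \<Rightarrow> ('a, real ^ 'n) chart set \<Rightarrow> 'a \<Rightarrow> 'a \<Rightarrow> bool" where
  "same_plaque k F p q \<longleftrightarrow> (\<exists>c\<in>F. \<exists>t. p \<in> plaque k c t \<and> q \<in> plaque k c t)"

definition leaves :: "'a topology \<Rightarrow> 'n \<Rightarrow> ('a, real ^ 'n) chart set \<Rightarrow> 'a set set" where
  "leaves N k F = (\<lambda>p. {q. (same_plaque k F)\<^sup>*\<^sup>* p q}) ` topspace N"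

text \<open>
  The intrinsic manifold structure of a leaf. Its topology is generated by the open subsets of
  plaques; in general it is finer than the subspace topology of \<open>N\<close>.
\<close>

definition leaf_topology ::
    "'a topology \<Rightarrow> 'n \<Rightarrow> ('a, real ^ 'n) chart set \<Rightarrow> 'a set \<Rightarrow> 'a topology" where
  "leaf_topology N k F L =
     topology_generated_by
       {W. \<exists>c\<in>F. \<exists>t. plaque k c t \<subseteq> L \<and> openin (subtopology N (plaque k c t)) W}"

definition leaf_atlas ::
    "'n \<Rightarrow> ('a, real ^ 'n) chart set \<Rightarrow> 'a set \<Rightarrow> ('a, real ^ 'n) chart set" where
  "leaf_atlas k F L =
     {(plaque k c t, hyperplane_proj k \<circ> snd c) | c t. c \<in> F \<and> plaque k c t \<subseteq> L}"

definition foliation_by_planes ::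
    "'a topology \<Rightarrow> ('a, real ^ 'n) chart set \<Rightarrow> 'n \<Rightarrow> ('a, real ^ 'n) chart set \<Rightarrow> bool" where
  "foliation_by_planes N A k F \<longleftrightarrow>
     foliation N A k F \<and>
     (\<forall>L \<in> leaves N k F.
        C2_diffeomorphic (leaf_topology N k F L) (leaf_atlas k F L)
          (top_of_set (hyperplane k)) {(hyperplane k, id)})"


section \<open>Fundamental group\<close>

definition loops :: "'a topology \<Rightarrow> 'a \<Rightarrow> (real \<Rightarrow> 'a) set" where
  "loops X x = {p. pathin X p \<and> p 0 = x \<and> p 1 = x}"

definition homotopic_loops_at :: "'a topology \<Rightarrow> 'a \<Rightarrow> (real \<Rightarrow> 'a) \<Rightarrow> (real \<Rightarrow> 'a) \<Rightarrow> bool" where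
  "homotopic_loops_at X x p q \<longleftrightarrow>
     homotopic_with (\<lambda>r. r 0 = x \<and> r 1 = x) (top_of_set {0..1}) X p q"

text \<open>The library's \<open>joinpaths\<close>, without its restriction to type-class topologies.\<close>

definition concat_paths :: "(real \<Rightarrow> 'a) \<Rightarrow> (real \<Rightarrow> 'a) \<Rightarrow> real \<Rightarrow> 'a" where
  "concat_paths p q = (\<lambda>t. if t \<le> 1/2 then p (2 * t) else q (2 * t - 1))"

definition loop_class :: "'a topology \<Rightarrow> 'a \<Rightarrow> (real \<Rightarrow> 'a) \<Rightarrow> (real \<Rightarrow> 'a) set" where
  "loop_class X x p = {q \<in> loops X x. homotopic_loops_at X x p q}"

definition fundamental_group :: "'a topology \<Rightarrow> 'a \<Rightarrow> (real \<Rightarrow> 'a) set monoid" where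
  "fundamental_group X x =
     \<lparr>carrier = loop_class X x ` loops X x,
      mult = (\<lambda>C D. \<Union>p\<in>C. \<Union>q\<in>D. loop_class X x (concat_paths p q)),
      one = loop_class X x (\<lambda>_. x)\<rparr>"


section \<open>Rank of a group\<close>

definition torsion_free :: "('g, 'm) monoid_scheme \<Rightarrow> bool" where
  "torsion_free G \<longleftrightarrow>
     (\<forall>g \<in> carrier G. g \<noteq> \<one>\<^bsub>G\<^esub> \<longrightarrow> (\<forall>m::nat. m > 0 \<longrightarrow> g [^]\<^bsub>G\<^esub> m \<noteq> \<one>\<^bsub>G\<^esub>))"

definition finitely_generated :: "('g, 'm) monoid_scheme \<Rightarrow> bool" where
  "finitely_generated G \<longleftrightarrow> (\<exists>S \<subseteq> carrier G. finite S \<and> generate G S = carrier G)"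

text \<open>Only meaningful for finitely generated groups.\<close>

definition group_rank :: "('g, 'm) monoid_scheme \<Rightarrow> nat" where
  "group_rank G = (LEAST m. \<exists>S \<subseteq> carrier G. finite S \<and> card S = m \<and> generate G S = carrier G)"

end

theory Submission
  imports Defs
begin

text \<open>
  Suppose that all leaves are closed; then every Abelian subgroup of the fundamental group turns out
  to be cyclic, so it cannot have rank greater than one.

  A leaf is homeomorphic to a hyperplane, hence separable, and so it meets a foliated chart in only
  countably many plaques. If it is closed, their transverse coordinates form a countable relatively
  closed set of reals, which by Baire's theorem has an isolated point. Isolation propagates along
  the leaf, so the leaf meets sufficiently small charts in at most one plaque (lemma \<open>isolated\<close>).

  Now pass to the universal cover \<open>E\<close> with the lifted foliation. Since local systems with fibre Z/2
  are trivial on \<open>E\<close> (\<open>Z2_trivial_cover\<close>), the lifted foliation is transversely oriented, and every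
  leaf has a globally defined positive half. By the orientation, a leaf can then cross a chart only
  once, and it divides \<open>E\<close> into two sides (\<open>Z2_trivial_separable_leaves\<close>). A leaf being simply
  connected, a deck transformation that maps a lifted leaf to itself is trivial (\<open>deck_free\<close>), so
  the deck group acts freely on the leaves of \<open>E\<close>.

  The heart of the argument is that a single automorphism \<open>f\<close> without invariant leaves nests some
  side: \<open>f Q \<subset> Q\<close> or \<open>Q \<subset> f Q\<close> (\<open>exists_nested_side\<close>). Otherwise each leaf has a
  side \<open>Q\<close> with \<open>f Q \<inter> Q = {}\<close>, here called an outer side. The outer sides containing a given one form a
  chain, whose union \<open>T\<close> is again an outer side, hence maximal. Let \<open>m\<close> be its boundary leaf. The
  far sides of the leaves just beyond \<open>m\<close> are outer by maximality, and form a chain with union \<open>R\<close>.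
  The frontier leaf of \<open>R\<close> that cuts \<open>R\<close> off from \<open>f T\<close> can only be \<open>f m\<close>. Thus \<open>R\<close>
  fills the complement of \<open>T\<close> near \<open>m\<close> and the complement of \<open>f T\<close> near \<open>f m\<close>. As \<open>f\<close> carries
  the former to the latter, \<open>R\<close> meets \<open>f R\<close>, which is impossible for an ascending union of outer sides.

  Finally let \<open>K\<close> be a nontrivial Abelian group of deck transformations. By the above there are \<open>g \<in> K\<close> and
  a side \<open>Q\<close> with \<open>g Q \<subset> Q\<close>. Any two
  points are separated by only finitely many translates of the boundary of \<open>Q\<close>
  (\<open>finite_separators\<close>). If \<open>h Q\<close> were disjoint from \<open>Q\<close>, or if they covered \<open>E\<close>, then the
  translates by powers of \<open>g\<close>, which commutes with \<open>h\<close>, would violate this. So the translates of \<open>Q\<close>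
  are nested, which orders \<open>K\<close> totally in such a way that only finitely many elements lie between
  the identity and a given positive one. Such a group is cyclic (\<open>cyclic_of_discrete_positive_cone\<close>).
\<close>

section \<open>Codimension-one foliations and the sides of a leaf\<close>

text \<open>
  A codimension-one foliation reduced to what the topological argument uses: a basis of open sets with
  transverse coordinates. The leaf directions enter only through the connectedness of plaques.
  Closure under reversal of \<open>y\<close> lets arguments assume that something happens above a point.
\<close>

locale foliated_space =
  fixes E :: "'e topology" and C :: "('e set \<times> ('e \<Rightarrow> real)) set"
  assumes chart_openin: "(U, y) \<in> C \<Longrightarrow> openin E U"
    and chart_connected: "(U, y) \<in> C \<Longrightarrow> connectedin E U"
    and chart_continuous: "(U, y) \<in> C \<Longrightarrow> continuous_map (subtopology E U) euclideanreal y"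
    and chart_open_map: "\<lbrakk>(U, y) \<in> C; openin E V; V \<subseteq> U\<rbrakk> \<Longrightarrow> open (y ` V)"
    and plaque_connected: "(U, y) \<in> C \<Longrightarrow> connectedin E {q \<in> U. y q = t}"
    and charts_coherent: "\<lbrakk>(U, y) \<in> C; (V, z) \<in> C; p \<in> U; p \<in> V\<rbrakk> \<Longrightarrow>
        \<exists>W h. openin E W \<and> p \<in> W \<and> W \<subseteq> U \<inter> V \<and> (\<forall>q\<in>W. z q = h (y q))"
    and charts_base: "\<lbrakk>openin E V; p \<in> V\<rbrakk> \<Longrightarrow> \<exists>U y. (U, y) \<in> C \<and> p \<in> U \<and> U \<subseteq> V"
    and chart_reverse: "(U, y) \<in> C \<Longrightarrow> (U, \<lambda>q. - y q) \<in> C"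
begin

definition plaque_rel :: "'e \<Rightarrow> 'e \<Rightarrow> bool" where
  "plaque_rel p q \<longleftrightarrow> (\<exists>U y. (U, y) \<in> C \<and> p \<in> U \<and> q \<in> U \<and> y p = y q)"

definition leaf :: "'e \<Rightarrow> 'e set" where
  "leaf p = {q. plaque_rel\<^sup>*\<^sup>* p q}"

definition is_leaf :: "'e set \<Rightarrow> bool" where
  "is_leaf l \<longleftrightarrow> (\<exists>p\<in>topspace E. l = leaf p)"

text \<open>
  For subsets of the space these are the unions of leaves. The definition is by plaques because then
  saturation can be checked in one chart at a time.
\<close>

definition saturated :: "'e set \<Rightarrow> bool" where
  "saturated A \<longleftrightarrow> (\<forall>p q. p \<in> A \<longrightarrow> plaque_rel p q \<longrightarrow> q \<in> A)"

lemma chart_subset: "(U, y) \<in> C \<Longrightarrow> U \<subseteq> topspace E"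
  using chart_openin openin_subset by blast

lemma chart_at: "p \<in> topspace E \<Longrightarrow> \<exists>U y. (U, y) \<in> C \<and> p \<in> U"
  using charts_base[OF openin_topspace] by blast

lemma plaque_rel_sym: "plaque_rel p q \<Longrightarrow> plaque_rel q p"
  unfolding plaque_rel_def by metis

lemma plaque_relI: "(U, y) \<in> C \<Longrightarrow> p \<in> U \<Longrightarrow> q \<in> U \<Longrightarrow> y p = y q \<Longrightarrow> plaque_rel p q"
  unfolding plaque_rel_def by blast

lemma leaf_refl [simp]: "p \<in> leaf p"
  by (simp add: leaf_def)

lemma leaf_sym: "q \<in> leaf p \<Longrightarrow> p \<in> leaf q"
  unfolding leaf_def mem_Collect_eq
  by (metis symp_rtranclp symp_def plaque_rel_sym)

lemma leaf_trans: "q \<in> leaf p \<Longrightarrow> r \<in> leaf q \<Longrightarrow> r \<in> leaf p"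
  by (auto simp: leaf_def)

lemma leaf_eq: "q \<in> leaf p \<Longrightarrow> leaf q = leaf p"
  using leaf_sym leaf_trans by blast

lemma saturated_leaf_subset: "saturated A \<Longrightarrow> p \<in> A \<Longrightarrow> leaf p \<subseteq> A"
proof
  fix q assume A: "saturated A" "p \<in> A" "q \<in> leaf p"
  from \<open>q \<in> leaf p\<close> have "plaque_rel\<^sup>*\<^sup>* p q" by (simp add: leaf_def)
  then show "q \<in> A"
    by (induction rule: rtranclp_induct) (use A in \<open>auto simp: saturated_def\<close>)
qed

lemma saturated_topspace: "saturated (topspace E)"
  unfolding saturated_def plaque_rel_def using chart_subset by blast

lemma leaf_subset: "p \<in> topspace E \<Longrightarrow> leaf p \<subseteq> topspace E"
  using saturated_leaf_subset saturated_topspace by blast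

lemma is_leaf_leaf: "p \<in> topspace E \<Longrightarrow> is_leaf (leaf p)"
  by (auto simp: is_leaf_def)

lemma is_leaf_subset: "is_leaf l \<Longrightarrow> l \<subseteq> topspace E"
  using leaf_subset by (auto simp: is_leaf_def)

lemma is_leaf_nonempty: "is_leaf l \<Longrightarrow> l \<noteq> {}"
  unfolding is_leaf_def using leaf_refl by blast

lemma is_leaf_eq: "is_leaf l \<Longrightarrow> p \<in> l \<Longrightarrow> l = leaf p"
  unfolding is_leaf_def using leaf_eq by blast

lemma is_leaf_disjoint: "is_leaf l \<Longrightarrow> is_leaf m \<Longrightarrow> l \<noteq> m \<Longrightarrow> l \<inter> m = {}"
  using is_leaf_eq by blast

lemma is_leaf_saturated: "is_leaf l \<Longrightarrow> saturated l"
  unfolding is_leaf_def saturated_def leaf_def by (auto intro: rtranclp.rtrancl_into_rtrancl)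

lemma saturated_leaf_cases:
  assumes "saturated A" "is_leaf l" shows "l \<subseteq> A \<or> l \<inter> A = {}"
  using assms saturated_leaf_subset is_leaf_eq by blast

lemma chart_beyond:
  assumes "(U, y) \<in> C" "openin E V" "p \<in> U" "p \<in> V"
  shows "\<exists>q\<in>U \<inter> V. y q < y p" "\<exists>q\<in>U \<inter> V. y p < y q"
proof -
  have o: "open (y ` (U \<inter> V))"
    using assms chart_open_map chart_openin by (metis inf_le1 openin_Int)
  have "y p \<in> y ` (U \<inter> V)" using assms by blast
  with o obtain e where e: "e > 0" "ball (y p) e \<subseteq> y ` (U \<inter> V)"
    using openE by blast
  have "y p - e/2 \<in> ball (y p) e" "y p + e/2 \<in> ball (y p) e" using \<open>e > 0\<close> by (auto simp: dist_real_def)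
  then have "y p - e/2 \<in> y ` (U \<inter> V)" "y p + e/2 \<in> y ` (U \<inter> V)" using e by blast+
  then show "\<exists>q\<in>U \<inter> V. y q < y p" "\<exists>q\<in>U \<inter> V. y p < y q"
    using \<open>e > 0\<close> by (force elim!: imageE)+
qed

lemma chart_openin_less:
  assumes "(U, y) \<in> C"
  shows "openin E {q \<in> U. y q < t}" "openin E {q \<in> U. t < y q}"
proof -
  have *: "openin E {q \<in> U. y q \<in> B}" if "open B" for B
  proof -
    have "openin (subtopology E U) {q \<in> topspace (subtopology E U). y q \<in> B}"
      using chart_continuous[OF assms] that
      by (simp add: continuous_map_def)
    moreover have "{q \<in> topspace (subtopology E U). y q \<in> B} = {q \<in> U. y q \<in> B}" using chart_subset[OF assms] by auto
    ultimately have "openin (subtopology E U) {q \<in> U. y q \<in> B}" by metis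
    then show ?thesis using openin_open_subtopology[OF chart_openin[OF assms]] by blast
  qed
  show "openin E {q \<in> U. y q < t}" using *[of "{..<t}"] by simp
  show "openin E {q \<in> U. t < y q}" using *[of "{t<..}"] by simp
qed

text \<open>
  The side \<open>Q\<close> is one of the two halves into which the leaf \<open>l\<close> divides the space. The last clause makes
  \<open>l\<close> cross a chart at most once, and puts \<open>Q\<close> on exactly one side of it there, which excludes leaves
  with the same half on both sides.
\<close>

definition side :: "'e set \<Rightarrow> 'e set \<Rightarrow> bool" where
  "side l Q \<longleftrightarrow> is_leaf l \<and> openin E Q \<and> openin E (topspace E - l - Q) \<and> Q \<inter> l = {} \<and>
     (\<forall>U y p. (U, y) \<in> C \<longrightarrow> p \<in> U \<longrightarrow> p \<in> l \<longrightarrow>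
        l \<inter> U = {q \<in> U. y q = y p} \<and> (Q \<inter> U = {q \<in> U. y p < y q} \<or> Q \<inter> U = {q \<in> U. y q < y p}))"

definition opp :: "'e set \<Rightarrow> 'e set \<Rightarrow> 'e set" where
  "opp l Q = topspace E - l - Q"

lemma side_is_leaf: "side l Q \<Longrightarrow> is_leaf l"
  and side_openin: "side l Q \<Longrightarrow> openin E Q"
  and side_openin_opp: "side l Q \<Longrightarrow> openin E (opp l Q)"
  and side_disjoint: "side l Q \<Longrightarrow> Q \<inter> l = {}"
  by (auto simp: side_def opp_def)

lemma side_subset: "side l Q \<Longrightarrow> Q \<subseteq> topspace E"
  using side_openin openin_subset by blast

lemma side_chart_leaf:
  "side l Q \<Longrightarrow> (U, y) \<in> C \<Longrightarrow> p \<in> U \<Longrightarrow> p \<in> l \<Longrightarrow> l \<inter> U = {q \<in> U. y q = y p}"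
  by (auto simp: side_def)

lemma side_chart:
  "side l Q \<Longrightarrow> (U, y) \<in> C \<Longrightarrow> p \<in> U \<Longrightarrow> p \<in> l \<Longrightarrow>
    Q \<inter> U = {q \<in> U. y p < y q} \<or> Q \<inter> U = {q \<in> U. y q < y p}"
  by (auto simp: side_def)

lemma opp_opp: "side l Q \<Longrightarrow> opp l (opp l Q) = Q"
  using side_subset side_disjoint unfolding opp_def by blast

lemma topspace_side: "side l Q \<Longrightarrow> topspace E = Q \<union> l \<union> opp l Q"
  using side_subset is_leaf_subset[OF side_is_leaf] unfolding opp_def by blast

lemma side_opp:
  assumes "side l Q" shows "side l (opp l Q)"
proof -
  have "opp l Q \<inter> U = {q \<in> U. y p < y q} \<or> opp l Q \<inter> U = {q \<in> U. y q < y p}"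
    if *: "(U, y) \<in> C" "p \<in> U" "p \<in> l" for U y p
  proof -
    have 1: "q \<in> l \<longleftrightarrow> y q = y p" if "q \<in> U" for q
      using side_chart_leaf[OF assms *] that by blast
    have 2: "opp l Q \<inter> U = {q \<in> U. q \<notin> l \<and> q \<notin> Q}" using chart_subset[OF *(1)] by (auto simp: opp_def)
    from side_chart[OF assms *] show ?thesis
    proof
      assume "Q \<inter> U = {q \<in> U. y p < y q}"
      then have "q \<in> Q \<longleftrightarrow> y p < y q" if "q \<in> U" for q using that by blast
      with 1 2 have "opp l Q \<inter> U = {q \<in> U. y q < y p}" by force
      then show ?thesis ..
    next
      assume "Q \<inter> U = {q \<in> U. y q < y p}"
      then have "q \<in> Q \<longleftrightarrow> y q < y p" if "q \<in> U" for q using that by blast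
      with 1 2 have "opp l Q \<inter> U = {q \<in> U. y p < y q}" by force
      then show ?thesis ..
    qed
  qed
  moreover have "openin E (topspace E - l - opp l Q)"
    using opp_opp[OF assms] side_openin[OF assms] by (simp add: opp_def)
  ultimately show ?thesis
    using assms side_openin_opp[OF assms]
    by (auto simp: side_def[of l "opp l Q"] side_is_leaf side_chart_leaf) (auto simp: opp_def)
qed

lemma openin_separation_connected:
  assumes "connectedin E U" "openin E A" "openin E B" "U \<subseteq> A \<union> B" "A \<inter> B \<inter> U = {}"
  shows "U \<subseteq> A \<or> U \<subseteq> B"
proof (rule ccontr)
  assume "\<not> ?thesis"
  then have "A \<inter> U \<noteq> {}" "B \<inter> U \<noteq> {}" using assms by auto
  then show False using assms unfolding connectedin by blast
qed

text \<open>
  The two halves are open and cover the complement of the leaf, so a connected chart that misses the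
  leaf lies in one of them.
\<close>

lemma side_chart_disjoint:
  assumes "side l Q" "(U, y) \<in> C" "U \<inter> l = {}"
  shows "U \<subseteq> Q \<or> U \<subseteq> opp l Q"
  using openin_separation_connected[OF chart_connected[OF assms(2)] side_openin[OF assms(1)] side_openin_opp[OF assms(1)]]
    assms(3) chart_subset[OF assms(2)] by (auto simp: opp_def)

lemma side_saturated:
  assumes "side l Q" shows "saturated Q"
  unfolding saturated_def
proof (intro allI impI)
  fix p q assume "p \<in> Q" "plaque_rel p q"
  then obtain U y where U: "(U, y) \<in> C" "p \<in> U" "q \<in> U" "y p = y q" by (auto simp: plaque_rel_def)
  show "q \<in> Q"
  proof (cases "U \<inter> l = {}")
    case True
    then show ?thesis using side_chart_disjoint[OF assms U(1)] U \<open>p \<in> Q\<close> by (auto simp: opp_def)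
  next
    case False
    then obtain r where "r \<in> U" "r \<in> l" by blast
    from side_chart[OF assms U(1) this] have "p \<in> Q \<inter> U \<longleftrightarrow> q \<in> Q \<inter> U"
      using U(2-4) by (elim disjE) simp_all
    then show ?thesis using \<open>p \<in> Q\<close> U by blast
  qed
qed

lemma side_meets:
  assumes "side l Q" "openin E V" "p \<in> V" "p \<in> l" shows "V \<inter> Q \<noteq> {}"
proof -
  obtain U y where U: "(U, y) \<in> C" "p \<in> U" "U \<subseteq> V" using charts_base assms by blast
  from side_chart[OF assms(1) U(1,2) assms(4)] chart_beyond[OF U(1) chart_openin[OF U(1)] U(2,2)] show ?thesis
    using U(3) by blast
qed

lemma side_nonempty: "side l Q \<Longrightarrow> Q \<noteq> {}"
  using side_meets[OF _ openin_topspace] is_leaf_nonempty[OF side_is_leaf] is_leaf_subset[OF side_is_leaf] by blast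

lemma leaf_side_cases:
  assumes "side l Q" "is_leaf m" "m \<noteq> l"
  shows "m \<subseteq> Q \<or> m \<subseteq> opp l Q"
  using saturated_leaf_cases[OF side_saturated[OF assms(1)] assms(2)] is_leaf_disjoint[OF side_is_leaf[OF assms(1)] assms(2)] assms(3)
    is_leaf_subset[OF assms(2)] by (auto simp: opp_def)

text \<open>
  If the leaves differ, then \<open>l\<close> lies in the open complement \<open>opp m Q\<close>, although all its points are
  limits of points of \<open>Q\<close>.
\<close>

lemma side_determines_leaf:
  assumes "side l Q" "side m Q" shows "l = m"
proof (rule ccontr)
  assume "l \<noteq> m"
  then have "l \<subseteq> opp m Q"
    using leaf_side_cases[OF assms(2) side_is_leaf[OF assms(1)]] side_disjoint[OF assms(1)] is_leaf_nonempty[OF side_is_leaf[OF assms(1)]] by blast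
  then show False using side_meets[OF assms(1) side_openin_opp[OF assms(2)]] is_leaf_nonempty[OF side_is_leaf[OF assms(1)]]
    by (auto simp: opp_def)
qed

end

locale connected_foliated_space = foliated_space +
  assumes connected: "connected_space E"
begin

lemma clopen_cases:
  assumes "openin E A" "openin E B" "A \<union> B = topspace E" "A \<inter> B = {}"
  shows "A = {} \<or> B = {}"
  using connected assms unfolding connected_space_def by (metis subset_refl)

text \<open>
  Where \<open>Q\<close> and \<open>M\<close> agree and where \<open>Q\<close> agrees with the complement of \<open>M\<close> are both open conditions,
  including at points of the leaf, and they exclude each other. So one of them holds everywhere.
\<close>

lemma side_unique:
  assumes "side l Q" "side l M" shows "M = Q \<or> M = opp l Q"
proof -
  define A where "A = {p. \<exists>W. openin E W \<and> p \<in> W \<and> Q \<inter> W = M \<inter> W}"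
  define B where "B = {p. \<exists>W. openin E W \<and> p \<in> W \<and> Q \<inter> W = opp l M \<inter> W}"
  have oA: "openin E A" "openin E B"
    unfolding A_def B_def by (subst openin_subopen, blast)+
  have o: "openin E Q" "openin E M" "openin E (opp l Q)" "openin E (opp l M)"
    using assms side_openin side_openin_opp by blast+
  have AB: "p \<in> A \<or> p \<in> B" if "p \<in> topspace E" for p
  proof -
    consider "p \<in> Q" "p \<in> M" | "p \<in> Q" "p \<in> opp l M" | "p \<in> opp l Q" "p \<in> M" | "p \<in> opp l Q" "p \<in> opp l M" | "p \<in> l"
      using \<open>p \<in> topspace E\<close> unfolding opp_def by blast
    then show ?thesis
    proof cases
      case 1
      then have "p \<in> A" unfolding A_def using o by (intro CollectI exI[of _ "Q \<inter> M"]) (auto intro!: openin_Int)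
      then show ?thesis ..
    next
      case 2
      then have "p \<in> B" unfolding B_def using o
        by (intro CollectI exI[of _ "Q \<inter> opp l M"] conjI openin_Int) auto
      then show ?thesis ..
    next
      case 3
      then have "p \<in> B" unfolding B_def using o
        by (intro CollectI exI[of _ "opp l Q \<inter> M"] conjI openin_Int) (auto simp: opp_def)
      then show ?thesis ..
    next
      case 4
      then have "p \<in> A" unfolding A_def using o
        by (intro CollectI exI[of _ "opp l Q \<inter> opp l M"] conjI openin_Int) (auto simp: opp_def)
      then show ?thesis ..
    next
      case 5
      obtain U y where U: "(U, y) \<in> C" "p \<in> U" using chart_at[OF \<open>p \<in> topspace E\<close>] by blast
      note c = side_chart[OF assms(1) U 5] side_chart[OF assms(2) U 5] side_chart[OF side_opp[OF assms(2)] U 5]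
      have "M \<inter> U \<inter> (opp l M \<inter> U) = {}" by (auto simp: opp_def)
      moreover have "M \<inter> U \<noteq> {}" using side_meets[OF assms(2) chart_openin[OF U(1)] U(2) 5] by blast
      \<comment> \<open>Three sets, each an upper or a lower half of \<open>U\<close>, cannot be pairwise distinct.\<close>
      moreover have gen: "A = B \<or> A = D"
        if "A = X \<or> A = Y" "B = X \<or> B = Y" "D = X \<or> D = Y" "B \<inter> D = {}" "B \<noteq> {}" for A B D X Y :: "'a set"
        using that by auto
      ultimately have "Q \<inter> U = M \<inter> U \<or> Q \<inter> U = opp l M \<inter> U" by (intro gen[OF c])
      then show ?thesis unfolding A_def B_def using U chart_openin by blast
    qed
  qed
  have "A \<inter> B = {}"
  proof (rule ccontr)
    assume "A \<inter> B \<noteq> {}"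
    then obtain p V W where *: "openin E W" "p \<in> W" "Q \<inter> W = M \<inter> W" "openin E V" "p \<in> V" "Q \<inter> V = opp l M \<inter> V"
      by (auto simp: A_def B_def)
    have "Q \<inter> (V \<inter> W) = {}" using * by (auto simp: opp_def)
    moreover have "M \<inter> (V \<inter> W) = {}" using * by (auto simp: opp_def)
    moreover have "opp l M \<inter> (V \<inter> W) = {}" using * by (auto simp: opp_def)
    moreover have "p \<in> topspace E" using * openin_subset by blast
    ultimately have "p \<in> l" using * by (auto simp: opp_def)
    then show False using side_meets[OF assms(1), of "V \<inter> W" p] \<open>Q \<inter> (V \<inter> W) = {}\<close> * by auto
  qed
  moreover have AB': "A \<union> B = topspace E" using AB oA openin_subset by blast
  ultimately have "A = {} \<or> B = {}" using clopen_cases oA by blast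
  then show ?thesis
  proof
    assume "A = {}"
    then have "p \<in> Q \<longleftrightarrow> p \<in> opp l M" if "p \<in> topspace E" for p
      using AB' that by (auto simp: B_def)
    then have "Q = opp l M" using side_subset[OF assms(1)] by (auto simp: opp_def)
    then show ?thesis using opp_opp[OF assms(2)] by simp
  next
    assume "B = {}"
    then have "p \<in> Q \<longleftrightarrow> p \<in> M" if "p \<in> topspace E" for p
      using AB' that by (auto simp: A_def)
    then show ?thesis using side_subset[OF assms(1)] side_subset[OF assms(2)] by blast
  qed
qed

text \<open>
  Since neither leaf enters the other's side, \<open>Q \<inter> M\<close> is closed as well as open. The other three
  relative positions of two leaves reduce to this one by passing to opposite sides.
\<close>

lemma sides_disjoint:
  assumes Q: "side l Q" and M: "side m M" and "l \<noteq> m" "l \<inter> M = {}" "m \<inter> Q = {}"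
  shows "Q \<inter> M = {}"
proof -
  have lm: "l \<inter> m = {}" using is_leaf_disjoint assms side_is_leaf by metis
  have l: "l \<subseteq> topspace E" "m \<subseteq> topspace E" using is_leaf_subset Q M side_is_leaf by blast+
  have "(Q \<inter> M) \<union> (opp l Q \<union> opp m M) = topspace E"
    using side_subset[OF Q] side_subset[OF M] l lm assms(4,5) by (auto simp: opp_def)
  moreover have "(Q \<inter> M) \<inter> (opp l Q \<union> opp m M) = {}" by (auto simp: opp_def)
  moreover have "openin E (Q \<inter> M)" "openin E (opp l Q \<union> opp m M)"
    using side_openin side_openin_opp Q M by blast+
  ultimately have "Q \<inter> M = {} \<or> opp l Q \<union> opp m M = {}" by (metis clopen_cases)
  then show ?thesis using side_nonempty[OF side_opp[OF Q]] by blast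
qed

lemma sides_nested:
  assumes Q: "side l Q" and M: "side m M" and "l \<noteq> m" "l \<inter> opp m M = {}" "m \<inter> Q = {}"
  shows "Q \<union> l \<subseteq> M"
proof -
  have "Q \<inter> opp m M = {}" using sides_disjoint[OF Q side_opp[OF M]] assms by blast
  then show ?thesis using assms side_subset[OF Q] is_leaf_subset[OF side_is_leaf[OF Q]]
    is_leaf_disjoint[OF side_is_leaf[OF Q] side_is_leaf[OF M]] by (auto simp: opp_def)
qed

lemma sides_cover:
  assumes Q: "side l Q" and M: "side m M" and "l \<noteq> m" "l \<inter> opp m M = {}" "m \<inter> opp l Q = {}"
  shows "opp l Q \<inter> opp m M = {}" "Q \<union> M = topspace E"
proof -
  show 1: "opp l Q \<inter> opp m M = {}" using sides_disjoint[OF side_opp[OF Q] side_opp[OF M]] assms by blast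
  have "l \<inter> m = {}" using is_leaf_disjoint[OF side_is_leaf[OF Q] side_is_leaf[OF M]] assms(3) by blast
  then show "Q \<union> M = topspace E" using 1 assms(4,5) side_subset[OF Q] side_subset[OF M]
    unfolding opp_def by blast
qed

text \<open>
  Four relative positions are possible for the sides of two distinct leaves, according to the side in
  which each leaf lies with respect to the other.
\<close>

lemma sides_cases:
  assumes Q: "side l Q" and M: "side m M" and "l \<noteq> m"
  obtains "Q \<inter> M = {}" | "Q \<union> l \<subseteq> M" | "M \<union> m \<subseteq> Q" | "opp l Q \<inter> opp m M = {}" "Q \<union> M = topspace E"
proof -
  have "l \<inter> M = {} \<or> l \<inter> opp m M = {}" "m \<inter> Q = {} \<or> m \<inter> opp l Q = {}"
    using leaf_side_cases[OF M side_is_leaf[OF Q]] leaf_side_cases[OF Q side_is_leaf[OF M]] assms(3)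
    by (auto simp: opp_def)
  then show thesis
    using that sides_disjoint[OF assms] sides_nested[OF assms] sides_nested[OF M Q] sides_cover[OF assms] assms(3) by blast
qed

lemma side_wrt_leaf:
  assumes Q: "side l Q" and M: "side m M" and "m \<inter> Q = {}"
  shows "Q \<subseteq> M \<or> Q \<subseteq> opp m M"
proof (cases "l = m")
  case True
  then show ?thesis using side_unique[of m M Q] Q M by auto
next
  case False
  have "l \<subseteq> M \<or> l \<subseteq> opp m M"
    using leaf_side_cases[OF M side_is_leaf[OF Q]] False by blast
  then show ?thesis
  proof
    assume "l \<subseteq> M"
    then have "l \<inter> opp m M = {}" by (auto simp: opp_def)
    then show ?thesis using sides_nested[OF Q M False] assms by blast
  next
    assume "l \<subseteq> opp m M"
    then have "l \<inter> opp m (opp m M) = {}" by (auto simp: opp_def)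
    then show ?thesis using sides_nested[OF Q side_opp[OF M] False] assms by blast
  qed
qed

end

section \<open>Nested families of sides and their frontier leaves\<close>

context connected_foliated_space
begin

definition side_chain :: "'a set set \<Rightarrow> bool" where
  "side_chain D \<longleftrightarrow> (\<forall>Q\<in>D. \<exists>l. side l Q) \<and> (\<forall>Q\<in>D. \<forall>M\<in>D. Q \<subseteq> M \<or> M \<subseteq> Q)"

definition adherent :: "'a set \<Rightarrow> 'a \<Rightarrow> bool" where
  "adherent T p \<longleftrightarrow> (\<forall>V. openin E V \<longrightarrow> p \<in> V \<longrightarrow> V \<inter> T \<noteq> {})"

lemma side_chain_openin: "side_chain D \<Longrightarrow> openin E (\<Union>D)"
  unfolding side_chain_def by (intro openin_Union) (use side_openin in blast)

lemma side_adherent: "side l Q \<Longrightarrow> p \<in> l \<Longrightarrow> adherent Q p"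
  unfolding adherent_def using side_meets by blast

lemma adherent_disjoint: "adherent T p \<Longrightarrow> openin E V \<Longrightarrow> V \<inter> T = {} \<Longrightarrow> p \<notin> V"
  unfolding adherent_def by blast

lemma side_chainD:
  "side_chain D \<Longrightarrow> Q \<in> D \<Longrightarrow> \<exists>l. side l Q"
  "side_chain D \<Longrightarrow> Q \<in> D \<Longrightarrow> M \<in> D \<Longrightarrow> Q \<subseteq> M \<or> M \<subseteq> Q"
  by (simp_all add: side_chain_def)

lemma side_chain_saturated:
  assumes "side_chain D" shows "saturated (\<Union>D)"
  unfolding saturated_def
proof (intro allI impI)
  fix p q assume p: "p \<in> \<Union>D" "plaque_rel p q"
  then obtain Q where Q: "Q \<in> D" "p \<in> Q" by blast
  then obtain l where "side l Q" using side_chainD(1)[OF assms] by blast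
  then have "q \<in> Q" using side_saturated p(2) Q(2) unfolding saturated_def by blast
  then show "q \<in> \<Union>D" using Q(1) by blast
qed

lemma side_chain_wrt_leaf:
  assumes "side_chain D" "side n M" "n \<inter> \<Union>D = {}"
  shows "\<Union>D \<subseteq> M \<or> \<Union>D \<subseteq> opp n M"
proof -
  have 1: "Q \<subseteq> M \<or> Q \<subseteq> opp n M" if QD: "Q \<in> D" for Q
  proof -
    obtain l where "side l Q" using side_chainD(1)[OF assms(1) QD] by blast
    moreover have "n \<inter> Q = {}" using assms(3) QD by blast
    ultimately show ?thesis using side_wrt_leaf assms(2) by blast
  qed
  have 2: "M \<inter> opp n M = {}" by (auto simp: opp_def)
  show ?thesis
  proof (rule ccontr)
    assume "\<not> ?thesis"
    then obtain Q1 Q2 where Q: "Q1 \<in> D" "\<not> Q1 \<subseteq> M" "Q2 \<in> D" "\<not> Q2 \<subseteq> opp n M" by blast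
    then have "Q1 \<subseteq> opp n M" "Q2 \<subseteq> M" using 1 by blast+
    moreover have "Q1 \<subseteq> Q2 \<or> Q2 \<subseteq> Q1" using side_chainD(2)[OF assms(1) Q(1,3)] .
    ultimately show False using Q by blast
  qed
qed

definition upset :: "'a set \<Rightarrow> 'a set \<Rightarrow> ('a \<Rightarrow> real) \<Rightarrow> bool" where
  "upset A U y \<longleftrightarrow> (\<forall>q\<in>U. \<forall>r\<in>U. q \<in> A \<longrightarrow> y q \<le> y r \<longrightarrow> r \<in> A)"

definition downset :: "'a set \<Rightarrow> 'a set \<Rightarrow> ('a \<Rightarrow> real) \<Rightarrow> bool" where
  "downset A U y \<longleftrightarrow> (\<forall>q\<in>U. \<forall>r\<in>U. q \<in> A \<longrightarrow> y r \<le> y q \<longrightarrow> r \<in> A)"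

lemma side_upset_or_downset:
  assumes "side l Q" "(U, y) \<in> C"
  shows "upset Q U y \<or> downset Q U y"
proof (cases "U \<inter> l = {}")
  case True
  then show ?thesis using side_chart_disjoint[OF assms] by (auto simp: upset_def opp_def)
next
  case False
  then obtain p where p: "p \<in> U" "p \<in> l" by blast
  from side_chart[OF assms p] show ?thesis
  proof
    assume "Q \<inter> U = {q \<in> U. y p < y q}"
    then have "q \<in> Q \<longleftrightarrow> y p < y q" if "q \<in> U" for q using that by blast
    then show ?thesis by (auto simp: upset_def)
  next
    assume "Q \<inter> U = {q \<in> U. y q < y p}"
    then have "q \<in> Q \<longleftrightarrow> y q < y p" if "q \<in> U" for q using that by blast
    then show ?thesis by (auto simp: downset_def)
  qed
qed

text \<open>
  A single side meets a chart in an upper or in a lower set of the transverse coordinate. If a chain contains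
  nonempty sets of both kinds in a chart, the larger of the two is the whole chart; so the union is again
  an upper or a lower set.
\<close>

lemma side_chain_upset_or_downset:
  assumes D: "side_chain D" and U: "(U, y) \<in> C"
  shows "upset (\<Union>D) U y \<or> downset (\<Union>D) U y"
proof (cases "\<forall>Q\<in>D. upset Q U y")
  case True
  then have "upset (\<Union>D) U y" unfolding upset_def by blast
  then show ?thesis ..
next
  case False
  have ud: "upset Q U y \<or> downset Q U y" if "Q \<in> D" for Q
    using side_chainD(1)[OF D that] side_upset_or_downset[OF _ U] by blast
  from False obtain Q0 where Q0: "Q0 \<in> D" "\<not> upset Q0 U y" by blast
  then obtain q r where q: "q \<in> U" "r \<in> U" "q \<in> Q0" by (auto simp: upset_def)
  have d0: "downset Q0 U y" using Q0 ud by blast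
  have "r' \<in> \<Union>D" if *: "q' \<in> U" "r' \<in> U" "q' \<in> Q" "Q \<in> D" "y r' \<le> y q'" for q' r' Q
  proof (cases "downset Q U y")
    case True
    then show ?thesis using * unfolding downset_def by blast
  next
    case False
    then have u: "upset Q U y" using ud * by blast
    consider "Q \<subseteq> Q0" | "Q0 \<subseteq> Q" using side_chainD(2)[OF D Q0(1) *(4)] by blast
    then show ?thesis
    proof cases
      case 1
      then have "r' \<in> Q0" using d0 * unfolding downset_def by blast
      then show ?thesis using Q0 by blast
    next
      case 2
      have "r' \<in> Q"
      proof (cases "y r' \<le> y q")
        case True
        then have "r' \<in> Q0" using d0 * q unfolding downset_def by blast
        then show ?thesis using 2 by blast
      next
        case False
        then have "y q \<le> y r'" by simp
        then show ?thesis using u q 2 * unfolding upset_def by blast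
      qed
      then show ?thesis using * by blast
    qed
  qed
  then have "downset (\<Union>D) U y" unfolding downset_def by blast
  then show ?thesis ..
qed

text \<open>
  A leaf \<open>n\<close> in the frontier of the union is a genuine boundary of it: near \<open>n\<close> the union
  contains points arbitrarily close to \<open>n\<close> on the side \<open>M\<close>, and being an upper or lower set not
  containing \<open>n\<close>, it fills all of \<open>M\<close> in the chart.
\<close>

lemma side_chain_adjacent:
  assumes D: "side_chain D" and M: "side n M" and sub: "\<Union>D \<subseteq> M" and p: "p \<in> n" "adherent (\<Union>D) p"
    and U: "(U, y) \<in> C" "p \<in> U"
  shows "\<Union>D \<inter> U = M \<inter> U"
proof -
  have pT: "p \<notin> \<Union>D" using sub side_disjoint[OF M] p by blast
  have *: "M \<inter> U \<subseteq> \<Union>D" if z: "(U, z) \<in> C" and Mz: "M \<inter> U = {q \<in> U. z p < z q}" for z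
  proof
    fix q assume "q \<in> M \<inter> U"
    then have q: "q \<in> U" "z p < z q" using Mz by blast+
    have "openin E {r \<in> U. z r < z q}" by (rule chart_openin_less[OF z])
    then obtain r where r: "r \<in> U" "z r < z q" "r \<in> \<Union>D"
      using p(2) q U(2) unfolding adherent_def by blast
    have "r \<in> M \<inter> U" using r sub by blast
    then have "z p < z r" unfolding Mz by blast
    from side_chain_upset_or_downset[OF D z] show "q \<in> \<Union>D"
    proof
      assume "upset (\<Union>D) U z"
      then show ?thesis using r q unfolding upset_def by (meson less_imp_le)
    next
      assume "downset (\<Union>D) U z"
      then have "p \<in> \<Union>D" using r \<open>z p < z r\<close> U(2) unfolding downset_def by (meson less_imp_le)
      then show ?thesis using pT by blast
    qed
  qed
  from side_chart[OF M U p(1)] have "M \<inter> U \<subseteq> \<Union>D"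
  proof
    assume "M \<inter> U = {q \<in> U. y p < y q}"
    then show ?thesis by (rule *[OF U(1)])
  next
    assume "M \<inter> U = {q \<in> U. y q < y p}"
    then show ?thesis using *[OF chart_reverse[OF U(1)]] by simp
  qed
  then show ?thesis using sub by blast
qed

lemma side_chain_leaf_adherent:
  assumes D: "side_chain D" and M: "side n M" and sub: "\<Union>D \<subseteq> M" and p: "p \<in> n" "adherent (\<Union>D) p"
    and q: "q \<in> n"
  shows "adherent (\<Union>D) q"
proof -
  have "r \<in> {q. q \<in> n \<and> adherent (\<Union>D) q}" if *: "s \<in> {q. q \<in> n \<and> adherent (\<Union>D) q}" "plaque_rel s r" for r s
  proof -
    have s: "s \<in> n" "adherent (\<Union>D) s" using * by auto
    have r: "r \<in> n" using is_leaf_saturated[OF side_is_leaf[OF M]] s * unfolding saturated_def by blast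
    obtain U y where U: "(U, y) \<in> C" "s \<in> U" "r \<in> U" using * unfolding plaque_rel_def by blast
    have eq: "\<Union>D \<inter> U = M \<inter> U" using side_chain_adjacent[OF D M sub s U(1,2)] .
    have "V \<inter> \<Union>D \<noteq> {}" if "openin E V" "r \<in> V" for V
      using side_meets[OF M, of "V \<inter> U" r] that U chart_openin[OF U(1)] r eq by blast
    then show ?thesis using r by (simp add: adherent_def)
  qed
  then have "saturated {q. q \<in> n \<and> adherent (\<Union>D) q}" unfolding saturated_def by blast
  from saturated_leaf_subset[OF this] p show ?thesis
    using q is_leaf_eq[OF side_is_leaf[OF M] p(1)] by blast
qed

definition separable_leaves :: bool where
  "separable_leaves \<longleftrightarrow> (\<forall>l. is_leaf l \<longrightarrow> (\<exists>Q. side l Q))"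

text \<open>
  The union of a chain of sides need not be a side, since its frontier may consist of many leaves
  when the leaf space is not Hausdorff. But each point outside is separated from the union by one of these
  leaves: the set \<open>Z\<close> of points that are not cut off by any frontier leaf is open, as no such point is in the closure
  of the union, and so is its complement.
\<close>

lemma side_chain_separation:
  assumes sep: separable_leaves and D: "side_chain D" and ne: "\<Union>D \<noteq> {}" and z: "z \<in> topspace E" "z \<notin> \<Union>D"
  obtains n M where "side n M" "\<Union>D \<subseteq> M" "z \<notin> M" "\<And>p. p \<in> n \<Longrightarrow> adherent (\<Union>D) p"
proof (rule ccontr)
  assume no: "\<not> thesis"
  \<comment> \<open>\<open>Fr n M\<close>: the leaf \<open>n\<close> is in the frontier of the union, which lies on the side \<open>M\<close>.\<close>
  define Fr where "Fr n M \<longleftrightarrow> side n M \<and> \<Union>D \<subseteq> M \<and> (\<forall>p\<in>n. adherent (\<Union>D) p)" for n M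
  define Z where "Z = {z \<in> topspace E. z \<notin> \<Union>D \<and> (\<forall>n M. Fr n M \<longrightarrow> z \<in> M)}"
  have "z \<in> Z" using no that z unfolding Z_def Fr_def by blast
  have "\<exists>T. openin E T \<and> w \<in> T \<and> T \<subseteq> Z" if w: "w \<in> Z" for w
  proof -
    have w': "w \<in> topspace E" "w \<notin> \<Union>D" "\<And>n M. Fr n M \<Longrightarrow> w \<in> M" using w unfolding Z_def by auto
    \<comment> \<open>Otherwise the leaf of \<open>w\<close> is itself a frontier leaf and \<open>w\<close> is cut off by it.\<close>
    have "\<not> adherent (\<Union>D) w"
    proof
      assume a: "adherent (\<Union>D) w"
      have lf: "is_leaf (leaf w)" using w' is_leaf_leaf by blast
      then obtain M0 where M0: "side (leaf w) M0" using sep unfolding separable_leaves_def by blast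
      have "leaf w \<inter> \<Union>D = {}"
        using saturated_leaf_cases[OF side_chain_saturated[OF D] lf] w'(2) leaf_refl by blast
      from side_chain_wrt_leaf[OF D M0 this] have "\<exists>M. side (leaf w) M \<and> \<Union>D \<subseteq> M"
      proof
        assume "\<Union>D \<subseteq> M0"
        then show ?thesis using M0 by blast
      next
        assume "\<Union>D \<subseteq> opp (leaf w) M0"
        then show ?thesis using side_opp[OF M0] by blast
      qed
      then obtain M where M: "side (leaf w) M" "\<Union>D \<subseteq> M" by (elim exE conjE)
      have adh: "adherent (\<Union>D) q" if "q \<in> leaf w" for q
        using side_chain_leaf_adherent[OF D M leaf_refl a that] .
      have "Fr (leaf w) M" unfolding Fr_def using M adh by simp
      from w'(3)[OF this] show False using side_disjoint[OF M(1)] leaf_refl[of w] by blast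
    qed
    then obtain V where V: "openin E V" "w \<in> V" "V \<inter> \<Union>D = {}" unfolding adherent_def by blast
    then obtain U y where U: "(U, y) \<in> C" "w \<in> U" "U \<subseteq> V" using charts_base by blast
    have "U \<subseteq> M" if F: "Fr n M" for n M
    proof -
      have "U \<inter> n = {}" using F V U(3) unfolding Fr_def adherent_def by blast
      then have "U \<subseteq> M \<or> U \<subseteq> opp n M" using side_chart_disjoint[OF _ U(1)] F unfolding Fr_def by blast
      then show ?thesis using w'(3)[OF F] U(2) unfolding opp_def by blast
    qed
    then have "U \<subseteq> Z" unfolding Z_def using V U(3) chart_subset[OF U(1)] by blast
    then show ?thesis using U chart_openin by blast
  qed
  then have oZ: "openin E Z" by (subst openin_subopen) blast
  have "\<exists>T. openin E T \<and> w \<in> T \<and> T \<subseteq> topspace E - Z" if w: "w \<in> topspace E - Z" for w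
  proof (cases "w \<in> \<Union>D")
    case True
    have "\<Union>D \<subseteq> topspace E - Z" using openin_subset[OF side_chain_openin[OF D]] unfolding Z_def by blast
    then show ?thesis using True side_chain_openin[OF D] by blast
  next
    case False
    then obtain n M where F: "Fr n M" "w \<notin> M" using w unfolding Z_def by blast
    then have M: "side n M" unfolding Fr_def by blast
    have 1: "opp n M \<inter> Z = {}" "n \<inter> Z = {}" using F side_disjoint[OF M] unfolding Z_def opp_def by blast+
    show ?thesis
    proof (cases "w \<in> n")
      case False
      then have "w \<in> opp n M" using w F(2) by (auto simp: opp_def)
      moreover have "opp n M \<subseteq> topspace E - Z" using 1 by (auto simp: opp_def)
      ultimately show ?thesis using side_openin_opp[OF M] by blast
    next
      case True
      obtain U y where U: "(U, y) \<in> C" "w \<in> U" using chart_at w by blast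
      have "\<Union>D \<inter> U = M \<inter> U"
        using side_chain_adjacent[OF D M _ True _ U] F(1) True unfolding Fr_def by blast
      moreover have "\<Union>D \<inter> Z = {}" unfolding Z_def by blast
      ultimately have "U \<inter> Z = {}" using 1 topspace_side[OF M] chart_subset[OF U(1)] by blast
      then show ?thesis using U chart_openin[OF U(1)] chart_subset[OF U(1)] by blast
    qed
  qed
  then have "openin E (topspace E - Z)" by (subst openin_subopen) blast
  then have "Z = {} \<or> topspace E - Z = {}"
    using clopen_cases[OF oZ] openin_subset[OF oZ] by blast
  moreover have "\<Union>D \<subseteq> topspace E - Z" using openin_subset[OF side_chain_openin[OF D]] unfolding Z_def by blast
  ultimately show False using ne \<open>z \<in> Z\<close> by blast
qed

end

section \<open>Automorphisms of a foliated space\<close>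

context foliated_space
begin

text \<open>
  The inverse \<open>f'\<close> is carried along, since \<open>f\<close> is a total function that is controlled on the space only.
\<close>

definition automorphism :: "('e \<Rightarrow> 'e) \<Rightarrow> ('e \<Rightarrow> 'e) \<Rightarrow> bool" where
  "automorphism f f' \<longleftrightarrow> (\<forall>p\<in>topspace E. f p \<in> topspace E \<and> f' p \<in> topspace E \<and> f' (f p) = p \<and> f (f' p) = p) \<and>
     (\<forall>V. openin E V \<longrightarrow> openin E (f ` V) \<and> openin E (f' ` V)) \<and>
     (\<forall>U y. (U, y) \<in> C \<longrightarrow> (f ` U, y \<circ> f') \<in> C \<and> (f' ` U, y \<circ> f) \<in> C)"

lemma automorphism_sym: "automorphism f f' \<Longrightarrow> automorphism f' f"
  unfolding automorphism_def by blast

lemma automorphism_in: "automorphism f f' \<Longrightarrow> p \<in> topspace E \<Longrightarrow> f p \<in> topspace E"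
  and automorphism_inv: "automorphism f f' \<Longrightarrow> p \<in> topspace E \<Longrightarrow> f' (f p) = p"
  and automorphism_openin: "automorphism f f' \<Longrightarrow> openin E V \<Longrightarrow> openin E (f ` V)"
  and automorphism_chart: "automorphism f f' \<Longrightarrow> (U, y) \<in> C \<Longrightarrow> (f ` U, y \<circ> f') \<in> C"
  unfolding automorphism_def by blast+

lemma automorphism_inj: "automorphism f f' \<Longrightarrow> inj_on f (topspace E)"
  by (rule inj_on_inverseI[of _ f']) (rule automorphism_inv)

lemma automorphism_image_inv:
  assumes "automorphism f f'" "A \<subseteq> topspace E" shows "f' ` f ` A = A"
proof -
  have "f' (f p) = p" if "p \<in> A" for p using automorphism_inv[OF assms(1)] assms(2) that by blast
  then show ?thesis by (simp add: image_image)
qed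

lemma automorphism_image_Int:
  "automorphism f f' \<Longrightarrow> A \<subseteq> topspace E \<Longrightarrow> B \<subseteq> topspace E \<Longrightarrow> f ` (A \<inter> B) = f ` A \<inter> f ` B"
  by (rule inj_on_image_Int[OF automorphism_inj])

lemma automorphism_image_subset: "automorphism f f' \<Longrightarrow> A \<subseteq> topspace E \<Longrightarrow> f ` A \<subseteq> topspace E"
  using automorphism_in by (intro image_subsetI) (metis subsetD)

lemma automorphism_image_topspace:
  assumes "automorphism f f'" shows "f ` topspace E = topspace E"
proof
  show "f ` topspace E \<subseteq> topspace E" using automorphism_image_subset[OF assms] by simp
  have "f' ` topspace E \<subseteq> topspace E" using automorphism_image_subset[OF automorphism_sym[OF assms]] by simp
  then have "f ` f' ` topspace E \<subseteq> f ` topspace E" by (rule image_mono)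
  then show "topspace E \<subseteq> f ` topspace E" using automorphism_image_inv[OF automorphism_sym[OF assms]] by simp
qed

lemma automorphism_image_Diff:
  assumes "automorphism f f'" "A \<subseteq> topspace E" "B \<subseteq> topspace E" shows "f ` (A - B) = f ` A - f ` B"
  by (rule inj_on_image_set_diff[OF automorphism_inj[OF assms(1)]]) (use assms in blast)+

lemma automorphism_plaque_rel: 
  assumes "automorphism f f'" "plaque_rel p q" shows "plaque_rel (f p) (f q)"
proof -
  obtain U y where U: "(U, y) \<in> C" "p \<in> U" "q \<in> U" "y p = y q" using assms unfolding plaque_rel_def by blast
  have "f' (f p) = p" "f' (f q) = q" using automorphism_inv[OF assms(1)] U chart_subset by blast+
  then show ?thesis using U by (intro plaque_relI[OF automorphism_chart[OF assms(1) U(1)]]) auto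
qed

lemma automorphism_leaf_subset: "automorphism f f' \<Longrightarrow> f ` leaf p \<subseteq> leaf (f p)"
proof (rule image_subsetI)
  fix q assume a: "automorphism f f'" "q \<in> leaf p"
  from a(2) have "plaque_rel\<^sup>*\<^sup>* p q" by (simp add: leaf_def)
  then have "plaque_rel\<^sup>*\<^sup>* (f p) (f q)"
    by (induction rule: rtranclp_induct) (auto intro: rtranclp.rtrancl_into_rtrancl automorphism_plaque_rel[OF a(1)])
  then show "f q \<in> leaf (f p)" by (simp add: leaf_def)
qed

lemma automorphism_leaf:
  assumes "automorphism f f'" "p \<in> topspace E" shows "f ` leaf p = leaf (f p)"
proof
  show "f ` leaf p \<subseteq> leaf (f p)" using automorphism_leaf_subset assms by blast
  have "f' ` leaf (f p) \<subseteq> leaf p" using automorphism_leaf_subset[OF automorphism_sym[OF assms(1)], of "f p"] automorphism_inv[OF assms] by simp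
  then have "f ` f' ` leaf (f p) \<subseteq> f ` leaf p" by blast
  then show "leaf (f p) \<subseteq> f ` leaf p"
    using automorphism_image_inv[OF automorphism_sym[OF assms(1)] leaf_subset[OF automorphism_in[OF assms]]] by simp
qed

lemma automorphism_is_leaf: "automorphism f f' \<Longrightarrow> is_leaf l \<Longrightarrow> is_leaf (f ` l)"
  unfolding is_leaf_def using automorphism_leaf automorphism_in by (elim bexE) blast

lemma automorphism_opp:
  assumes "automorphism f f'" "side l Q" shows "opp (f ` l) (f ` Q) = f ` opp l Q"
proof -
  have "l \<subseteq> topspace E" "Q \<subseteq> topspace E" using is_leaf_subset side_is_leaf side_subset assms by blast+
  moreover from this have "topspace E - l \<subseteq> topspace E" by blast
  ultimately show ?thesis unfolding opp_def
    by (simp add: automorphism_image_Diff[OF assms(1)] automorphism_image_topspace[OF assms(1)])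
qed

lemma automorphism_side:
  assumes a: "automorphism f f'" and Q: "side l Q" shows "side (f ` l) (f ` Q)"
proof -
  have sub: "l \<subseteq> topspace E" "Q \<subseteq> topspace E" using is_leaf_subset[OF side_is_leaf[OF Q]] side_subset[OF Q] by blast+
  have ch: "f ` l \<inter> U = {q \<in> U. y q = y p} \<and> (f ` Q \<inter> U = {q \<in> U. y p < y q} \<or> f ` Q \<inter> U = {q \<in> U. y q < y p})"
    if U: "(U, y) \<in> C" "p \<in> U" "p \<in> f ` l" for U y p
  proof -
    let ?U = "f' ` U"
    obtain p0 where p0: "p0 \<in> l" "p = f p0" using U by blast
    have V: "(?U, y \<circ> f) \<in> C" using automorphism_chart[OF automorphism_sym[OF a] U(1)] .
    have "f' p = p0" using p0 automorphism_inv[OF a] sub by blast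
    then have pU: "p0 \<in> ?U" using U(2) by blast
    have UE: "U \<subseteq> topspace E" "?U \<subseteq> topspace E" using chart_subset V U by blast+
    have ff: "f (f' q) = q" if "q \<in> U" for q using automorphism_inv[OF automorphism_sym[OF a]] UE(1) that by blast
    have fU: "f ` ?U = U" using automorphism_image_inv[OF automorphism_sym[OF a] UE(1)] .
    have im: "f ` (A \<inter> ?U) = f ` A \<inter> U" if "A \<subseteq> topspace E" for A
      using automorphism_image_Int[OF a that UE(2)] fU by simp
    have im2: "f ` {q \<in> ?U. R ((y \<circ> f) q)} = {q \<in> U. R (y q)}" for R
    proof -
      have "{q \<in> U. R (y q)} = f ` f' ` {q \<in> U. R (y q)}"
        by (rule automorphism_image_inv[OF automorphism_sym[OF a], symmetric]) (use UE in blast)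
      moreover have "f' ` {q \<in> U. R (y q)} = {q \<in> ?U. R ((y \<circ> f) q)}"
        using ff by force
      ultimately show ?thesis by simp
    qed
    have e: "l \<inter> ?U = {q \<in> ?U. (y \<circ> f) q = (y \<circ> f) p0}" by (rule side_chart_leaf[OF Q V pU p0(1)])
    have 1: "f ` l \<inter> U = {q \<in> U. y q = y p}"
      using im[OF sub(1)] unfolding e im2[of "\<lambda>t. t = (y \<circ> f) p0"] using p0 by simp
    from side_chart[OF Q V pU p0(1)] show ?thesis
    proof
      assume e: "Q \<inter> ?U = {q \<in> ?U. (y \<circ> f) p0 < (y \<circ> f) q}"
      show ?thesis
        using 1 im[OF sub(2)] unfolding e im2[of "\<lambda>t. (y \<circ> f) p0 < t"] using p0 by simp
    next
      assume e: "Q \<inter> ?U = {q \<in> ?U. (y \<circ> f) q < (y \<circ> f) p0}"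
      show ?thesis
        using 1 im[OF sub(2)] unfolding e im2[of "\<lambda>t. t < (y \<circ> f) p0"] using p0 by simp
    qed
  qed
  have "f ` Q \<inter> f ` l = {}" using automorphism_image_Int[OF a sub(2,1)] side_disjoint[OF Q] by simp
  moreover have "openin E (topspace E - f ` l - f ` Q)"
    using automorphism_opp[OF a Q] automorphism_openin[OF a side_openin_opp[OF Q]] by (simp add: opp_def)
  moreover have "is_leaf (f ` l)" "openin E (f ` Q)"
    using automorphism_is_leaf[OF a side_is_leaf[OF Q]] automorphism_openin[OF a side_openin[OF Q]] by blast+
  ultimately show ?thesis using ch unfolding side_def by blast
qed

end

section \<open>A nested side for a fixed-point-free automorphism\<close>

text \<open>
  The hypothetical situation refuted in this section. By freeness and the classification of the relative
  position of \<open>f Q\<close> and \<open>Q\<close>, for every leaf these sides or the opposite ones are disjoint.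
\<close>

locale unnested_automorphism = connected_foliated_space E C
  for E :: "'e topology" and C +
  fixes f f' :: "'e \<Rightarrow> 'e"
  assumes a: "automorphism f f'"
    and sep: "separable_leaves"
    and free: "p \<in> topspace E \<Longrightarrow> f p \<notin> leaf p"
    and unnested: "side l Q \<Longrightarrow> \<not> f ` Q \<union> f ` l \<subseteq> Q \<and> \<not> Q \<union> l \<subseteq> f ` Q"
begin

definition outer :: "'e set \<Rightarrow> bool" where
  "outer Q \<longleftrightarrow> (\<exists>l. side l Q) \<and> f ` Q \<inter> Q = {}"

lemma leaf_moved: assumes "is_leaf l" shows "f ` l \<noteq> l"
proof
  assume e: "f ` l = l"
  obtain p where p: "p \<in> topspace E" "l = leaf p" using assms unfolding is_leaf_def by (elim bexE)
  then have "f p \<in> l" using e leaf_refl[of p] by blast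
  then show False using free[OF p(1)] p(2) by simp
qed

lemma outer_or_opp:
  assumes M: "side n M" shows "outer M \<or> outer (opp n M)"
proof -
  have fM: "side (f ` n) (f ` M)" by (rule automorphism_side[OF a M])
  have ne: "f ` n \<noteq> n" by (rule leaf_moved[OF side_is_leaf[OF M]])
  show ?thesis
  proof (rule sides_cases[OF fM M ne])
    assume "f ` M \<inter> M = {}"
    then show ?thesis using M unfolding outer_def by (intro disjI1 conjI exI)
  next
    assume "opp (f ` n) (f ` M) \<inter> opp n M = {}"
    then have "f ` opp n M \<inter> opp n M = {}" using automorphism_opp[OF a M] by simp
    then show ?thesis using side_opp[OF M] unfolding outer_def by (intro disjI2 conjI exI)
  next
    assume "f ` M \<union> f ` n \<subseteq> M"
    then show ?thesis using unnested[OF M] by (elim conjE notE)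
  next
    assume "M \<union> n \<subseteq> f ` M"
    then show ?thesis using unnested[OF M] by (elim conjE notE)
  qed
qed

lemma outer_subset: "outer Q \<Longrightarrow> Q \<subseteq> topspace E"
  unfolding outer_def using side_subset by (elim conjE exE)

lemma outer_nonempty: "outer Q \<Longrightarrow> Q \<noteq> {}"
  unfolding outer_def using side_nonempty by (elim conjE exE)

lemma outer_preimage:
  assumes "outer Q" shows "outer (f' ` Q)"
proof -
  obtain l where l: "side l Q" using assms unfolding outer_def by (elim conjE exE)
  have Q: "Q \<subseteq> topspace E" by (rule outer_subset[OF assms])
  have 1: "f ` f' ` Q = Q" by (rule automorphism_image_inv[OF automorphism_sym[OF a] Q])
  have "f' ` (f ` Q \<inter> Q) = f' ` f ` Q \<inter> f' ` Q"
    by (rule automorphism_image_Int[OF automorphism_sym[OF a] automorphism_image_subset[OF a Q] Q])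
  then have "f' ` f ` Q \<inter> f' ` Q = {}" using assms by (simp add: outer_def)
  then have "f ` f' ` Q \<inter> f' ` Q = {}" unfolding 1 automorphism_image_inv[OF a Q] .
  then show ?thesis using automorphism_side[OF automorphism_sym[OF a] l] unfolding outer_def by (intro conjI exI)
qed

text \<open>
  Overlapping outer sides cannot cover the space together: a point of both is moved by \<open>f\<close> out of both.
\<close>

lemma outer_nested:
  assumes Q: "outer Q" and M: "outer M" and Q0: "Q0 \<noteq> {}" "Q0 \<subseteq> Q" "Q0 \<subseteq> M"
  shows "Q \<subseteq> M \<or> M \<subseteq> Q"
proof -
  obtain l where l: "side l Q" using Q unfolding outer_def by (elim conjE exE)
  obtain m where m: "side m M" using M unfolding outer_def by (elim conjE exE)
  show ?thesis
  proof (cases "l = m")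
    case True
    then have "M = Q \<or> M = opp l Q" using side_unique l m by simp
    moreover have "M \<noteq> opp l Q" using Q0 by (auto simp: opp_def)
    ultimately show ?thesis by simp
  next
    case False
    show ?thesis
    proof (rule sides_cases[OF l m False])
      assume "Q \<inter> M = {}" then show ?thesis using Q0 by blast
    next
      assume "Q \<union> l \<subseteq> M" then show ?thesis by simp
    next
      assume "M \<union> m \<subseteq> Q" then show ?thesis by simp
    next
      assume c: "Q \<union> M = topspace E"
      obtain x where x: "x \<in> Q0" using Q0 by blast
      then have "f x \<in> f ` Q" "f x \<in> f ` M" using Q0 by blast+
      then have "f x \<notin> Q" "f x \<notin> M" using Q M unfolding outer_def by blast+
      moreover have "f x \<in> topspace E" using automorphism_in[OF a] x Q0 outer_subset[OF Q] by blast
      ultimately show ?thesis using c by blast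
    qed
  qed
qed

lemma outer_chain:
  assumes D: "side_chain D" and o: "\<And>Q. Q \<in> D \<Longrightarrow> outer Q"
  shows "f ` \<Union>D \<inter> \<Union>D = {}"
proof (rule ccontr)
  assume "\<not> ?thesis"
  then obtain x Q M where x: "x \<in> Q" "Q \<in> D" "f x \<in> M" "M \<in> D" by blast
  then consider "Q \<subseteq> M" | "M \<subseteq> Q" using side_chainD(2)[OF D, of Q M] by blast
  then show False
  proof cases
    case 1
    then have "f x \<in> f ` M \<inter> M" using x by blast
    then show False using o[OF x(4)] unfolding outer_def by simp
  next
    case 2
    then have "f x \<in> f ` Q \<inter> Q" using x by blast
    then show False using o[OF x(2)] unfolding outer_def by simp
  qed
qed

text \<open>
  Let \<open>T\<close> be the union of all outer sides containing \<open>Q0\<close>. It is disjoint from \<open>f T\<close>, so a frontier leaf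
  \<open>n\<close> of \<open>T\<close> separates it from a point of \<open>f T\<close>, and then from all of \<open>f T\<close>. Either the side of \<open>n\<close> that contains \<open>T\<close> is outer, or
  the one that contains \<open>f T\<close> is, and then so is its preimage. In both cases an outer side contains \<open>T\<close>, hence is \<open>T\<close>.
\<close>

lemma maximal_outer:
  assumes Q0: "outer Q0"
  obtains m T where "side m T" "outer T" "\<And>M. outer M \<Longrightarrow> T \<subseteq> M \<Longrightarrow> M = T"
proof -
  define D where "D = {Q. outer Q \<and> Q0 \<subseteq> Q}"
  define T where "T = \<Union>D"
  have Q0D: "Q0 \<in> D" using Q0 by (simp add: D_def)
  have D: "side_chain D"
    unfolding side_chain_def
  proof (intro conjI ballI)
    fix Q assume "Q \<in> D" then show "\<exists>l. side l Q" by (simp add: D_def outer_def)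
  next
    fix Q M assume "Q \<in> D" "M \<in> D"
    then show "Q \<subseteq> M \<or> M \<subseteq> Q" using outer_nested[OF _ _ outer_nonempty[OF Q0]] by (simp add: D_def)
  qed
  have D': "side_chain ((`) f ` D)"
    unfolding side_chain_def
  proof (intro conjI ballI)
    fix Q assume "Q \<in> (`) f ` D"
    then obtain Q' where "Q' \<in> D" "Q = f ` Q'" by blast
    moreover from this obtain l where "side l Q'" using side_chainD(1)[OF D] by blast
    ultimately have "side (f ` l) Q" using automorphism_side[OF a] by simp
    then show "\<exists>l. side l Q" by (rule exI)
  next
    fix Q M assume "Q \<in> (`) f ` D" "M \<in> (`) f ` D"
    then obtain Q' M' where "Q' \<in> D" "Q = f ` Q'" "M' \<in> D" "M = f ` M'" by blast
    moreover from this have "Q' \<subseteq> M' \<or> M' \<subseteq> Q'" using side_chainD(2)[OF D] by blast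
    ultimately show "Q \<subseteq> M \<or> M \<subseteq> Q" by (metis image_mono)
  qed
  have fT: "\<Union>((`) f ` D) = f ` T" unfolding T_def by blast
  have oT: "openin E T" unfolding T_def by (rule side_chain_openin[OF D])
  have ofT: "openin E (f ` T)" by (rule automorphism_openin[OF a oT])
  have disj: "f ` T \<inter> T = {}" unfolding T_def by (rule outer_chain[OF D]) (simp add: D_def)
  have "Q0 \<subseteq> T" using Q0D unfolding T_def by (rule Union_upper)
  then have Tne: "T \<noteq> {}" using outer_nonempty[OF Q0] by blast
  then obtain z where z: "z \<in> f ` T" by blast
  have zE: "z \<in> topspace E" "z \<notin> T" using z disj openin_subset[OF ofT] by blast+
  obtain n M where M: "side n M" "T \<subseteq> M" "z \<notin> M" "\<And>p. p \<in> n \<Longrightarrow> adherent T p"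
    using side_chain_separation[OF sep D] Tne zE unfolding T_def by metis
  have "n \<inter> f ` T = {}" using adherent_disjoint[OF M(4) ofT disj] by blast
  then have "f ` T \<subseteq> M \<or> f ` T \<subseteq> opp n M" using side_chain_wrt_leaf[OF D' M(1)] unfolding fT by simp
  then have fTo: "f ` T \<subseteq> opp n M" using z M(3) by blast
  have maxi: "M \<subseteq> T" if "outer M" "Q0 \<subseteq> M" for M
    unfolding T_def by (rule Union_upper) (use that in \<open>simp add: D_def\<close>)
  have "outer T"
  proof (rule disjE[OF outer_or_opp[OF M(1)]])
    assume o: "outer M"
    then have "M \<subseteq> T" using maxi M(2) \<open>Q0 \<subseteq> T\<close> by simp
    then show ?thesis using o M(2) by (simp add: subset_antisym)
  next
    assume "outer (opp n M)"
    then have o: "outer (f' ` opp n M)" by (rule outer_preimage)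
    have "f' ` f ` T \<subseteq> f' ` opp n M" using fTo by (rule image_mono)
    then have s: "T \<subseteq> f' ` opp n M" using automorphism_image_inv[OF a openin_subset[OF oT]] by simp
    then have "f' ` opp n M \<subseteq> T" using maxi o \<open>Q0 \<subseteq> T\<close> by simp
    then have "f' ` opp n M = T" using s by (rule subset_antisym)
    then show ?thesis using o by simp
  qed
  moreover from this obtain m where "side m T" unfolding outer_def by (elim conjE exE)
  moreover have "M = T" if "outer M" "T \<subseteq> M" for M
    using maxi[OF that(1)] that(2) \<open>Q0 \<subseteq> T\<close> by (simp add: subset_antisym)
  ultimately show thesis using that by simp
qed

lemma adherent_image:
  assumes "adherent T p" "p \<in> topspace E" "T \<subseteq> topspace E" shows "adherent (f ` T) (f p)"
  unfolding adherent_def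
proof (intro allI impI)
  fix V assume V: "openin E V" "f p \<in> V"
  have "p \<in> f' ` V" using V(2) automorphism_inv[OF a assms(2)] by (metis imageI)
  then have "f' ` V \<inter> T \<noteq> {}"
    using assms(1) automorphism_openin[OF automorphism_sym[OF a] V(1)] unfolding adherent_def by simp
  then obtain v where "v \<in> V" "f' v \<in> T" by blast
  moreover have "f (f' v) = v" using automorphism_inv[OF automorphism_sym[OF a]] \<open>v \<in> V\<close> openin_subset[OF V(1)] by blast
  ultimately show "V \<inter> f ` T \<noteq> {}" by (metis IntI emptyE imageI)
qed

text \<open>
  The contradiction comes from the leaves immediately beyond the boundary leaf \<open>m\<close> of \<open>T\<close>. By maximality their
  sides away from \<open>T\<close> are outer. The union \<open>R\<close> of these far sides is disjoint from \<open>f R\<close>. On the other hand,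
  the leaf \<open>n\<close> that separates \<open>R\<close> from \<open>f T\<close> has a side that contains \<open>T\<close> and \<open>m\<close> and is too
  large to be outer. So its other side is outer, and the preimage of that side contains \<open>T\<close>, hence equals \<open>T\<close>;
  that is, \<open>n = f m\<close>. So \<open>f\<close> maps the part of \<open>R\<close> near \<open>m\<close> onto the part of \<open>R\<close> near \<open>f m\<close>.
\<close>

lemma no_maximal_outer:
  assumes T: "side m T" "outer T" and maxT: "\<And>M. outer M \<Longrightarrow> T \<subseteq> M \<Longrightarrow> M = T"
  shows False
proof -
  have Tm: "T \<inter> m = {}" by (rule side_disjoint[OF T(1)])
  have lm: "is_leaf m" by (rule side_is_leaf[OF T(1)])
  obtain p where p: "p \<in> m" using is_leaf_nonempty[OF lm] by blast
  have pE: "p \<in> topspace E" using p is_leaf_subset[OF lm] by blast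
  obtain U0 y0 where U0: "(U0, y0) \<in> C" "p \<in> U0" using chart_at[OF pE] by blast
  have "\<exists>y. (U0, y) \<in> C \<and> T \<inter> U0 = {q \<in> U0. y q < y p}"
    using side_chart[OF T(1) U0 p]
  proof
    assume "T \<inter> U0 = {q \<in> U0. y0 p < y0 q}"
    then show ?thesis using chart_reverse[OF U0(1)] by (intro exI[of _ "\<lambda>q. - y0 q"]) simp
  qed (use U0 in blast)
  then obtain U y where U: "(U, y) \<in> C" "p \<in> U" and TU: "T \<inter> U = {q \<in> U. y q < y p}" using U0 by blast
  have mU: "m \<inter> U = {q \<in> U. y q = y p}" by (rule side_chart_leaf[OF T(1) U p])

  \<comment> \<open>For \<open>q\<close> just beyond \<open>m\<close> in the chart \<open>U\<close>, the side \<open>A\<close> of the leaf of \<open>q\<close> faces away from \<open>T\<close>.\<close>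
  define far where "far q A \<longleftrightarrow> side (leaf q) A \<and> T \<union> m \<subseteq> opp (leaf q) A" for q A
  have far_ex: "\<exists>A. far q A" if q: "q \<in> U" "y p < y q" for q
  proof -
    have qE: "q \<in> topspace E" using q chart_subset[OF U(1)] by blast
    have "q \<notin> m \<inter> U" "q \<notin> T \<inter> U" unfolding mU TU using q(2) by simp_all
    then have qn: "q \<notin> m" "q \<notin> T" using q(1) by simp_all
    have lq: "is_leaf (leaf q)" by (rule is_leaf_leaf[OF qE])
    have ne: "m \<noteq> leaf q" using qn leaf_refl by blast
    have qT: "leaf q \<inter> T = {}" using saturated_leaf_cases[OF side_saturated[OF T(1)] lq] qn leaf_refl by blast
    obtain A0 where A0: "side (leaf q) A0" using sep lq unfolding separable_leaves_def by blast
    have "\<exists>A. side (leaf q) A \<and> m \<subseteq> opp (leaf q) A"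
      using leaf_side_cases[OF A0 lm ne]
    proof
      assume "m \<subseteq> A0"
      then show ?thesis using side_opp[OF A0] opp_opp[OF A0] by (intro exI[of _ "opp (leaf q) A0"]) simp
    qed (use A0 in blast)
    then obtain A where A: "side (leaf q) A" "m \<subseteq> opp (leaf q) A" by (elim exE conjE)
    have "m \<inter> opp (leaf q) (opp (leaf q) A) = {}" using A(2) by (auto simp: opp_def)
    from sides_nested[OF T(1) side_opp[OF A(1)] ne this qT] show ?thesis using A(1) unfolding far_def by blast
  qed
  \<comment> \<open>The side facing \<open>T\<close> strictly contains \<open>T\<close>, so by maximality it is not outer.\<close>
  have far_outer: "outer A" if "far q A" for q A
  proof -
    have A: "side (leaf q) A" "T \<union> m \<subseteq> opp (leaf q) A" using that by (simp_all add: far_def)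
    have "\<not> outer (opp (leaf q) A)"
    proof
      assume "outer (opp (leaf q) A)"
      then have "opp (leaf q) A = T" using A(2) by (intro maxT) simp_all
      then show False using A(2) p Tm by blast
    qed
    then show ?thesis using outer_or_opp[OF A(1)] by simp
  qed
  have far_chart: "A \<inter> U = {r \<in> U. y q < y r}" if "far q A" "q \<in> U" "y p < y q" for q A
  proof -
    have A: "side (leaf q) A" "T \<union> m \<subseteq> opp (leaf q) A" using that by (simp_all add: far_def)
    have "p \<notin> A" using A(2) p by (auto simp: opp_def)
    then have "A \<inter> U \<noteq> {r \<in> U. y r < y q}" using that U(2) by blast
    then show ?thesis using side_chart[OF A(1) U(1) that(2) leaf_refl] by simp
  qed
  define D where "D = {A. \<exists>q\<in>U. y p < y q \<and> far q A}"
  have nested: "B \<subseteq> A" if "far q A" "q \<in> U" "y p < y q" "far r B" "r \<in> U" "y q < y r" for q r A B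
  proof -
    have A: "side (leaf q) A" and B: "side (leaf r) B" using that by (simp_all add: far_def)
    have "y p < y r" using that(3,6) by simp
    then have "r \<in> A \<inter> U" "q \<notin> B \<inter> U"
      unfolding far_chart[OF that(1-3)] far_chart[OF that(4,5) \<open>y p < y r\<close>] using that by simp_all
    then have 1: "r \<in> A" "q \<notin> B" using that(2) by simp_all
    have ne: "leaf r \<noteq> leaf q" using 1(1) side_disjoint[OF A] leaf_refl by blast
    have "leaf r \<subseteq> A" by (rule saturated_leaf_subset[OF side_saturated[OF A] 1(1)])
    then have 2: "leaf r \<inter> opp (leaf q) A = {}" by (auto simp: opp_def)
    have 3: "leaf q \<inter> B = {}"
      using saturated_leaf_cases[OF side_saturated[OF B] side_is_leaf[OF A]] 1(2) leaf_refl by blast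
    show ?thesis using sides_nested[OF B A ne 2 3] by simp
  qed
  have D: "side_chain D"
    unfolding side_chain_def
  proof (intro conjI ballI)
    fix A assume "A \<in> D" then show "\<exists>l. side l A" unfolding D_def far_def by blast
  next
    fix A B assume "A \<in> D" "B \<in> D"
    then obtain q r where q: "q \<in> U" "y p < y q" "far q A" and r: "r \<in> U" "y p < y r" "far r B"
      unfolding D_def by blast
    consider "y q < y r" | "y r < y q" | "y q = y r" by linarith
    then show "A \<subseteq> B \<or> B \<subseteq> A"
    proof cases
      case 1 then show ?thesis using nested[OF q(3,1,2) r(3,1)] by simp
    next
      case 2 then show ?thesis using nested[OF r(3,1,2) q(3,1)] by simp
    next
      case 3
      then have "plaque_rel q r" using plaque_relI[OF U(1) q(1) r(1)] by simp
      then have l: "leaf r = leaf q" by (intro leaf_eq) (simp add: leaf_def)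
      then have "B = A \<or> B = opp (leaf q) A" using q(3) r(3) side_unique unfolding far_def by simp
      moreover have "p \<in> opp (leaf q) A" "p \<in> opp (leaf q) B" using q(3) r(3) l p unfolding far_def by auto
      ultimately have "B = A" by (auto simp: opp_def)
      then show ?thesis by simp
    qed
  qed
  define R where "R = \<Union>D"
  have oR: "openin E R" unfolding R_def by (rule side_chain_openin[OF D])
  have RE: "R \<subseteq> topspace E" by (rule openin_subset[OF oR])
  have RT: "R \<inter> (T \<union> m) = {}"
  proof -
    have "A \<inter> (T \<union> m) = {}" if AD: "A \<in> D" for A
    proof -
      obtain q where "far q A" using AD unfolding D_def by blast
      then have "T \<union> m \<subseteq> opp (leaf q) A" by (simp add: far_def)
      then show ?thesis unfolding opp_def by blast
    qed
    then show ?thesis unfolding R_def by blast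
  qed
  have fR: "f ` R \<inter> R = {}" unfolding R_def by (rule outer_chain[OF D]) (use far_outer in \<open>auto simp: D_def\<close>)
  have UR: "r \<in> R" if r: "r \<in> U" "y p < y r" for r
  proof -
    obtain q where q: "q \<in> U" "y p < y q" "y q < y r"
      using chart_beyond(2)[OF U(1) chart_openin_less(1)[OF U(1), of "y r"] U(2)] U(2) r(2) by blast
    obtain A where A: "far q A" using far_ex[OF q(1,2)] by (elim exE)
    have "r \<in> A" using far_chart[OF A q(1,2)] r(1) q(3) by blast
    moreover have "A \<in> D" using A q unfolding D_def by blast
    ultimately show ?thesis unfolding R_def by blast
  qed
  have adp: "adherent R p"
    unfolding adherent_def
  proof (intro allI impI)
    fix V assume "openin E V" "p \<in> V"
    then obtain r where "r \<in> U" "r \<in> V" "y p < y r" using chart_beyond(2)[OF U(1) _ U(2)] by blast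
    then show "V \<inter> R \<noteq> {}" using UR by blast
  qed
  have RT': "R \<subseteq> opp m T" using RT RE by (auto simp: opp_def)
  have Tsub: "T \<subseteq> topspace E" "m \<subseteq> topspace E" using side_subset[OF T(1)] is_leaf_subset[OF lm] by blast+
  have adm: "adherent R q" if "q \<in> m" for q
    using side_chain_leaf_adherent[OF D side_opp[OF T(1)] RT'[unfolded R_def] p adp[unfolded R_def] that]
    unfolding R_def .
  have Rne: "R \<noteq> {}" using adp pE unfolding adherent_def by (metis Int_empty_right openin_topspace)
  have fT: "side (f ` m) (f ` T)" by (rule automorphism_side[OF a T(1)])
  have fTT: "f ` T \<inter> T = {}" using T(2) by (simp add: outer_def)
  \<comment> \<open>The leaf \<open>m\<close> is in the closure of \<open>R\<close>, so \<open>f m\<close> is in the closure of \<open>f R\<close>, which is disjoint from the open set \<open>R\<close>.\<close>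
  have fmR: "f ` m \<inter> R = {}"
  proof -
    have "f q \<notin> R" if "q \<in> m" for q
      using adherent_disjoint[OF adherent_image[OF adm[OF that] _ RE] oR] fR that Tsub by blast
    then show ?thesis by blast
  qed
  \<comment> \<open>If \<open>R\<close> were inside \<open>f T\<close>, then \<open>p \<in> m\<close> would lie in the open set \<open>f T\<close>, which is disjoint from \<open>T\<close>, but \<open>p\<close> is a limit of points of \<open>T\<close>.\<close>
  have fTR: "f ` T \<inter> R = {}"
  proof -
    have "\<not> R \<subseteq> f ` T"
    proof
      assume s: "R \<subseteq> f ` T"
      have "opp (f ` m) (f ` T) \<inter> R = {}" using s by (auto simp: opp_def)
      then have "p \<notin> opp (f ` m) (f ` T)" by (rule adherent_disjoint[OF adp side_openin_opp[OF fT]])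
      moreover have "p \<notin> f ` m"
        using is_leaf_disjoint[OF side_is_leaf[OF fT] lm leaf_moved[OF lm]] p by blast
      ultimately have "p \<in> f ` T" using pE by (simp add: opp_def)
      moreover have "adherent T p" by (rule side_adherent[OF T(1) p])
      ultimately show False using adherent_disjoint[OF _ side_openin[OF fT] fTT] by blast
    qed
    then have "R \<subseteq> opp (f ` m) (f ` T)" using side_chain_wrt_leaf[OF D fT] fmR unfolding R_def by blast
    then show ?thesis by (auto simp: opp_def)
  qed
  obtain z where z: "z \<in> f ` T" using side_nonempty[OF fT] by blast
  then have zE: "z \<in> topspace E" "z \<notin> R" using side_subset[OF fT] fTR by blast+
  obtain n M where M: "side n M" "R \<subseteq> M" "z \<notin> M" "\<And>p. p \<in> n \<Longrightarrow> adherent R p"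
    using side_chain_separation[OF sep D] Rne zE unfolding R_def by metis
  have nfT: "n \<inter> f ` T = {}" using adherent_disjoint[OF M(4) side_openin[OF fT] fTR] by blast
  have nT: "n \<inter> T = {}" using adherent_disjoint[OF M(4) side_openin[OF T(1)]] RT by blast
  have fTM: "f ` T \<subseteq> opp n M" using side_wrt_leaf[OF fT M(1) nfT] z M(3) by blast
  have nm: "m \<noteq> n"
  proof
    assume e: "m = n"
    then have "M = T \<or> M = opp m T" using side_unique[OF T(1)] M(1) by simp
    then have "M = opp m T" using M(2) RT Rne by blast
    then have "opp n M = T" using opp_opp[OF T(1)] e by simp
    then have "f ` T \<subseteq> T" using fTM by simp
    then show False using fTT side_nonempty[OF fT] by blast
  qed
  have mM: "m \<subseteq> M"
  proof -
    have "\<not> m \<subseteq> opp n M"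
    proof
      assume "m \<subseteq> opp n M"
      moreover have "opp n M \<inter> R = {}" using M(2) by (auto simp: opp_def)
      ultimately show False using adherent_disjoint[OF adp side_openin_opp[OF M(1)]] p by blast
    qed
    then show ?thesis using leaf_side_cases[OF M(1) lm nm] by blast
  qed
  have "m \<inter> opp n M = {}" using mM by (auto simp: opp_def)
  then have TM: "T \<union> m \<subseteq> M" by (rule sides_nested[OF T(1) M(1) nm _ nT])
  \<comment> \<open>The side \<open>M\<close> contains \<open>T\<close> and also \<open>m\<close>, so it is larger than the maximal outer side \<open>T\<close>.\<close>
  have "\<not> outer M"
  proof
    assume "outer M"
    then have "M = T" using TM by (intro maxT) simp_all
    then show False using mM p Tm by blast
  qed
  then have "outer (opp n M)" using outer_or_opp[OF M(1)] by simp
  then have o: "outer (f' ` opp n M)" by (rule outer_preimage)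
  have "f' ` f ` T \<subseteq> f' ` opp n M" using fTM by (rule image_mono)
  then have "T \<subseteq> f' ` opp n M" using automorphism_image_inv[OF a Tsub(1)] by simp
  then have e: "f' ` opp n M = T" by (rule maxT[OF o])
  have "f ` f' ` opp n M = opp n M"
    by (rule automorphism_image_inv[OF automorphism_sym[OF a] side_subset[OF side_opp[OF M(1)]]])
  then have oT: "opp n M = f ` T" using e by simp
  then have "side n (f ` T)" using side_opp[OF M(1)] by simp
  then have nfm: "n = f ` m" using side_determines_leaf fT by blast
  have "M = opp n (opp n M)" using opp_opp[OF M(1)] by simp
  then have Meq: "M = f ` opp m T" using oT nfm automorphism_opp[OF a T(1)] by simp
  \<comment> \<open>Near \<open>m\<close> the set \<open>R\<close> is the complement of \<open>T\<close>, and near \<open>f m\<close> it is the complement of \<open>f T\<close>.\<close>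
  have 1: "R \<inter> U = opp m T \<inter> U"
    unfolding R_def by (rule side_chain_adjacent[OF D side_opp[OF T(1)] RT'[unfolded R_def] p adp[unfolded R_def] U])
  have fU: "(f ` U, y \<circ> f') \<in> C" by (rule automorphism_chart[OF a U(1)])
  have fp: "f p \<in> n" "f p \<in> f ` U" using p U(2) nfm by blast+
  have 2: "R \<inter> f ` U = M \<inter> f ` U"
    unfolding R_def by (rule side_chain_adjacent[OF D M(1) M(2)[unfolded R_def] fp(1) M(4)[OF fp(1), unfolded R_def] fU fp(2)])
  have UE: "U \<subseteq> topspace E" by (rule chart_subset[OF U(1)])
  have "f ` (opp m T \<inter> U) = f ` opp m T \<inter> f ` U"
    by (rule automorphism_image_Int[OF a side_subset[OF side_opp[OF T(1)]] UE])
  then have "f ` (R \<inter> U) = R \<inter> f ` U" using 1 2 Meq by simp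
  moreover have "R \<inter> U \<noteq> {}" using adp chart_openin[OF U(1)] U(2) unfolding adherent_def by blast
  ultimately show False using fR by blast
qed

lemma no_points: "topspace E = {}"
proof (rule ccontr)
  assume "topspace E \<noteq> {}"
  then obtain p where "p \<in> topspace E" by blast
  then have "is_leaf (leaf p)" by (rule is_leaf_leaf)
  then obtain Q where "side (leaf p) Q" using sep unfolding separable_leaves_def by blast
  then have "\<exists>Q. outer Q" using outer_or_opp by blast
  then show False using maximal_outer no_maximal_outer by metis
qed

end

context connected_foliated_space
begin

theorem exists_nested_side:
  assumes "automorphism f f'" "separable_leaves" "\<And>p. p \<in> topspace E \<Longrightarrow> f p \<notin> leaf p" "topspace E \<noteq> {}"
  shows "\<exists>l Q. side l Q \<and> (f ` Q \<union> f ` l \<subseteq> Q \<or> Q \<union> l \<subseteq> f ` Q)"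
proof (rule ccontr)
  assume "\<not> ?thesis"
  then interpret unnested_automorphism E C f f'
    using assms by unfold_locales blast+
  show False using no_points assms(4) by simp
qed

end

section \<open>Abelian groups acting freely on the leaf space\<close>

text \<open>
  The set \<open>P\<close> is the positive cone of a left-invariant total order with only finitely many positive elements below
  each positive element. The least positive element \<open>h0\<close> then generates the group, by division with remainder: dividing
  \<open>h\<close> by \<open>h0\<close> on the left removes an element from the initial segment below \<open>h\<close>.
\<close>

lemma (in group) cyclic_of_discrete_positive_cone:
  assumes P: "P \<subseteq> carrier G" and mult: "\<And>h k. h \<in> P \<Longrightarrow> k \<in> P \<Longrightarrow> h \<otimes> k \<in> P"
    and tri: "\<And>h. h \<in> carrier G \<Longrightarrow> h = \<one> \<or> h \<in> P \<or> inv h \<in> P" and one: "\<one> \<notin> P"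
    and fin: "\<And>h. h \<in> P \<Longrightarrow> finite {k \<in> P. k = h \<or> inv k \<otimes> h \<in> P}"
  shows "\<exists>h\<in>carrier G. generate G {h} = carrier G"
proof -
  have gen: "\<exists>h\<in>carrier G. generate G {h} = carrier G" if "h0 \<in> carrier G" "P \<subseteq> generate G {h0}" for h0
  proof (rule bexI[OF _ that(1)])
    have sg: "subgroup (generate G {h0}) G" using generate_is_subgroup that(1) by simp
    have "h \<in> generate G {h0}" if h: "h \<in> carrier G" for h
      using tri[OF h]
    proof (elim disjE)
      assume "h = \<one>" then show ?thesis using generate.one by simp
    next
      assume "h \<in> P" then show ?thesis using \<open>P \<subseteq> generate G {h0}\<close> by blast
    next
      assume "inv h \<in> P"
      then have "inv h \<in> generate G {h0}" using \<open>P \<subseteq> generate G {h0}\<close> by blast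
      then show ?thesis using subgroup.m_inv_closed[OF sg] h inv_inv by metis
    qed
    then show "generate G {h0} = carrier G" using generate_incl[of "{h0}"] that(1) by blast
  qed
  show ?thesis
  proof (cases "P = {}")
    case True
    then show ?thesis using gen[OF one_closed] by simp
  next
    case False
    \<comment> \<open>\<open>I h\<close> is the set of positive elements up to \<open>h\<close>; an element with fewest predecessors is the least one.\<close>
    define I where "I h = {k \<in> P. k = h \<or> inv k \<otimes> h \<in> P}" for h
    have finI: "finite (I h)" if "h \<in> P" for h using fin[OF that] by (simp add: I_def)
    have "\<exists>h0. h0 \<in> P \<and> (\<forall>h. h \<in> P \<longrightarrow> card (I h0) \<le> card (I h))"
      using False by (metis (no_types, lifting) ex_has_least_nat[of "\<lambda>h. h \<in> P" _ "\<lambda>h. card (I h)"] ex_in_conv)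
    then obtain h0 where h0: "h0 \<in> P" "\<And>h. h \<in> P \<Longrightarrow> card (I h0) \<le> card (I h)" by blast
    have h0c: "h0 \<in> carrier G" using h0 P by blast
    have minimal: "k = h0" if k: "k \<in> I h0" for k
    proof (rule ccontr)
      assume ne: "k \<noteq> h0"
      then have kP: "k \<in> P" "inv k \<otimes> h0 \<in> P" using k by (auto simp: I_def)
      have kc: "k \<in> carrier G" using kP P by blast
      have "I k \<subseteq> I h0"
      proof
        fix j assume j: "j \<in> I k"
        then have jP: "j \<in> P" by (simp add: I_def)
        then have jc: "j \<in> carrier G" using P by (simp add: subsetD)
        show "j \<in> I h0"
        proof (cases "j = k")
          case True then show ?thesis using k by simp
        next
          case False
          then have "inv j \<otimes> k \<in> P" using j by (simp add: I_def)
          then have "(inv j \<otimes> k) \<otimes> (inv k \<otimes> h0) \<in> P" using mult kP by blast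
          also have "(inv j \<otimes> k) \<otimes> (inv k \<otimes> h0) = inv j \<otimes> h0"
            using jc kc h0c by (metis inv_closed m_assoc m_closed inv_solve_left r_inv l_one)
          finally show ?thesis using jP by (simp add: I_def)
        qed
      qed
      moreover have "h0 \<notin> I k"
      proof
        assume "h0 \<in> I k"
        then have "inv h0 \<otimes> k \<in> P" using ne by (auto simp: I_def)
        then have "(inv h0 \<otimes> k) \<otimes> (inv k \<otimes> h0) \<in> P" using mult kP by blast
        also have "(inv h0 \<otimes> k) \<otimes> (inv k \<otimes> h0) = \<one>"
          using kc h0c by (metis inv_closed m_assoc m_closed r_inv l_inv l_one)
        finally show False using one by simp
      qed
      moreover have "h0 \<in> I h0" using h0 by (simp add: I_def)
      ultimately have "card (I k) < card (I h0)" by (intro psubset_card_mono finI h0(1)) blast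
      then show False using h0(2)[OF kP(1)] by simp
    qed
    have "h \<in> generate G {h0}" if "h \<in> P" for h
      using that
    proof (induction "card (I h)" arbitrary: h rule: less_induct)
      case less
      have hc: "h \<in> carrier G" using less.prems P by blast
      define h1 where "h1 = inv h0 \<otimes> h"
      have h1c: "h1 \<in> carrier G" using hc h0c by (simp add: h1_def)
      have hh: "h = h0 \<otimes> h1" using hc h0c by (simp add: h1_def m_assoc[symmetric])
      have g0: "h0 \<in> generate G {h0}" by (rule generate.incl) simp
      from tri[OF h1c] show ?case
      proof (elim disjE)
        assume "h1 = \<one>" then show ?thesis using hh h0c g0 by simp
      next
        assume h1: "h1 \<in> P"
        have h0I: "h0 \<in> I h" using h0 h1 by (simp add: I_def h1_def)
        have "(\<lambda>k. h0 \<otimes> k) ` I h1 \<subseteq> I h - {h0}"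
        proof (rule image_subsetI)
          fix k assume k: "k \<in> I h1"
          then have kP: "k \<in> P" by (simp add: I_def)
          then have kc: "k \<in> carrier G" using P by (simp add: subsetD)
          have "inv (h0 \<otimes> k) \<otimes> h = inv k \<otimes> h1"
            using kc h0c hc by (simp add: h1_def inv_mult_group m_assoc)
          moreover have "k = h1 \<or> inv k \<otimes> h1 \<in> P" using k by (simp add: I_def)
          ultimately have "h0 \<otimes> k \<in> I h" using mult[OF h0(1) kP] hh by (auto simp: I_def)
          moreover have "h0 \<otimes> k \<noteq> h0" using kP one l_cancel_one[OF h0c kc] by auto
          ultimately show "h0 \<otimes> k \<in> I h - {h0}" by blast
        qed
        moreover have "inj_on (\<lambda>k. h0 \<otimes> k) (I h1)"
        proof (rule inj_onI)
          fix j k assume "j \<in> I h1" "k \<in> I h1" and e: "h0 \<otimes> j = h0 \<otimes> k"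
          then have "j \<in> P" "k \<in> P" by (simp_all add: I_def)
          then have "j \<in> carrier G" "k \<in> carrier G" using P by (simp_all add: subsetD)
          then show "j = k" using e h0c by simp
        qed
        ultimately have "card (I h1) \<le> card (I h - {h0})"
          using finI[OF less.prems] by (metis card_image card_mono finite_Diff)
        also have "\<dots> < card (I h)" using finI[OF less.prems] h0I by (intro card_Diff1_less)
        finally have "h1 \<in> generate G {h0}" using less.hyps h1 by simp
        then show ?thesis using hh generate.eng[OF g0] by simp
      next
        assume "inv h1 \<in> P"
        moreover have "inv h1 = inv h \<otimes> h0" using hc h0c by (simp add: h1_def inv_mult_group)
        ultimately have "h \<in> I h0" using less.prems by (simp add: I_def)
        then have "h = h0" by (rule minimal)
        then show ?thesis using g0 by simp
      qed
    qed
    then show ?thesis using gen[OF h0c] by blast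
  qed
qed

text \<open>
  The last condition says that all leaves of one orbit together meet a sufficiently small chart in at most
  one plaque. This is how closedness of the leaves downstairs shows in the cover.
\<close>

locale foliated_action = connected_foliated_space E C + K: comm_group K
  for E :: "'e topology" and C and K :: "('g, 'b) monoid_scheme" +
  fixes act :: "'g \<Rightarrow> 'e \<Rightarrow> 'e"
  assumes act_automorphism: "h \<in> carrier K \<Longrightarrow> automorphism (act h) (act (inv\<^bsub>K\<^esub> h))"
    and act_mult: "\<lbrakk>h \<in> carrier K; k \<in> carrier K; p \<in> topspace E\<rbrakk> \<Longrightarrow> act (h \<otimes>\<^bsub>K\<^esub> k) p = act h (act k p)"
    and act_free: "\<lbrakk>h \<in> carrier K; p \<in> topspace E; act h p \<in> leaf p\<rbrakk> \<Longrightarrow> h = \<one>\<^bsub>K\<^esub>"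
    and sep: "separable_leaves"
    and orbit_discrete: "\<lbrakk>a \<in> topspace E; p \<in> topspace E\<rbrakk> \<Longrightarrow> \<exists>U y. (U, y) \<in> C \<and> p \<in> U \<and>
          (\<forall>h\<in>carrier K. \<forall>k\<in>carrier K. \<forall>q\<in>U \<inter> leaf (act h a). \<forall>r\<in>U \<inter> leaf (act k a). y q = y r)"
begin

lemma act_in: "h \<in> carrier K \<Longrightarrow> p \<in> topspace E \<Longrightarrow> act h p \<in> topspace E"
  using automorphism_in[OF act_automorphism] .

lemma act_inv1: "h \<in> carrier K \<Longrightarrow> p \<in> topspace E \<Longrightarrow> act (inv\<^bsub>K\<^esub> h) (act h p) = p"
  using automorphism_inv[OF act_automorphism] .

lemma act_inv2: "h \<in> carrier K \<Longrightarrow> p \<in> topspace E \<Longrightarrow> act h (act (inv\<^bsub>K\<^esub> h) p) = p"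
  using act_inv1[of "inv\<^bsub>K\<^esub> h"] by simp

lemma act_one: "p \<in> topspace E \<Longrightarrow> act \<one>\<^bsub>K\<^esub> p = p"
  using act_mult[of "\<one>\<^bsub>K\<^esub>" "inv\<^bsub>K\<^esub> \<one>\<^bsub>K\<^esub>" p] act_inv2[of "\<one>\<^bsub>K\<^esub>" p] by simp

lemma act_image_mult:
  assumes "h \<in> carrier K" "k \<in> carrier K" "A \<subseteq> topspace E"
  shows "act (h \<otimes>\<^bsub>K\<^esub> k) ` A = act h ` act k ` A"
proof -
  have "act (h \<otimes>\<^bsub>K\<^esub> k) p = act h (act k p)" if "p \<in> A" for p
    by (rule act_mult[OF assms(1,2)]) (use that assms(3) in blast)
  then show ?thesis by (simp add: image_image)
qed

end

locale nested_action = foliated_action E C K act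
  for E :: "'e topology" and C and K :: "('g, 'b) monoid_scheme" and act +
  fixes g :: 'g and l Q :: "'e set" and a :: 'e
  assumes Q: "side l Q" and g: "g \<in> carrier K" and nested: "act g ` Q \<union> act g ` l \<subseteq> Q" and al: "a \<in> l"
begin

lemma sub: "Q \<subseteq> topspace E" "l \<subseteq> topspace E" "a \<in> topspace E" "a \<notin> Q"
  using side_subset[OF Q] is_leaf_subset[OF side_is_leaf[OF Q]] al side_disjoint[OF Q] by blast+

lemma l_eq: "l = leaf a"
  by (rule is_leaf_eq[OF side_is_leaf[OF Q] al])

lemma act_side: "h \<in> carrier K \<Longrightarrow> side (act h ` l) (act h ` Q)"
  by (rule automorphism_side[OF act_automorphism Q])

lemma act_leaf: "h \<in> carrier K \<Longrightarrow> act h ` l = leaf (act h a)"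
  unfolding l_eq by (rule automorphism_leaf[OF act_automorphism sub(3)])

definition same_side :: "'g \<Rightarrow> 'e \<Rightarrow> 'e \<Rightarrow> bool" where
  "same_side h p q \<longleftrightarrow> p \<in> act h ` Q \<and> q \<in> act h ` Q \<or>
    p \<in> opp (act h ` l) (act h ` Q) \<and> q \<in> opp (act h ` l) (act h ` Q)"

text \<open>
  A translate of \<open>l\<close> that passes through one of the points counts as separating them. This keeps the
  relation of not being separated transitive for each fixed translate.
\<close>

definition separators :: "'e \<Rightarrow> 'e \<Rightarrow> 'g set" where
  "separators p q = {h \<in> carrier K. \<not> same_side h p q}"

lemma separators_trans: "separators p r \<subseteq> separators p q \<union> separators q r"
  unfolding separators_def same_side_def opp_def by blast

lemma separators_sym: "separators p q = separators q p"
  unfolding separators_def same_side_def by blast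

lemma leaf_act_inj:
  assumes "h \<in> carrier K" "k \<in> carrier K" "leaf (act h a) = leaf (act k a)" shows "h = k"
proof -
  have "act h a = act (h \<otimes>\<^bsub>K\<^esub> inv\<^bsub>K\<^esub> k) (act k a)"
    using assms sub(3) act_in by (simp add: act_mult act_inv1)
  then have "act (h \<otimes>\<^bsub>K\<^esub> inv\<^bsub>K\<^esub> k) (act k a) \<in> leaf (act k a)" using assms(3) leaf_refl by metis
  then have "h \<otimes>\<^bsub>K\<^esub> inv\<^bsub>K\<^esub> k = \<one>\<^bsub>K\<^esub>" using assms sub(3) act_in by (intro act_free) auto
  then show ?thesis using assms by (metis K.inv_closed K.inv_equality K.inv_inv)
qed

text \<open>
  In a small chart all translates of \<open>l\<close> that meet it share a plaque, hence coincide, and by freeness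
  come from a single group element.
\<close>

lemma separators_locally_finite:
  assumes "p \<in> topspace E"
  shows "\<exists>U. openin E U \<and> p \<in> U \<and> (\<forall>q\<in>U. finite (separators p q))"
proof -
  obtain U y where U: "(U, y) \<in> C" "p \<in> U" and
    disc: "\<And>h k q r. \<lbrakk>h \<in> carrier K; k \<in> carrier K; q \<in> U \<inter> leaf (act h a); r \<in> U \<inter> leaf (act k a)\<rbrakk> \<Longrightarrow> y q = y r"
    using orbit_discrete[OF sub(3) assms] by blast
  define B where "B = {h \<in> carrier K. U \<inter> leaf (act h a) \<noteq> {}}"
  have "h = k" if hkB: "h \<in> B" "k \<in> B" for h k
  proof -
    have hk: "h \<in> carrier K" "k \<in> carrier K" using hkB by (auto simp: B_def)
    obtain q where q1: "q \<in> U \<inter> leaf (act h a)" using hkB(1) unfolding B_def by blast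
    obtain r where q2: "r \<in> U \<inter> leaf (act k a)" using hkB(2) unfolding B_def by blast
    note q = q1 q2
    then have "plaque_rel q r" using disc[OF hk q] by (intro plaque_relI[OF U(1)]) auto
    then have "leaf r = leaf q" by (intro leaf_eq) (simp add: leaf_def)
    then have "leaf (act h a) = leaf (act k a)" using q leaf_eq by blast
    then show ?thesis by (rule leaf_act_inj[OF hk])
  qed
  then have "B \<subseteq> {SOME h. h \<in> B}" by (metis insertI1 someI subsetI)
  then have fB: "finite B" by (rule finite_subset) simp
  have "separators p q \<subseteq> B" if "q \<in> U" for q
  proof
    fix h assume h: "h \<in> separators p q"
    show "h \<in> B"
    proof (rule ccontr)
      have hK: "h \<in> carrier K" using h by (simp add: separators_def)
      assume "h \<notin> B"
      then have "U \<inter> act h ` l = {}" using hK by (simp add: B_def act_leaf)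
      then have "U \<subseteq> act h ` Q \<or> U \<subseteq> opp (act h ` l) (act h ` Q)"
        by (rule side_chart_disjoint[OF act_side[OF hK] U(1)])
      then have "same_side h p q" using U(2) \<open>q \<in> U\<close> unfolding same_side_def by blast
      then show False using h by (simp add: separators_def)
    qed
  qed
  then have "\<forall>q\<in>U. finite (separators p q)" using finite_subset fB by blast
  then show ?thesis using U chart_openin by blast
qed

text \<open>
  Being separated from \<open>p\<close> by finitely many translates is locally constant, hence
  independent of the point.
\<close>

lemma finite_separators:
  assumes "p \<in> topspace E" "q \<in> topspace E" shows "finite (separators p q)"
proof -
  define A where "A = {q \<in> topspace E. finite (separators p q)}"
  define B where "B = {q \<in> topspace E. infinite (separators p q)}"
  have loc: "\<exists>U. openin E U \<and> q \<in> U \<and> (\<forall>r\<in>U. r \<in> topspace E \<and> finite (separators p r) = finite (separators p q))"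
    if q: "q \<in> topspace E" for q
  proof -
    obtain U where U: "openin E U" "q \<in> U" "\<And>r. r \<in> U \<Longrightarrow> finite (separators q r)"
      using separators_locally_finite[OF q] by blast
    have "finite (separators p r) = finite (separators p q)" if r: "r \<in> U" for r
    proof
      assume "finite (separators p r)"
      then show "finite (separators p q)"
        using U(3)[OF r] separators_trans[of p q r] separators_sym[of q r] by (metis finite_UnI finite_subset)
    next
      assume "finite (separators p q)"
      then show "finite (separators p r)"
        using U(3)[OF r] separators_trans[of p r q] by (metis finite_UnI finite_subset)
    qed
    then show ?thesis using U openin_subset by blast
  qed
  have "\<exists>T. openin E T \<and> q \<in> T \<and> T \<subseteq> A" if q: "q \<in> A" for q
  proof -
    have q': "q \<in> topspace E" "finite (separators p q)" using q by (simp_all add: A_def)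
    obtain U where U: "openin E U" "q \<in> U"
      "\<forall>r\<in>U. r \<in> topspace E \<and> finite (separators p r) = finite (separators p q)" using loc[OF q'(1)] by (elim exE conjE)
    then have "U \<subseteq> A" using q' by (simp add: A_def subset_eq)
    then show ?thesis using U by blast
  qed
  then have oA: "openin E A" by (subst openin_subopen) blast
  have "\<exists>T. openin E T \<and> q \<in> T \<and> T \<subseteq> B" if q: "q \<in> B" for q
  proof -
    have q': "q \<in> topspace E" "infinite (separators p q)" using q by (simp_all add: B_def)
    obtain U where U: "openin E U" "q \<in> U"
      "\<forall>r\<in>U. r \<in> topspace E \<and> finite (separators p r) = finite (separators p q)" using loc[OF q'(1)] by (elim exE conjE)
    then have "U \<subseteq> B" using q' by (simp add: B_def subset_eq)
    then show ?thesis using U by blast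
  qed
  then have oB: "openin E B" by (subst openin_subopen) blast
  have "A \<union> B = topspace E" "A \<inter> B = {}" unfolding A_def B_def by blast+
  then have "A = {} \<or> B = {}" by (rule clopen_cases[OF oA oB])
  moreover have "p \<in> A"
  proof -
    obtain U where "p \<in> U" "\<forall>q\<in>U. finite (separators p q)" using separators_locally_finite[OF assms(1)] by blast
    then show ?thesis using assms(1) by (simp add: A_def)
  qed
  ultimately show ?thesis using assms(2) unfolding B_def by blast
qed

definition pos :: "'g set" where
  "pos = {h \<in> carrier K. act h ` Q \<union> act h ` l \<subseteq> Q}"

lemma pos_carrier: "pos \<subseteq> carrier K" by (auto simp: pos_def)

lemma pos_subset: "h \<in> pos \<Longrightarrow> act h ` Q \<subseteq> Q" by (simp add: pos_def)

lemma pos_mult: assumes "h \<in> pos" "k \<in> pos" shows "h \<otimes>\<^bsub>K\<^esub> k \<in> pos"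
proof -
  have hk: "h \<in> carrier K" "k \<in> carrier K" using assms pos_carrier by blast+
  have "act k ` Q \<union> act k ` l \<subseteq> Q" using assms by (simp add: pos_def)
  then have "act h ` act k ` Q \<union> act h ` act k ` l \<subseteq> act h ` Q" by blast
  then have "act (h \<otimes>\<^bsub>K\<^esub> k) ` Q \<union> act (h \<otimes>\<^bsub>K\<^esub> k) ` l \<subseteq> Q"
    unfolding act_image_mult[OF hk sub(1)] act_image_mult[OF hk sub(2)]
    using pos_subset[OF assms(1)] by (meson order_trans)
  then show ?thesis using hk by (simp add: pos_def)
qed

lemma one_not_pos: "\<one>\<^bsub>K\<^esub> \<notin> pos"
proof
  assume "\<one>\<^bsub>K\<^esub> \<in> pos"
  then have "act \<one>\<^bsub>K\<^esub> a \<in> Q" using al by (auto simp: pos_def)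
  then show False using act_one sub by simp
qed

text \<open>
  If \<open>k\<close> lies between the identity and \<open>h\<close>, then \<open>k Q\<close> contains \<open>h Q\<close> but not the boundary of \<open>Q\<close>; so the
  translate of \<open>l\<close> by \<open>k\<close> separates \<open>a \<in> l\<close> from a point of \<open>h Q\<close>.
\<close>

lemma pos_finite_below:
  assumes h: "h \<in> pos" shows "finite {k \<in> pos. k = h \<or> inv\<^bsub>K\<^esub> k \<otimes>\<^bsub>K\<^esub> h \<in> pos}"
proof -
  have hK: "h \<in> carrier K" using h pos_carrier by blast
  obtain b where b: "b \<in> act h ` Q" using side_nonempty[OF Q] by blast
  have bE: "b \<in> topspace E" using b pos_subset[OF h] sub by blast
  have *: "k \<in> separators a b" if k: "k \<in> pos" "k = h \<or> inv\<^bsub>K\<^esub> k \<otimes>\<^bsub>K\<^esub> h \<in> pos" for k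
  proof -
    have kK: "k \<in> carrier K" using k pos_carrier by blast
    have "act h ` Q \<subseteq> act k ` Q" using k(2)
    proof
      assume "inv\<^bsub>K\<^esub> k \<otimes>\<^bsub>K\<^esub> h \<in> pos"
      then have "act k ` act (inv\<^bsub>K\<^esub> k \<otimes>\<^bsub>K\<^esub> h) ` Q \<subseteq> act k ` Q" by (intro image_mono pos_subset)
      moreover have "act k ` act (inv\<^bsub>K\<^esub> k \<otimes>\<^bsub>K\<^esub> h) ` Q = act (k \<otimes>\<^bsub>K\<^esub> (inv\<^bsub>K\<^esub> k \<otimes>\<^bsub>K\<^esub> h)) ` Q"
        using act_image_mult[of k "inv\<^bsub>K\<^esub> k \<otimes>\<^bsub>K\<^esub> h" Q] kK hK sub by simp
      moreover have "k \<otimes>\<^bsub>K\<^esub> (inv\<^bsub>K\<^esub> k \<otimes>\<^bsub>K\<^esub> h) = h" using kK hK by (simp add: K.m_assoc[symmetric])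
      ultimately show ?thesis by simp
    qed simp
    then have "b \<in> act k ` Q" using b by blast
    moreover have "a \<notin> act k ` Q" using pos_subset[OF k(1)] sub by blast
    ultimately show ?thesis using kK unfolding separators_def same_side_def opp_def by blast
  qed
  show ?thesis
  proof (rule finite_subset[OF _ finite_separators[OF sub(3) bE]], rule subsetI)
    fix k assume "k \<in> {k \<in> pos. k = h \<or> inv\<^bsub>K\<^esub> k \<otimes>\<^bsub>K\<^esub> h \<in> pos}"
    then have "k \<in> pos" "k = h \<or> inv\<^bsub>K\<^esub> k \<otimes>\<^bsub>K\<^esub> h \<in> pos" by simp_all
    then show "k \<in> separators a b" by (rule *)
  qed
qed

lemma g_pos: "g \<in> pos" using g nested by (simp add: pos_def)

lemma pow_pos: "g [^]\<^bsub>K\<^esub> Suc n \<in> pos"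
proof (induction n)
  case 0 then show ?case using g_pos g by simp
next
  case (Suc n)
  then show ?case using pos_mult[OF Suc g_pos] by (simp only: K.nat_pow_Suc)
qed

lemma pow_image_subset: "act (g [^]\<^bsub>K\<^esub> (n::nat)) ` Q \<subseteq> Q"
proof (cases n)
  case 0
  then show ?thesis using act_one sub by auto
next
  case (Suc m)
  then show ?thesis using pos_subset[OF pow_pos[of m]] by simp
qed

lemma pow_inj: "inj (\<lambda>n::nat. g [^]\<^bsub>K\<^esub> n)"
proof -
  have "g [^]\<^bsub>K\<^esub> m \<noteq> g [^]\<^bsub>K\<^esub> n" if mn: "m < n" for m n :: nat
  proof
    assume e: "g [^]\<^bsub>K\<^esub> m = g [^]\<^bsub>K\<^esub> n"
    obtain k where k: "n = m + Suc k" using mn less_iff_Suc_add by auto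
    have "g [^]\<^bsub>K\<^esub> m \<otimes>\<^bsub>K\<^esub> g [^]\<^bsub>K\<^esub> Suc k = g [^]\<^bsub>K\<^esub> m"
      using K.nat_pow_mult[OF g, of m "Suc k"] e k by simp
    then have "g [^]\<^bsub>K\<^esub> Suc k = \<one>\<^bsub>K\<^esub>"
      by (rule iffD1[OF K.l_cancel_one[OF K.nat_pow_closed[OF g] K.nat_pow_closed[OF g]]])
    then show False using pow_pos[of k] one_not_pos by simp
  qed
  then show ?thesis by (rule linorder_injI)
qed

text \<open>
  Here commutativity enters. If \<open>h Q\<close> is disjoint from \<open>Q\<close>, take \<open>b \<in> Q\<close>. All powers \<open>k\<close> of \<open>g\<close> map \<open>b\<close> into \<open>Q\<close> and, because they
  commute with \<open>h\<close>, map \<open>h b\<close> into \<open>h Q\<close>. So all the infinitely many translates of \<open>l\<close> by the inverses of these powers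
  separate \<open>b\<close> from \<open>h b\<close>. If \<open>h Q\<close> and \<open>Q\<close> cover the space, the powers themselves serve in the same way for a point \<open>b\<close> outside \<open>Q\<close>.
\<close>

lemma pos_trichotomy:
  assumes h: "h \<in> carrier K" shows "h = \<one>\<^bsub>K\<^esub> \<or> h \<in> pos \<or> inv\<^bsub>K\<^esub> h \<in> pos"
proof (cases "h = \<one>\<^bsub>K\<^esub>")
  case False
  have ne: "act h ` l \<noteq> l"
  proof
    assume "act h ` l = l"
    then have "act h a \<in> leaf a" using al l_eq by blast
    then show False using act_free[OF h sub(3)] False by simp
  qed
  have pc: "g [^]\<^bsub>K\<^esub> n \<in> carrier K" for n :: nat using g by simp
  have comm: "act (g [^]\<^bsub>K\<^esub> n) (act h p) = act h (act (g [^]\<^bsub>K\<^esub> n) p)" if "p \<in> topspace E" for n :: nat and p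
    using act_mult[OF pc h that] act_mult[OF h pc that] K.m_comm[OF pc h] by simp
  show ?thesis
  proof (rule sides_cases[OF act_side[OF h] Q ne])
    assume "act h ` Q \<union> act h ` l \<subseteq> Q"
    then show ?thesis using h by (simp add: pos_def)
  next
    assume "Q \<union> l \<subseteq> act h ` Q"
    then have "act (inv\<^bsub>K\<^esub> h) ` (Q \<union> l) \<subseteq> act (inv\<^bsub>K\<^esub> h) ` act h ` Q" by (rule image_mono)
    then have "act (inv\<^bsub>K\<^esub> h) ` (Q \<union> l) \<subseteq> Q" using automorphism_image_inv[OF act_automorphism[OF h] sub(1)] by simp
    then show ?thesis using h by (simp add: pos_def image_Un)
  next
    assume disj: "act h ` Q \<inter> Q = {}"
    define b where "b = act g a"
    have b: "b \<in> Q" using nested al by (auto simp: b_def)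
    have bE: "b \<in> topspace E" "act h b \<in> topspace E" using b sub act_in[OF h] by blast+
    have "inv\<^bsub>K\<^esub> (g [^]\<^bsub>K\<^esub> n) \<in> separators b (act h b)" for n :: nat
    proof -
      let ?k = "g [^]\<^bsub>K\<^esub> n"
      have "act ?k b \<in> Q" using pow_image_subset b by blast
      then have "act (inv\<^bsub>K\<^esub> ?k) (act ?k b) \<in> act (inv\<^bsub>K\<^esub> ?k) ` Q" by (rule imageI)
      then have 1: "b \<in> act (inv\<^bsub>K\<^esub> ?k) ` Q" using act_inv1[OF pc bE(1)] by simp
      have "act h b \<notin> act (inv\<^bsub>K\<^esub> ?k) ` Q"
      proof
        assume "act h b \<in> act (inv\<^bsub>K\<^esub> ?k) ` Q"
        then obtain q where q: "q \<in> Q" "act h b = act (inv\<^bsub>K\<^esub> ?k) q" by blast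
        then have "act ?k (act h b) = q" using act_inv2[OF pc] sub by auto
        then have "act h (act ?k b) \<in> Q" using comm[OF bE(1)] q(1) by simp
        then show False using disj \<open>act ?k b \<in> Q\<close> by blast
      qed
      then show ?thesis using 1 pc unfolding separators_def same_side_def opp_def by blast
    qed
    then have "range (\<lambda>n::nat. inv\<^bsub>K\<^esub> (g [^]\<^bsub>K\<^esub> n)) \<subseteq> separators b (act h b)" by (rule image_subsetI)
    from finite_subset[OF this finite_separators[OF bE]]
    have fin: "finite (range (\<lambda>n::nat. inv\<^bsub>K\<^esub> (g [^]\<^bsub>K\<^esub> n)))" .
    have "inj (\<lambda>n::nat. inv\<^bsub>K\<^esub> (g [^]\<^bsub>K\<^esub> n))"
    proof (rule injI)
      fix m n :: nat assume "inv\<^bsub>K\<^esub> (g [^]\<^bsub>K\<^esub> m) = inv\<^bsub>K\<^esub> (g [^]\<^bsub>K\<^esub> n)"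
      then have "inv\<^bsub>K\<^esub> (inv\<^bsub>K\<^esub> (g [^]\<^bsub>K\<^esub> m)) = inv\<^bsub>K\<^esub> (inv\<^bsub>K\<^esub> (g [^]\<^bsub>K\<^esub> n))" by (rule arg_cong)
      then have "g [^]\<^bsub>K\<^esub> m = g [^]\<^bsub>K\<^esub> n" unfolding K.inv_inv[OF pc] .
      then show "m = n" by (rule injD[OF pow_inj])
    qed
    from range_inj_infinite[OF this] fin show ?thesis by simp
  next
    assume cov: "act h ` Q \<union> Q = topspace E"
    define b where "b = act (inv\<^bsub>K\<^esub> g) a"
    have bE: "b \<in> topspace E" using act_in sub g by (simp add: b_def)
    have hbE: "act h b \<in> topspace E" using act_in[OF h bE] .
    have "b \<notin> Q"
    proof
      assume "b \<in> Q"
      then have "act g b \<in> Q" using nested by blast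
      then show False using act_inv2[OF g sub(3)] sub(4) by (simp add: b_def)
    qed
    have "g [^]\<^bsub>K\<^esub> n \<in> separators b (act h b)" for n :: nat
    proof -
      let ?k = "g [^]\<^bsub>K\<^esub> n"
      have 1: "b \<notin> act ?k ` Q" using pow_image_subset \<open>b \<notin> Q\<close> by blast
      have "act h b \<in> act ?k ` topspace E" using automorphism_image_topspace[OF act_automorphism[OF pc]] hbE by simp
      then obtain r where r: "r \<in> topspace E" "act h b = act ?k r" by (elim imageE)
      have "r \<notin> act h ` Q"
      proof
        assume "r \<in> act h ` Q"
        then obtain q where q: "q \<in> Q" "r = act h q" by (elim imageE)
        have qE: "q \<in> topspace E" using q(1) sub(1) by (rule rev_subsetD)
        have "act h b = act h (act ?k q)" using r(2) q(2) comm[OF qE] by simp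
        then have "act (inv\<^bsub>K\<^esub> h) (act h b) = act (inv\<^bsub>K\<^esub> h) (act h (act ?k q))" by simp
        then have "b = act ?k q" using act_inv1[OF h bE] act_inv1[OF h act_in[OF pc qE]] by simp
        then show False using 1 q(1) by blast
      qed
      then have "r \<in> Q" using cov r(1) by (metis UnE)
      then have "act h b \<in> act ?k ` Q" using r(2) by simp
      then show ?thesis using 1 pc unfolding separators_def same_side_def opp_def by blast
    qed
    then have "range (\<lambda>n::nat. g [^]\<^bsub>K\<^esub> n) \<subseteq> separators b (act h b)" by (rule image_subsetI)
    from finite_subset[OF this finite_separators[OF bE hbE]] show ?thesis
      using range_inj_infinite[OF pow_inj] by simp
  qed
qed simp

lemma cyclic: "\<exists>h\<in>carrier K. generate K {h} = carrier K"
  by (rule K.cyclic_of_discrete_positive_cone[OF pos_carrier pos_mult pos_trichotomy one_not_pos pos_finite_below])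

end

context foliated_action
begin

theorem cyclic_group:
  assumes "topspace E \<noteq> {}"
  shows "\<exists>h\<in>carrier K. generate K {h} = carrier K"
proof (cases "\<exists>g\<in>carrier K. g \<noteq> \<one>\<^bsub>K\<^esub>")
  case True
  then obtain g where g: "g \<in> carrier K" "g \<noteq> \<one>\<^bsub>K\<^esub>" by blast
  have fr: "act g p \<notin> leaf p" if "p \<in> topspace E" for p
    using act_free[OF g(1) that] g(2) by (rule contrapos_nn[rotated])
  have "\<exists>l Q. side l Q \<and> (act g ` Q \<union> act g ` l \<subseteq> Q \<or> Q \<union> l \<subseteq> act g ` Q)"
    by (rule exists_nested_side[OF act_automorphism[OF g(1)] sep fr assms])
  then obtain l Q where Q: "side l Q" "act g ` Q \<union> act g ` l \<subseteq> Q \<or> Q \<union> l \<subseteq> act g ` Q" by blast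
  obtain a where a: "a \<in> l" using is_leaf_nonempty[OF side_is_leaf[OF Q(1)]] by blast
  have "\<exists>k\<in>carrier K. act k ` Q \<union> act k ` l \<subseteq> Q"
    using Q(2)
  proof
    assume "Q \<union> l \<subseteq> act g ` Q"
    then have "act (inv\<^bsub>K\<^esub> g) ` (Q \<union> l) \<subseteq> act (inv\<^bsub>K\<^esub> g) ` act g ` Q" by (rule image_mono)
    then have "act (inv\<^bsub>K\<^esub> g) ` (Q \<union> l) \<subseteq> Q"
      using automorphism_image_inv[OF act_automorphism[OF g(1)] side_subset[OF Q(1)]] by simp
    then show ?thesis using g(1) by (intro bexI[of _ "inv\<^bsub>K\<^esub> g"]) (simp_all add: image_Un)
  qed (use g(1) in blast)
  then obtain k where k: "k \<in> carrier K" "act k ` Q \<union> act k ` l \<subseteq> Q" by blast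
  interpret nested_action E C K act k l Q a
    by unfold_locales (rule Q(1) k a)+
  show ?thesis by (rule cyclic)
next
  case False
  then have "carrier K = {\<one>\<^bsub>K\<^esub>}" by blast
  then show ?thesis
    using K.generate_incl[of "{\<one>\<^bsub>K\<^esub>}"] generate.one[of K "{\<one>\<^bsub>K\<^esub>}"] by (intro bexI[of _ "\<one>\<^bsub>K\<^esub>"]) auto
qed

end

section \<open>Local systems and transverse orientations\<close>

lemma connectedin_locally_constant:
  fixes F :: "'x \<Rightarrow> bool"
  assumes P: "connectedin X P"
    and loc: "\<And>p. p \<in> P \<Longrightarrow> \<exists>W. openin X W \<and> p \<in> W \<and> (\<forall>q\<in>W \<inter> P. F q = F p)"
    and "p \<in> P" "q \<in> P"
  shows "F p = F q"
proof (rule ccontr)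
  assume ne: "F p \<noteq> F q"
  define A where "A b = \<Union>{W. openin X W \<and> (\<forall>q\<in>W \<inter> P. F q = b)}" for b
  have o: "openin X (A b)" for b unfolding A_def by (rule openin_Union) simp
  have in_A: "r \<in> A (F r)" if r: "r \<in> P" for r
  proof -
    obtain W where "openin X W" "r \<in> W" "\<forall>q\<in>W \<inter> P. F q = F r" using loc[OF r] by (elim exE conjE)
    then show ?thesis unfolding A_def by (intro UnionI[of W]) simp_all
  qed
  have F_A: "F r = b" if "r \<in> A b" "r \<in> P" for r b
    using that unfolding A_def by blast
  have "P \<subseteq> A True \<union> A False"
  proof
    fix r assume "r \<in> P"
    from in_A[OF this] show "r \<in> A True \<union> A False" by (cases "F r") simp_all
  qed
  moreover have "A True \<inter> A False \<inter> P = {}" using F_A by blast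
  moreover have "A True \<inter> P \<noteq> {}" "A False \<inter> P \<noteq> {}"
    using ne in_A[OF assms(3)] in_A[OF assms(4)] assms(3,4) by (cases "F p"; cases "F q"; auto)+
  ultimately show False using P o[of True] o[of False] unfolding connectedin by blast
qed

text \<open>
  On the convex set of pairs \<open>u < v\<close> the continuous function \<open>h v - h u\<close> has no zero, so it has a constant sign.
\<close>

lemma continuous_inj_on_interval_monotone:
  fixes h :: "real \<Rightarrow> real"
  assumes I: "is_interval I" and cont: "continuous_on I h" and inj: "inj_on h I"
  shows "(\<forall>u\<in>I. \<forall>v\<in>I. u < v \<longrightarrow> h u < h v) \<or> (\<forall>u\<in>I. \<forall>v\<in>I. u < v \<longrightarrow> h v < h u)"
proof -
  define T where "T = (I \<times> I) \<inter> {p::real \<times> real. inner (-1, 1) p > 0}"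
  have T: "(u, v) \<in> T \<longleftrightarrow> u \<in> I \<and> v \<in> I \<and> u < v" for u v by (auto simp: T_def)
  have "convex I" using I by (simp add: is_interval_convex_1)
  then have "convex T" unfolding T_def by (intro convex_Int convex_Times convex_halfspace_gt)
  then have "connected T" by (rule convex_connected)
  moreover have "continuous_on T (\<lambda>p. h (snd p) - h (fst p))"
    by (intro continuous_intros continuous_on_compose2[OF cont]) (auto simp: T_def)
  ultimately have c: "connected ((\<lambda>p. h (snd p) - h (fst p)) ` T)" by (rule connected_continuous_image[rotated])
  have nz: "0 \<notin> (\<lambda>p. h (snd p) - h (fst p)) ` T"
    using inj by (force simp: T_def inj_on_def)
  have *: "\<not> (h v - h u < 0 \<and> 0 < h v' - h u')" if uv: "(u, v) \<in> T" "(u', v') \<in> T" for u v u' v'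
  proof
    assume s: "h v - h u < 0 \<and> 0 < h v' - h u'"
    have "h v - h u \<in> (\<lambda>p. h (snd p) - h (fst p)) ` T" "h v' - h u' \<in> (\<lambda>p. h (snd p) - h (fst p)) ` T"
      using imageI[OF uv(1), of "\<lambda>p. h (snd p) - h (fst p)"] imageI[OF uv(2), of "\<lambda>p. h (snd p) - h (fst p)"] by simp_all
    from c[unfolded connected_iff_interval, rule_format, OF this, of 0] s nz show False by simp
  qed
  show ?thesis
  proof (rule ccontr)
    assume "\<not> ?thesis"
    then obtain u v u' v' where uv: "u \<in> I" "v \<in> I" "u < v" "\<not> h u < h v" "u' \<in> I" "v' \<in> I" "u' < v'" "\<not> h v' < h u'"
      by blast
    have "h u \<noteq> h v" "h u' \<noteq> h v'" using uv inj by (auto simp: inj_on_def)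
    then show False using *[of u v u' v'] uv T by auto
  qed
qed

text \<open>
  Every locally constant system of two-element sets has a global section. Such a system is given by a
  cover \<open>S\<close> with local sections \<open>s\<close>, where any two local sections agree or disagree locally constantly on
  the overlap; a section \<open>f\<close> is global if it agrees or disagrees with each local section locally constantly. No space
  of sections is formed: only the comparison of Boolean functions matters, not their continuity.
\<close>

definition Z2_trivial :: "'x topology \<Rightarrow> bool" where
  "Z2_trivial X \<longleftrightarrow> (\<forall>S :: ('x set \<times> ('x \<Rightarrow> bool)) set.
     (\<forall>U s. (U, s) \<in> S \<longrightarrow> openin X U) \<longrightarrow> (\<forall>p\<in>topspace X. \<exists>U s. (U, s) \<in> S \<and> p \<in> U) \<longrightarrow>
     (\<forall>U s V t p. (U, s) \<in> S \<longrightarrow> (V, t) \<in> S \<longrightarrow> p \<in> U \<longrightarrow> p \<in> V \<longrightarrow>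
        (\<exists>W. openin X W \<and> p \<in> W \<and> W \<subseteq> U \<inter> V \<and> (\<forall>q\<in>W. (s q = t q) = (s p = t p)))) \<longrightarrow>
     (\<exists>f. \<forall>U s p. (U, s) \<in> S \<longrightarrow> p \<in> U \<longrightarrow>
        (\<exists>W. openin X W \<and> p \<in> W \<and> W \<subseteq> U \<and> (\<forall>q\<in>W. (f q = s q) = (f p = s p)))))"

context foliated_space
begin

lemma chart_preimage_openin:
  assumes "(U, y) \<in> C" "open B" shows "openin E {q \<in> U. y q \<in> B}"
proof -
  have "openin (subtopology E U) {q \<in> topspace (subtopology E U). y q \<in> B}"
    using chart_continuous[OF assms(1)] assms(2) by (simp add: continuous_map_def)
  moreover have "{q \<in> topspace (subtopology E U). y q \<in> B} = {q \<in> U. y q \<in> B}" using chart_subset[OF assms(1)] by auto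
  ultimately have "openin (subtopology E U) {q \<in> U. y q \<in> B}" by metis
  then show ?thesis using openin_open_subtopology[OF chart_openin[OF assms(1)]] by blast
qed

lemma chart_image_connected:
  assumes "(U, y) \<in> C" "connectedin E W" "W \<subseteq> U" shows "connected (y ` W)"
  using connectedin_continuous_map_image[OF chart_continuous[OF assms(1)], of W] assms(2,3)
  by (simp add: connectedin_subtopology)

text \<open>
  With \<open>\<sigma>\<close> the two coordinates increase in the same direction near \<open>p\<close>, without it in opposite directions.
\<close>

definition same_dir :: "bool \<Rightarrow> 'e set \<times> ('e \<Rightarrow> real) \<Rightarrow> 'e set \<times> ('e \<Rightarrow> real) \<Rightarrow> 'e \<Rightarrow> bool" where
  "same_dir \<sigma> c d p \<longleftrightarrow> (\<exists>W. openin E W \<and> p \<in> W \<and> W \<subseteq> fst c \<inter> fst d \<and>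
     (\<forall>q\<in>W. \<forall>r\<in>W. snd c q < snd c r \<longleftrightarrow> (if \<sigma> then snd d q < snd d r else snd d r < snd d q)))"

text \<open>
  Coherence gives the change of transverse coordinates only as a function \<open>h\<close>. The coordinates
  being open and continuous, \<open>h\<close> is continuous and injective on an interval, hence monotone.
\<close>

lemma same_dir_exists:
  assumes U: "(U, y) \<in> C" and V: "(V, z) \<in> C" and p: "p \<in> U" "p \<in> V"
  shows "\<exists>\<sigma>. same_dir \<sigma> (U, y) (V, z) p"
proof -
  obtain W1 h where W1: "openin E W1" "p \<in> W1" "W1 \<subseteq> U \<inter> V" "\<forall>q\<in>W1. z q = h (y q)"
    using charts_coherent[OF U V p] by blast
  obtain W2 h' where W2: "openin E W2" "p \<in> W2" "W2 \<subseteq> V \<inter> U" "\<forall>q\<in>W2. y q = h' (z q)"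
    using charts_coherent[OF V U p(2,1)] by blast
  obtain W w where W: "(W, w) \<in> C" "p \<in> W" "W \<subseteq> W1 \<inter> W2"
    using charts_base[OF openin_Int[OF W1(1) W2(1)]] W1(2) W2(2) by blast
  have WU: "W \<subseteq> U" "W \<subseteq> V" using W W1 by blast+
  have oW: "openin E W" by (rule chart_openin[OF W(1)])
  have h: "z q = h (y q)" and h': "y q = h' (z q)" if "q \<in> W" for q using that W(3) W1(4) W2(4) by blast+
  define I where "I = y ` W"
  have oI: "open I" unfolding I_def by (rule chart_open_map[OF U oW WU(1)])
  have I: "is_interval I" unfolding I_def is_interval_connected_1
    by (rule chart_image_connected[OF U chart_connected[OF W(1)] WU(1)])
  have inj: "inj_on h I"
  proof (rule inj_onI)
    fix u v assume "u \<in> I" "v \<in> I" and e: "h u = h v"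
    then obtain q r where "q \<in> W" "u = y q" "r \<in> W" "v = y r" unfolding I_def by blast
    then show "u = v" using e h h' by metis
  qed
  have "open (h -` B \<inter> I)" if B: "open B" for B
  proof -
    have "h -` B \<inter> I = y ` ({q \<in> V. z q \<in> B} \<inter> W)" unfolding I_def using h WU by force
    moreover have "openin E ({q \<in> V. z q \<in> B} \<inter> W)" using chart_preimage_openin[OF V B] oW by blast
    ultimately show ?thesis using chart_open_map[OF U, of "{q \<in> V. z q \<in> B} \<inter> W"] WU by auto
  qed
  then have "continuous_on I h" by (simp add: continuous_on_open_vimage[OF oI])
  from continuous_inj_on_interval_monotone[OF I this inj] show ?thesis
  proof
    assume m: "\<forall>u\<in>I. \<forall>v\<in>I. u < v \<longrightarrow> h u < h v"
    have "y q < y r \<longleftrightarrow> z q < z r" if "q \<in> W" "r \<in> W" for q r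
    proof -
      have "y q \<in> I" "y r \<in> I" using that by (auto simp: I_def)
      then show ?thesis using m h[OF that(1)] h[OF that(2)] by (metis less_asym linorder_neqE_linordered_idom)
    qed
    then have "same_dir True (U, y) (V, z) p" unfolding same_dir_def using oW W(2) WU by auto
    then show ?thesis by (rule exI)
  next
    assume m: "\<forall>u\<in>I. \<forall>v\<in>I. u < v \<longrightarrow> h v < h u"
    have "y q < y r \<longleftrightarrow> z r < z q" if "q \<in> W" "r \<in> W" for q r
    proof -
      have "y q \<in> I" "y r \<in> I" using that by (auto simp: I_def)
      then show ?thesis using m h[OF that(1)] h[OF that(2)] by (metis less_asym linorder_neqE_linordered_idom)
    qed
    then have "same_dir False (U, y) (V, z) p" unfolding same_dir_def using oW W(2) WU by auto
    then show ?thesis by (rule exI)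
  qed
qed

lemma same_dir_sym: "same_dir \<sigma> c d p \<Longrightarrow> same_dir \<sigma> d c p"
proof -
  assume "same_dir \<sigma> c d p"
  then obtain W where W: "openin E W" "p \<in> W" "W \<subseteq> fst c \<inter> fst d"
    "\<forall>q\<in>W. \<forall>r\<in>W. snd c q < snd c r \<longleftrightarrow> (if \<sigma> then snd d q < snd d r else snd d r < snd d q)"
    unfolding same_dir_def by (elim exE conjE)
  have "\<forall>q\<in>W. \<forall>r\<in>W. snd d q < snd d r \<longleftrightarrow> (if \<sigma> then snd c q < snd c r else snd c r < snd c q)"
    using W(4) by (cases \<sigma>) simp_all
  moreover have "W \<subseteq> fst d \<inter> fst c" using W(3) by simp
  ultimately show ?thesis unfolding same_dir_def using W(1,2) by (intro exI conjI)
qed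

lemma same_dir_trans:
  assumes "same_dir \<sigma> c d p" "same_dir \<tau> d e p" shows "same_dir (\<sigma> = \<tau>) c e p"
proof -
  obtain W where W: "openin E W" "p \<in> W" "W \<subseteq> fst c \<inter> fst d"
    "\<forall>q\<in>W. \<forall>r\<in>W. snd c q < snd c r \<longleftrightarrow> (if \<sigma> then snd d q < snd d r else snd d r < snd d q)"
    using assms(1) unfolding same_dir_def by (elim exE conjE)
  obtain W' where W': "openin E W'" "p \<in> W'" "W' \<subseteq> fst d \<inter> fst e"
    "\<forall>q\<in>W'. \<forall>r\<in>W'. snd d q < snd d r \<longleftrightarrow> (if \<tau> then snd e q < snd e r else snd e r < snd e q)"
    using assms(2) unfolding same_dir_def by (elim exE conjE)
  have "\<forall>q\<in>W \<inter> W'. \<forall>r\<in>W \<inter> W'. snd c q < snd c r \<longleftrightarrow> (if \<sigma> = \<tau> then snd e q < snd e r else snd e r < snd e q)"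
    using W(4) W'(4) by (cases \<sigma>; cases \<tau>) simp_all
  moreover have "openin E (W \<inter> W')" "p \<in> W \<inter> W'" "W \<inter> W' \<subseteq> fst c \<inter> fst e" using W W' by blast+
  ultimately show ?thesis unfolding same_dir_def by (intro exI conjI)
qed

lemma same_dir_unique:
  assumes U: "(U, y) \<in> C" and "same_dir \<sigma> (U, y) d p" "same_dir \<tau> (U, y) d p" shows "\<sigma> = \<tau>"
proof -
  have "same_dir (\<sigma> = \<tau>) (U, y) (U, y) p" by (rule same_dir_trans[OF assms(2) same_dir_sym[OF assms(3)]])
  then obtain W where W: "openin E W" "p \<in> W" "W \<subseteq> U \<inter> U"
    "\<forall>q\<in>W. \<forall>r\<in>W. y q < y r \<longleftrightarrow> (if \<sigma> = \<tau> then y q < y r else y r < y q)"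
    unfolding same_dir_def fst_conv snd_conv by (elim exE conjE)
  have "p \<in> U" using W by blast
  then obtain q where "q \<in> U \<inter> W" "y q < y p" using chart_beyond(1)[OF U W(1) \<open>p \<in> U\<close> W(2)] by (elim bexE)
  then have "(if \<sigma> = \<tau> then y q < y p else y p < y q)" using W(2,4) by simp
  then show ?thesis using \<open>y q < y p\<close> by (auto split: if_splits)
qed

definition coherent_orientation :: "('e set \<times> ('e \<Rightarrow> real)) set \<Rightarrow> bool" where
  "coherent_orientation C' \<longleftrightarrow> C' \<subseteq> C \<and> (\<forall>U y. (U, y) \<in> C \<longrightarrow> (U, y) \<in> C' \<or> (U, \<lambda>q. - y q) \<in> C') \<and>
     (\<forall>c\<in>C'. \<forall>d\<in>C'. \<forall>p\<in>fst c \<inter> fst d. same_dir True c d p)"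

text \<open>
  The two transverse directions at each point form a local system with fibre Z/2. Its local sections compare a
  chart with an arbitrarily chosen reference chart at each point, and a global section selects the
  charts that agree with it.
\<close>

lemma orientation_exists:
  assumes Z: "Z2_trivial E"
  shows "\<exists>C'. coherent_orientation C'"
proof -
  \<comment> \<open>The reference charts vary without any continuity; only comparisons at one and the same point are made.\<close>
  define ref where "ref p = (SOME c. c \<in> C \<and> p \<in> fst c)" for p
  have ref: "ref p \<in> C" "p \<in> fst (ref p)" if p: "p \<in> topspace E" for p
  proof -
    obtain U y where "(U, y) \<in> C" "p \<in> U" using chart_at[OF p] by blast
    then have "\<exists>c. c \<in> C \<and> p \<in> fst c" by (metis fst_conv)
    from someI_ex[OF this] show "ref p \<in> C" "p \<in> fst (ref p)" by (simp_all add: ref_def)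
  qed
  define sg where "sg c p = same_dir True c (ref p) p" for c p
  have sg: "same_dir (sg (U, y) p) (U, y) (ref p) p" if Up: "(U, y) \<in> C" "p \<in> U" for U y p
  proof -
    have pE: "p \<in> topspace E" using Up chart_subset by blast
    obtain \<sigma> where s: "same_dir \<sigma> (U, y) (ref p) p"
      using same_dir_exists[OF Up(1), of "fst (ref p)" "snd (ref p)" p] ref[OF pE] Up(2) by auto
    then show ?thesis by (cases \<sigma>; cases "sg (U, y) p") (simp_all add: sg_def)
  qed
  have agree: "(sg (U, y) p = sg (V, z) p) = \<sigma>"
    if "(U, y) \<in> C" "(V, z) \<in> C" "p \<in> U" "p \<in> V" "same_dir \<sigma> (U, y) (V, z) p" for U y V z p \<sigma>
  proof -
    have "same_dir (\<sigma> = sg (V, z) p) (U, y) (ref p) p"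
      by (rule same_dir_trans[OF that(5) sg[OF that(2,4)]])
    from same_dir_unique[OF that(1) sg[OF that(1,3)] this] show ?thesis by auto
  qed
  define S where "S = (\<lambda>c. (fst c, sg c)) ` C"
  have SC: "(U, s) \<in> S \<longleftrightarrow> (\<exists>y. (U, y) \<in> C \<and> s = sg (U, y))" for U s
    unfolding S_def by force
  have "\<exists>f. \<forall>U s p. (U, s) \<in> S \<longrightarrow> p \<in> U \<longrightarrow>
        (\<exists>W. openin E W \<and> p \<in> W \<and> W \<subseteq> U \<and> (\<forall>q\<in>W. (f q = s q) = (f p = s p)))"
  proof (rule Z[unfolded Z2_trivial_def, rule_format])
    fix U s assume "(U, s) \<in> S"
    then obtain y where "(U, y) \<in> C" unfolding SC by (elim exE conjE)
    then show "openin E U" by (rule chart_openin)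
  next
    fix p assume "p \<in> topspace E"
    then obtain U y where "(U, y) \<in> C" "p \<in> U" using chart_at by blast
    then show "\<exists>U s. (U, s) \<in> S \<and> p \<in> U" using SC[of U "sg (U, y)"] by (intro exI[of _ U] exI[of _ "sg (U, y)"]) blast
  next
    fix U s V t p assume "(U, s) \<in> S" "(V, t) \<in> S" and p: "p \<in> U" "p \<in> V"
    then obtain y z where U: "(U, y) \<in> C" "s = sg (U, y)" and V: "(V, z) \<in> C" "t = sg (V, z)" unfolding SC by blast
    obtain \<sigma> where "same_dir \<sigma> (U, y) (V, z) p" using same_dir_exists[OF U(1) V(1) p] by (elim exE)
    then obtain W where W: "openin E W" "p \<in> W" "W \<subseteq> U \<inter> V"
        "\<forall>q\<in>W. \<forall>r\<in>W. y q < y r \<longleftrightarrow> (if \<sigma> then z q < z r else z r < z q)"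
      unfolding same_dir_def fst_conv snd_conv by (elim exE conjE)
    have "(s q = t q) = \<sigma>" if q: "q \<in> W" for q
    proof -
      have "same_dir \<sigma> (U, y) (V, z) q" unfolding same_dir_def fst_conv snd_conv using W q by (intro exI[of _ W] conjI)
      moreover have "q \<in> U" "q \<in> V" using q W(3) by blast+
      ultimately show ?thesis unfolding U(2) V(2) by (intro agree[OF U(1) V(1)])
    qed
    then have "\<forall>q\<in>W. (s q = t q) = (s p = t p)" using W(2) by simp
    then show "\<exists>W. openin E W \<and> p \<in> W \<and> W \<subseteq> U \<inter> V \<and> (\<forall>q\<in>W. (s q = t q) = (s p = t p))"
      using W(1-3) by (intro exI[of _ W] conjI)
  qed
  then obtain f where f1: "\<forall>U s p. (U, s) \<in> S \<longrightarrow> p \<in> U \<longrightarrow>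
        (\<exists>W. openin E W \<and> p \<in> W \<and> W \<subseteq> U \<and> (\<forall>q\<in>W. (f q = s q) = (f p = s p)))" by (elim exE)
  note f = f1[rule_format]
  define C' where "C' = {c \<in> C. \<forall>q\<in>fst c. f q = sg c q}"
  have "(U, y) \<in> C' \<or> (U, \<lambda>q. - y q) \<in> C'" if U: "(U, y) \<in> C" for U y
  proof (rule disjCI)
    assume "(U, \<lambda>q. - y q) \<notin> C'"
    then obtain q0 where q0: "q0 \<in> U" "f q0 \<noteq> sg (U, \<lambda>q. - y q) q0"
      using chart_reverse[OF U] by (auto simp: C'_def)
    have neg: "sg (U, \<lambda>q. - y q) q = (\<not> sg (U, y) q)" if "q \<in> U" for q
    proof -
      have "same_dir False (U, y) (U, \<lambda>q. - y q) q"
        unfolding same_dir_def using chart_openin[OF U] that by (intro exI[of _ U]) simp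
      from agree[OF U chart_reverse[OF U] that that this] show ?thesis by simp
    qed
    have "(f q = sg (U, y) q) = (f q0 = sg (U, y) q0)" if q: "q \<in> U" for q
    proof (rule connectedin_locally_constant[OF chart_connected[OF U] _ q q0(1)])
      fix p assume p: "p \<in> U"
      have "(U, sg (U, y)) \<in> S" unfolding SC by (intro exI[of _ y] conjI U refl)
      from f[OF this p] obtain W where W: "openin E W" "p \<in> W" "\<forall>q\<in>W. (f q = sg (U, y) q) = (f p = sg (U, y) p)"
        by (elim exE conjE)
      show "\<exists>W. openin E W \<and> p \<in> W \<and> (\<forall>q\<in>W \<inter> U. (f q = sg (U, y) q) = (f p = sg (U, y) p))"
        by (intro exI[of _ W] conjI ballI W(1,2)) (elim IntE, rule bspec[OF W(3)])
    qed
    moreover have "f q0 = sg (U, y) q0" using q0 neg by simp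
    ultimately show "(U, y) \<in> C'" using U by (simp add: C'_def)
  qed
  moreover have "same_dir True c d p" if c: "c \<in> C'" and d: "d \<in> C'" and p: "p \<in> fst c \<inter> fst d" for c d p
  proof -
    obtain U y V z where e: "c = (U, y)" "d = (V, z)" by (metis surj_pair)
    have U: "(U, y) \<in> C" "(V, z) \<in> C" "p \<in> U" "p \<in> V" using c d p by (simp_all add: C'_def e)
    obtain \<sigma> where s: "same_dir \<sigma> (U, y) (V, z) p" using same_dir_exists[OF U] by (elim exE)
    have a: "\<forall>q\<in>U. f q = sg (U, y) q" "\<forall>q\<in>V. f q = sg (V, z) q" using c d unfolding C'_def e by simp_all
    have "sg (U, y) p = sg (V, z) p" by (rule trans[OF bspec[OF a(1) U(3), symmetric] bspec[OF a(2) U(4)]])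
    then show ?thesis using agree[OF U s] s by (simp add: e)
  qed
  moreover have "C' \<subseteq> C" by (auto simp: C'_def)
  ultimately have "coherent_orientation C'" unfolding coherent_orientation_def by simp
  then show ?thesis by (rule exI)
qed

definition locally_single :: "'e set \<Rightarrow> bool" where
  "locally_single l \<longleftrightarrow> (\<forall>p\<in>topspace E. \<exists>U y. (U, y) \<in> C \<and> p \<in> U \<and> (\<forall>q\<in>l \<inter> U. \<forall>r\<in>l \<inter> U. y q = y r))"

end

section \<open>Leaves separate when all Z/2 local systems are trivial\<close>

locale oriented_leaf = foliated_space E C for E :: "'e topology" and C +
  fixes C' and l :: "'e set"
  assumes orient: "coherent_orientation C'" and l: "is_leaf l" and single: "locally_single l" and Z: "Z2_trivial E"
begin

lemma oriented_chart: "(U, y) \<in> C' \<Longrightarrow> (U, y) \<in> C"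
  using orient unfolding coherent_orientation_def by (elim conjE) (rule subsetD)

lemma oriented_or_reverse: "(U, y) \<in> C \<Longrightarrow> (U, y) \<in> C' \<or> (U, \<lambda>q. - y q) \<in> C'"
  using orient unfolding coherent_orientation_def by simp

lemma oriented_same_dir:
  assumes "(U, y) \<in> C'" "(V, z) \<in> C'" "p \<in> U" "p \<in> V"
  obtains W where "openin E W" "p \<in> W" "W \<subseteq> U \<inter> V" "\<And>q r. q \<in> W \<Longrightarrow> r \<in> W \<Longrightarrow> y q < y r \<longleftrightarrow> z q < z r"
proof -
  have "\<forall>c\<in>C'. \<forall>d\<in>C'. \<forall>p\<in>fst c \<inter> fst d. same_dir True c d p" using orient unfolding coherent_orientation_def by (elim conjE)
  from bspec[OF bspec[OF bspec[OF this assms(1)] assms(2)], of p] have "same_dir True (U, y) (V, z) p" using assms(3,4) by simp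
  then obtain W where "openin E W" "p \<in> W" "W \<subseteq> U \<inter> V" "\<forall>q\<in>W. \<forall>r\<in>W. y q < y r \<longleftrightarrow> (if True then z q < z r else z r < z q)"
    unfolding same_dir_def fst_conv snd_conv by (elim exE conjE)
  then show thesis using that by simp
qed

text \<open>
  In a chart that meets \<open>l\<close> in a single plaque this is the closed upper half cut off by that plaque.
  In a chart that misses \<open>l\<close> it is constantly false.
\<close>

definition above :: "'e set \<Rightarrow> ('e \<Rightarrow> real) \<Rightarrow> 'e \<Rightarrow> bool" where
  "above U y q \<longleftrightarrow> (\<exists>r\<in>l \<inter> U. y r \<le> y q)"

definition single_chart :: "'e set \<Rightarrow> ('e \<Rightarrow> real) \<Rightarrow> bool" where
  "single_chart U y \<longleftrightarrow> (U, y) \<in> C' \<and> (\<forall>q\<in>l \<inter> U. \<forall>r\<in>l \<inter> U. y q = y r)"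

lemma single_chartD:
  assumes "single_chart U y" "q \<in> l" "q \<in> U" "r \<in> l" "r \<in> U" shows "y q = y r"
proof -
  have *: "\<forall>q\<in>l \<inter> U. \<forall>r\<in>l \<inter> U. y q = y r" using assms(1) unfolding single_chart_def by (rule conjunct2)
  show ?thesis by (rule bspec[OF bspec[OF *]]) (use assms(2-5) in blast)+
qed

lemma single_chart_at:
  assumes "p \<in> topspace E" shows "\<exists>U y. single_chart U y \<and> p \<in> U"
proof -
  obtain U y where U: "(U, y) \<in> C" "p \<in> U" "\<forall>q\<in>l \<inter> U. \<forall>r\<in>l \<inter> U. y q = y r"
    using single assms unfolding locally_single_def by blast
  from oriented_or_reverse[OF U(1)] show ?thesis
  proof
    assume "(U, y) \<in> C'"
    then have "single_chart U y" unfolding single_chart_def using U(3) by (intro conjI)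
    then show ?thesis using U(2) by blast
  next
    assume "(U, \<lambda>q. - y q) \<in> C'"
    moreover have "\<forall>q\<in>l \<inter> U. \<forall>r\<in>l \<inter> U. - y q = - y r"
      by (intro ballI arg_cong[of _ _ uminus]) (rule bspec[OF bspec[OF U(3)]])
    ultimately have "single_chart U (\<lambda>q. - y q)" unfolding single_chart_def by (intro conjI)
    then show ?thesis using U(2) by blast
  qed
qed

lemma plaque_in_leaf:
  assumes "(U, y) \<in> C" "p \<in> U" "q \<in> U" "y p = y q" "p \<in> l" shows "q \<in> l"
  by (rule is_leaf_saturated[OF l, unfolded saturated_def, rule_format, OF assms(5) plaque_relI[OF assms(1-4)]])

lemma above_leaf:
  assumes "single_chart U y" "p \<in> l" "p \<in> U" shows "above U y q \<longleftrightarrow> y p \<le> y q"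
proof
  assume "above U y q"
  then obtain r where r: "r \<in> l" "r \<in> U" "y r \<le> y q" unfolding above_def by blast
  have "y p = y r" by (rule single_chartD[OF assms r(1,2)])
  then show "y p \<le> y q" using r(3) by simp
next
  assume "y p \<le> y q" then show "above U y q" unfolding above_def using assms(2,3) by blast
qed

lemma above_locally_constant:
  assumes U: "single_chart U y" and p: "p \<in> U" "p \<notin> l"
  shows "\<exists>W. openin E W \<and> p \<in> W \<and> W \<subseteq> U \<and> W \<inter> l = {} \<and> (\<forall>q\<in>W. above U y q = above U y p)"
proof (cases "l \<inter> U = {}")
  case True
  have "(U, y) \<in> C'" using U unfolding single_chart_def by (rule conjunct1)
  then have o: "openin E U" by (rule chart_openin[OF oriented_chart])
  have "\<not> above U y q" for q using True by (simp add: above_def)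
  then show ?thesis using True p o by (intro exI[of _ U]) (simp add: Int_commute)
next
  case False
  then obtain r where r: "r \<in> l" "r \<in> U" by blast
  have UC: "(U, y) \<in> C" using U unfolding single_chart_def by (intro oriented_chart) (rule conjunct1)
  have ne: "y r \<noteq> y p" using plaque_in_leaf[OF UC r(2) p(1) _ r(1)] p(2) by auto
  have off: "q \<notin> l" if "q \<in> U" "y q \<noteq> y r" for q
    using single_chartD[OF U _ that(1) r] that(2) by blast
  have ab: "above U y q \<longleftrightarrow> y r \<le> y q" for q by (rule above_leaf[OF U r])
  show ?thesis
  proof (cases "y r < y p")
    case True
    show ?thesis
    proof (intro exI[of _ "{q \<in> U. y r < y q}"] conjI)
      show "{q \<in> U. y r < y q} \<inter> l = {}" using off by force
      show "\<forall>q\<in>{q \<in> U. y r < y q}. above U y q = above U y p" using True by (simp add: ab)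
    qed (use True p chart_openin_less(2)[OF UC] in auto)
  next
    case False
    show ?thesis
    proof (intro exI[of _ "{q \<in> U. y q < y r}"] conjI)
      show "{q \<in> U. y q < y r} \<inter> l = {}" using off by force
      show "\<forall>q\<in>{q \<in> U. y q < y r}. above U y q = above U y p" using False ne by (simp add: ab)
    qed (use False ne p chart_openin_less(1)[OF UC] in auto)
  qed
qed

text \<open>
  At points of \<open>l\<close> the orientation makes the upper halves in two charts agree; away from \<open>l\<close> both
  conditions are locally constant.
\<close>

lemma above_compatible:
  assumes U: "single_chart U y" and V: "single_chart V z" and p: "p \<in> U" "p \<in> V"
  shows "\<exists>W. openin E W \<and> p \<in> W \<and> W \<subseteq> U \<inter> V \<and> (\<forall>q\<in>W. (above U y q = above V z q) = (above U y p = above V z p))"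
proof (cases "p \<in> l")
  case True
  have c: "(U, y) \<in> C'" "(V, z) \<in> C'" using U V by (simp_all add: single_chart_def)
  obtain W where W: "openin E W" "p \<in> W" "W \<subseteq> U \<inter> V" "\<And>q r. q \<in> W \<Longrightarrow> r \<in> W \<Longrightarrow> y q < y r \<longleftrightarrow> z q < z r"
    by (rule oriented_same_dir[OF c p]) blast
  have "above U y q = above V z q" if "q \<in> W" for q
    using W(4)[OF that W(2)] above_leaf[OF U True p(1)] above_leaf[OF V True p(2)] by (simp add: not_less[symmetric])
  then show ?thesis using W(1-3) by (intro exI[of _ W]) (simp add: W(2))
next
  case False
  obtain W where W: "openin E W" "p \<in> W" "W \<subseteq> U" "\<forall>q\<in>W. above U y q = above U y p"
    using above_locally_constant[OF U p(1) False] by blast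
  obtain W' where W': "openin E W'" "p \<in> W'" "W' \<subseteq> V" "\<forall>q\<in>W'. above V z q = above V z p"
    using above_locally_constant[OF V p(2) False] by blast
  have c: "(above U y q = above V z q) = (above U y p = above V z p)" if q: "q \<in> W \<inter> W'" for q
  proof -
    have "above U y q = above U y p" "above V z q = above V z p"
      using q bspec[OF W(4)] bspec[OF W'(4)] by (elim IntE, blast)+
    then show ?thesis by argo
  qed
  show ?thesis
  proof (intro exI[of _ "W \<inter> W'"] conjI ballI openin_Int W(1) W'(1) IntI W(2) W'(2))
    show "W \<inter> W' \<subseteq> U \<inter> V" using W(3) W'(3) by blast
  qed (rule c)
qed

text \<open>
  The functions \<open>above\<close> form a local system whose global section \<open>f\<close> jumps exactly at the leaf. Along the
  leaf \<open>f\<close> is constant, because plaques are connected, so it can be normalised to be true there.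
\<close>

lemma positive_side_exists:
  "\<exists>F. (\<forall>p. p \<in> l \<longrightarrow> F p) \<and>
     (\<forall>p. p \<in> topspace E \<longrightarrow> p \<notin> l \<longrightarrow> (\<exists>W. openin E W \<and> p \<in> W \<and> W \<inter> l = {} \<and> (\<forall>q\<in>W. F q = F p))) \<and>
     (\<forall>U y p. (U, y) \<in> C' \<longrightarrow> p \<in> U \<longrightarrow> p \<in> l \<longrightarrow>
        (\<exists>W. openin E W \<and> p \<in> W \<and> W \<subseteq> U \<and> (\<forall>q\<in>W. F q \<longleftrightarrow> y p \<le> y q)))"
proof -
  define S where "S = {(U, above U y) | U y. single_chart U y}"
  have "\<exists>f. \<forall>U s p. (U, s) \<in> S \<longrightarrow> p \<in> U \<longrightarrow>
        (\<exists>W. openin E W \<and> p \<in> W \<and> W \<subseteq> U \<and> (\<forall>q\<in>W. (f q = s q) = (f p = s p)))"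
  proof (rule Z[unfolded Z2_trivial_def, rule_format])
    fix U s assume "(U, s) \<in> S"
    then obtain y where "single_chart U y" unfolding S_def by auto
    then have "(U, y) \<in> C'" unfolding single_chart_def by (rule conjunct1)
    then show "openin E U" by (rule chart_openin[OF oriented_chart])
  next
    fix p assume "p \<in> topspace E"
    then obtain U y where "single_chart U y" "p \<in> U" using single_chart_at by blast
    then show "\<exists>U s. (U, s) \<in> S \<and> p \<in> U" unfolding S_def by (intro exI[of _ U] exI[of _ "above U y"] conjI CollectI exI[of _ y] refl)
  next
    fix U s V t p assume "(U, s) \<in> S" "(V, t) \<in> S" and p: "p \<in> U" "p \<in> V"
    then obtain y z where "single_chart U y" "s = above U y" "single_chart V z" "t = above V z" unfolding S_def by auto
    then show "\<exists>W. openin E W \<and> p \<in> W \<and> W \<subseteq> U \<inter> V \<and> (\<forall>q\<in>W. (s q = t q) = (s p = t p))"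
      using above_compatible p by simp
  qed
  then obtain f where f1: "\<forall>U s p. (U, s) \<in> S \<longrightarrow> p \<in> U \<longrightarrow>
        (\<exists>W. openin E W \<and> p \<in> W \<and> W \<subseteq> U \<and> (\<forall>q\<in>W. (f q = s q) = (f p = s p)))" by (elim exE)
  note f0 = f1[rule_format]
  have f: "\<exists>W. openin E W \<and> p \<in> W \<and> W \<subseteq> U \<and> (\<forall>q\<in>W. (f q = above U y q) = (f p = above U y p))"
    if "single_chart U y" "p \<in> U" for U y p
    by (rule f0) (use that in \<open>auto simp: S_def\<close>)
  have f_plaque: "f p = f q" if pq: "plaque_rel p q" "p \<in> l" for p q
  proof -
    obtain U y where U: "(U, y) \<in> C" "p \<in> U" "q \<in> U" "y p = y q" using pq unfolding plaque_rel_def by (elim exE conjE)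
    have sub: "{r \<in> U. y r = y p} \<subseteq> l" using plaque_in_leaf[OF U(1,2) _ _ pq(2)] by auto
    show ?thesis
    proof (rule connectedin_locally_constant[OF plaque_connected[OF U(1), of "y p"]])
      fix r assume r: "r \<in> {r \<in> U. y r = y p}"
      have rE: "r \<in> topspace E" "r \<in> l" using r chart_subset[OF U(1)] sub by blast+
      obtain V z where V: "single_chart V z" "r \<in> V" using single_chart_at[OF rE(1)] by (elim exE conjE)
      obtain W where W: "openin E W" "r \<in> W" "W \<subseteq> V" "\<forall>q\<in>W. (f q = above V z q) = (f r = above V z r)"
        using f[OF V] by (elim exE conjE)
      have ab: "above V z q" if "q \<in> V" "q \<in> l" for q
        using above_leaf[OF V(1) that(2,1), of q] by simp
      have "f q = f r" if q: "q \<in> W \<inter> {r \<in> U. y r = y p}" for q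
        using W(4) q ab[of q] ab[of r] W(2,3) sub rE by blast
      then show "\<exists>W. openin E W \<and> r \<in> W \<and> (\<forall>q\<in>W \<inter> {r \<in> U. y r = y p}. f q = f r)"
        using W(1,2) by (intro exI[of _ W] conjI ballI)
    qed (use U in auto)
  qed
  obtain p0 where p0: "p0 \<in> l" using is_leaf_nonempty[OF l] by blast
  have f_l: "f p = f p0" if "p \<in> l" for p
  proof -
    have "saturated {q \<in> l. f q = f p0}"
      unfolding saturated_def
    proof (intro allI impI)
      fix p q assume p: "p \<in> {q \<in> l. f q = f p0}" "plaque_rel p q"
      then have "q \<in> l" using is_leaf_saturated[OF l] unfolding saturated_def by blast
      then show "q \<in> {q \<in> l. f q = f p0}" using f_plaque[OF p(2)] p(1) by simp
    qed
    from saturated_leaf_subset[OF this, of p0] is_leaf_eq[OF l p0] that p0 show ?thesis by blast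
  qed
  define F where "F q = (f q = f p0)" for q
  show ?thesis
  proof (rule exI[of _ F], intro conjI allI impI)
    fix p assume "p \<in> l" then show "F p" using f_l by (simp add: F_def)
  next
    fix p assume p: "p \<in> topspace E" "p \<notin> l"
    obtain U y where U: "single_chart U y" "p \<in> U" using single_chart_at[OF p(1)] by (elim exE conjE)
    obtain W where W: "openin E W" "p \<in> W" "\<forall>q\<in>W. (f q = above U y q) = (f p = above U y p)"
      using f[OF U] by (elim exE conjE)
    obtain W' where W': "openin E W'" "p \<in> W'" "W' \<inter> l = {}" "\<forall>q\<in>W'. above U y q = above U y p"
      using above_locally_constant[OF U p(2)] by (elim exE conjE)
    have c: "F q = F p" if q: "q \<in> W \<inter> W'" for q
    proof -
      have "(f q = above U y q) = (f p = above U y p)" "above U y q = above U y p"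
        using q bspec[OF W(3)] bspec[OF W'(4)] by (elim IntE, blast)+
      then show ?thesis unfolding F_def by argo
    qed
    show "\<exists>W. openin E W \<and> p \<in> W \<and> W \<inter> l = {} \<and> (\<forall>q\<in>W. F q = F p)"
    proof (intro exI[of _ "W \<inter> W'"] conjI ballI openin_Int W(1) W'(1) IntI W(2) W'(2))
      show "W \<inter> W' \<inter> l = {}" using W'(3) by blast
    qed (rule c)
  next
    fix U y p assume U: "(U, y) \<in> C'" "p \<in> U" "p \<in> l"
    have pE: "p \<in> topspace E" using U(3) is_leaf_subset[OF l] by blast
    obtain V z where V: "single_chart V z" "p \<in> V" using single_chart_at[OF pE] by (elim exE conjE)
    have VC: "(V, z) \<in> C'" using V(1) by (simp add: single_chart_def)
    obtain W where W: "openin E W" "p \<in> W" "\<forall>q\<in>W. (f q = above V z q) = (f p = above V z p)"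
      using f[OF V] by (elim exE conjE)
    obtain W' where W': "openin E W'" "p \<in> W'" "W' \<subseteq> U \<inter> V" "\<And>q r. q \<in> W' \<Longrightarrow> r \<in> W' \<Longrightarrow> y q < y r \<longleftrightarrow> z q < z r"
      by (rule oriented_same_dir[OF U(1) VC U(2) V(2)]) blast
    have ab: "above V z q \<longleftrightarrow> z p \<le> z q" for q by (rule above_leaf[OF V(1) U(3) V(2)])
    have c: "F q \<longleftrightarrow> y p \<le> y q" if q: "q \<in> W \<inter> W'" for q
    proof -
      have "q \<in> W" using q by (rule IntD1)
      from bspec[OF W(3) this] have "(f q = (z p \<le> z q)) = (f p = True)" unfolding ab by simp
      moreover have "f p = f p0" by (rule f_l[OF U(3)])
      ultimately have "F q \<longleftrightarrow> z p \<le> z q" unfolding F_def by argo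
      also have "\<dots> \<longleftrightarrow> y p \<le> y q" using W'(4)[of q p] q W'(2) by (simp add: not_less[symmetric])
      finally show ?thesis .
    qed
    show "\<exists>W. openin E W \<and> p \<in> W \<and> W \<subseteq> U \<and> (\<forall>q\<in>W. F q \<longleftrightarrow> y p \<le> y q)"
    proof (intro exI[of _ "W \<inter> W'"] conjI ballI openin_Int W(1) W'(1) IntI W(2) W'(2))
      show "W \<inter> W' \<subseteq> U" using W'(3) by blast
    qed (rule c)
  qed
qed

text \<open>
  Let \<open>F\<close> be the global positive half. In an oriented chart \<open>F\<close> depends on the transverse coordinate
  only, and it is locally nondecreasing, hence nondecreasing. As it is
  true on \<open>l\<close> and false immediately below each plaque of \<open>l\<close>, the chart contains at most one such plaque.
\<close>

lemma side_exists: "\<exists>Q. side l Q"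
proof -
  obtain F where F: "\<forall>p. p \<in> l \<longrightarrow> F p"
    "\<forall>p. p \<in> topspace E \<longrightarrow> p \<notin> l \<longrightarrow> (\<exists>W. openin E W \<and> p \<in> W \<and> W \<inter> l = {} \<and> (\<forall>q\<in>W. F q = F p))"
    "\<forall>U y p. (U, y) \<in> C' \<longrightarrow> p \<in> U \<longrightarrow> p \<in> l \<longrightarrow>
        (\<exists>W. openin E W \<and> p \<in> W \<and> W \<subseteq> U \<and> (\<forall>q\<in>W. F q \<longleftrightarrow> y p \<le> y q))"
    using positive_side_exists by (elim exE conjE)
  note F1 = F(1)[rule_format] and F2 = F(2)[rule_format] and F3 = F(3)[rule_format]
  have F_plaque: "F p = F q" if U: "(U, y) \<in> C" "p \<in> U" "q \<in> U" "y p = y q" for U y p q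
  proof (cases "p \<in> l")
    case True
    then show ?thesis using F1 plaque_in_leaf[OF U] by simp
  next
    case False
    have sub: "r \<notin> l" if "r \<in> U" "y r = y p" for r
      using plaque_in_leaf[OF U(1) that(1) U(2) that(2)] False by blast
    show ?thesis
    proof (rule connectedin_locally_constant[OF plaque_connected[OF U(1), of "y p"]])
      fix r assume r: "r \<in> {r \<in> U. y r = y p}"
      then have "r \<in> topspace E" "r \<notin> l" using chart_subset[OF U(1)] sub by auto
      from F2[OF this] obtain W where W: "openin E W" "r \<in> W" "\<forall>q\<in>W. F q = F r" by (elim exE conjE)
      show "\<exists>W. openin E W \<and> r \<in> W \<and> (\<forall>q\<in>W \<inter> {r \<in> U. y r = y p}. F q = F r)"
        by (intro exI[of _ W] conjI ballI W(1,2)) (elim IntE, rule bspec[OF W(3)])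
    qed (use U in auto)
  qed
  have F_mono: "F r" if U: "(U, y) \<in> C'" and qr: "q \<in> U" "r \<in> U" "y q \<le> y r" "F q" for U y q r
  proof -
    have UC: "(U, y) \<in> C" by (rule oriented_chart[OF U])
    have conn: "connected (y ` U)" by (rule chart_image_connected[OF UC chart_connected[OF UC] order_refl])
    \<comment> \<open>\<open>F\<close> as a function of the transverse coordinate; its monotonicity is local, so bisection applies.\<close>
    define \<sigma> where "\<sigma> t = (\<exists>q\<in>U. y q = t \<and> F q)" for t
    have \<sigma>: "\<sigma> (y p) = F p" if "p \<in> U" for p
      using F_plaque[OF UC _ that] that unfolding \<sigma>_def by blast
    have "\<sigma> (y q) \<longrightarrow> \<sigma> (y r)"
      using qr(3)
    proof (induction rule: Bolzano[where P = "\<lambda>s t. \<sigma> s \<longrightarrow> \<sigma> t"])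
      case (trans a b c) then show ?case by blast
    next
      case (local x)
      then have "x \<in> y ` U" using conn qr(1,2) unfolding connected_iff_interval by blast
      then obtain p where p: "p \<in> U" "x = y p" by blast
      have pE: "p \<in> topspace E" using p chart_subset[OF UC] by blast
      have "\<exists>W. openin E W \<and> p \<in> W \<and> W \<subseteq> U \<and> ((\<forall>q\<in>W. F q = F p) \<or> (\<forall>q\<in>W. F q \<longleftrightarrow> y p \<le> y q))"
      proof (cases "p \<in> l")
        case True
        from F3[OF U p(1) True] show ?thesis by (elim exE conjE) (intro exI conjI disjI2)
      next
        case False
        from F2[OF pE False] obtain W where "openin E W" "p \<in> W" "\<forall>q\<in>W. F q = F p" by (elim exE conjE)
        then show ?thesis using p(1) chart_openin[OF UC]
          by (intro exI[of _ "W \<inter> U"] conjI disjI1 openin_Int IntI Int_lower2 ballI) (assumption | elim IntE, erule (1) bspec)+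
      qed
      then obtain W where W: "openin E W" "p \<in> W" "W \<subseteq> U" "(\<forall>q\<in>W. F q = F p) \<or> (\<forall>q\<in>W. F q \<longleftrightarrow> y p \<le> y q)"
        by (elim exE conjE)
      have "open (y ` W)" by (rule chart_open_map[OF UC W(1,3)])
      then obtain d where d: "d > 0" "ball x d \<subseteq> y ` W" using p(2) W(2) openE by (metis imageI)
      have m: "\<sigma> s \<longrightarrow> \<sigma> t" if st: "s \<le> x \<and> x \<le> t \<and> t - s < d" for s t
      proof -
        have "s \<in> ball x d" "t \<in> ball x d" using st by (auto simp: dist_real_def)
        then have "s \<in> y ` W" "t \<in> y ` W" using d(2) by blast+
        then obtain u v where uv: "u \<in> W" "s = y u" "v \<in> W" "t = y v" by (elim imageE)
        have "u \<in> U" "v \<in> U" using uv W(3) by blast+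
        then have e: "\<sigma> s = F u" "\<sigma> t = F v" using \<sigma> uv by simp_all
        from W(4) show ?thesis
        proof
          assume c: "\<forall>q\<in>W. F q = F p"
          show ?thesis using bspec[OF c uv(1)] bspec[OF c uv(3)] e by simp
        next
          assume "\<forall>q\<in>W. F q \<longleftrightarrow> y p \<le> y q"
          then have "F v" using uv st p(2) by simp
          then show ?thesis using e by simp
        qed
      qed
      show ?case by (intro exI[of _ d] conjI d(1) allI) (rule impI, rule m)
    qed
    then show ?thesis using \<sigma>[OF qr(1)] \<sigma>[OF qr(2)] qr(4) by simp
  qed
  \<comment> \<open>Immediately below a plaque of \<open>l\<close> the half \<open>F\<close> is left.\<close>
  have gap: "\<exists>r\<in>U. t < y r \<and> y r < y p \<and> \<not> F r"
    if U: "(U, y) \<in> C'" "p \<in> U" "p \<in> l" "t < y p" for U y p t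
  proof -
    have UC: "(U, y) \<in> C" by (rule oriented_chart[OF U(1)])
    from F3[OF U(1-3)] obtain W where W: "openin E W" "p \<in> W" "W \<subseteq> U" "\<forall>q\<in>W. F q \<longleftrightarrow> y p \<le> y q" by (elim exE conjE)
    have o: "openin E ({q \<in> U. t < y q} \<inter> W)" by (rule openin_Int[OF chart_openin_less(2)[OF UC] W(1)])
    have "p \<in> {q \<in> U. t < y q} \<inter> W" using U W(2) by simp
    from chart_beyond(1)[OF UC o U(2) this] show ?thesis using W(4) by fastforce
  qed
  have crossing: "l \<inter> U = {q \<in> U. y q = y p} \<and> {q. q \<in> topspace E - l \<and> F q} \<inter> U = {q \<in> U. y p < y q}"
    if U: "(U, y) \<in> C'" "p \<in> U" "p \<in> l" for U y p
  proof -
    have UC: "(U, y) \<in> C" by (rule oriented_chart[OF U(1)])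
    have not_less: "\<not> y q < y p'" if q: "q \<in> U" "F q" and p': "p' \<in> U" "p' \<in> l" for q p'
    proof
      assume "y q < y p'"
      from gap[OF U(1) p' this] obtain r where r: "r \<in> U" "y q < y r" "\<not> F r" by blast
      then show False using F_mono[OF U(1) q(1) r(1) _ q(2)] by simp
    qed
    have 1: "q \<in> l \<longleftrightarrow> y q = y p" if q: "q \<in> U" for q
    proof
      assume "q \<in> l"
      then show "y q = y p" using not_less[OF q F1 U(2,3)] not_less[OF U(2) F1[OF U(3)] q] by force
    next
      assume "y q = y p"
      then show "q \<in> l" using plaque_in_leaf[OF UC U(2) q _ U(3)] by simp
    qed
    have 2: "q \<notin> l \<and> F q \<longleftrightarrow> y p < y q" if q: "q \<in> U" for q
    proof
      assume "q \<notin> l \<and> F q"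
      then show "y p < y q" using not_less[OF q _ U(2,3)] 1[OF q] by force
    next
      assume "y p < y q"
      then show "q \<notin> l \<and> F q" using 1[OF q] F_mono[OF U(1,2) q _ F1[OF U(3)]] by simp
    qed
    have "U \<subseteq> topspace E" by (rule chart_subset[OF UC])
    then have "{q. q \<in> topspace E - l \<and> F q} \<inter> U = {q \<in> U. q \<notin> l \<and> F q}" by blast
    also have "\<dots> = {q \<in> U. y p < y q}" using 2 by blast
    finally show ?thesis using 1 by blast
  qed
  define Q where "Q = {q. q \<in> topspace E - l \<and> F q}"
  have "\<exists>T. openin E T \<and> p \<in> T \<and> T \<subseteq> Q" if p: "p \<in> Q" for p
  proof -
    have p': "p \<in> topspace E" "p \<notin> l" "F p" using p by (simp_all add: Q_def)
    from F2[OF p'(1,2)] obtain W where W: "openin E W" "p \<in> W" "W \<inter> l = {}" "\<forall>q\<in>W. F q = F p" by (elim exE conjE)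
    then have "W \<subseteq> Q" using p'(3) openin_subset[OF W(1)] unfolding Q_def by blast
    then show ?thesis using W by blast
  qed
  then have o1: "openin E Q" by (subst openin_subopen) blast
  have "\<exists>T. openin E T \<and> p \<in> T \<and> T \<subseteq> topspace E - l - Q" if p: "p \<in> topspace E - l - Q" for p
  proof -
    have p': "p \<in> topspace E" "p \<notin> l" "\<not> F p" using p unfolding Q_def by blast+
    from F2[OF p'(1,2)] obtain W where W: "openin E W" "p \<in> W" "W \<inter> l = {}" "\<forall>q\<in>W. F q = F p" by (elim exE conjE)
    then have "W \<subseteq> topspace E - l - Q" using p'(3) openin_subset[OF W(1)] unfolding Q_def by blast
    then show ?thesis using W by blast
  qed
  then have o2: "openin E (topspace E - l - Q)" by (subst openin_subopen) blast
  have "l \<inter> U = {q \<in> U. y q = y p} \<and> (Q \<inter> U = {q \<in> U. y p < y q} \<or> Q \<inter> U = {q \<in> U. y q < y p})"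
    if U: "(U, y) \<in> C" "p \<in> U" "p \<in> l" for U y p
    using oriented_or_reverse[OF U(1)]
  proof
    assume "(U, y) \<in> C'"
    from crossing[OF this U(2,3)] show ?thesis by (simp add: Q_def)
  next
    assume "(U, \<lambda>q. - y q) \<in> C'"
    from crossing[OF this U(2,3)] show ?thesis by (simp add: Q_def)
  qed
  then have "side l Q" unfolding side_def using l o1 o2 by (auto simp: Q_def)
  then show ?thesis by (rule exI)
qed

end

context connected_foliated_space
begin

theorem Z2_trivial_separable_leaves:
  assumes "Z2_trivial E" "\<And>l. is_leaf l \<Longrightarrow> locally_single l"
  shows "separable_leaves"
  unfolding separable_leaves_def
proof (intro allI impI)
  fix l assume l: "is_leaf l"
  obtain C' where "coherent_orientation C'" using orientation_exists[OF assms(1)] by (elim exE)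
  then interpret oriented_leaf E C C' l
    using assms l by unfold_locales simp_all
  show "\<exists>Q. side l Q" by (rule side_exists)
qed

end

section \<open>Homotopy of paths\<close>

abbreviation unit_square :: "(real \<times> real) set" where
  "unit_square \<equiv> {0..1} \<times> {0..1}"

definition path_hom :: "'a topology \<Rightarrow> (real \<Rightarrow> 'a) \<Rightarrow> (real \<Rightarrow> 'a) \<Rightarrow> bool" where
  "path_hom X p q \<longleftrightarrow> homotopic_with (\<lambda>r. r 0 = p 0 \<and> r 1 = p 1) (top_of_set {0..1}) X p q"

lemma path_hom_iff:
  "path_hom X p q \<longleftrightarrow> (\<exists>h. continuous_map (top_of_set unit_square) X h \<and>
     (\<forall>t\<in>{0..1}. h (0, t) = p t) \<and> (\<forall>t\<in>{0..1}. h (1, t) = q t) \<and> (\<forall>s\<in>{0..1}. h (s, 0) = p 0 \<and> h (s, 1) = p 1))"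
  unfolding path_hom_def by (subst homotopic_with) auto

lemma path_hom_pathin: "path_hom X p q \<Longrightarrow> pathin X p \<and> pathin X q"
  unfolding path_hom_def pathin_def by (rule homotopic_with_imp_continuous_maps)

lemma path_hom_ends: "path_hom X p q \<Longrightarrow> q 0 = p 0 \<and> q 1 = p 1"
  unfolding path_hom_def by (drule homotopic_with_imp_property) simp

lemma path_hom_refl: "pathin X p \<Longrightarrow> path_hom X p p"
  unfolding path_hom_def pathin_def by simp

lemma path_hom_sym:
  assumes "path_hom X p q" shows "path_hom X q p"
proof -
  have "q 0 = p 0" "q 1 = p 1" using path_hom_ends[OF assms] by simp_all
  then show ?thesis using homotopic_with_symD assms unfolding path_hom_def by simp
qed

lemma path_hom_trans:
  assumes "path_hom X p q" "path_hom X q r" shows "path_hom X p r"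
proof -
  have "q 0 = p 0" "q 1 = p 1" using path_hom_ends[OF assms(1)] by simp_all
  then show ?thesis using homotopic_with_trans assms unfolding path_hom_def by auto
qed

lemma path_hom_cong:
  assumes "path_hom X p q" "\<And>t. t \<in> {0..1} \<Longrightarrow> p' t = p t" "\<And>t. t \<in> {0..1} \<Longrightarrow> q' t = q t"
  shows "path_hom X p' q'"
  using assms unfolding path_hom_iff by simp

lemma path_hom_compose:
  assumes "path_hom X p q" "continuous_map X Y f" shows "path_hom Y (f \<circ> p) (f \<circ> q)"
  using assms unfolding path_hom_def by (elim homotopic_with_compose_continuous_map_left) simp_all

text \<open>
  Two paths with common endpoints in a convex set are homotopic there, and so are their images under a continuous map.
  All reparametrisations below, and the simple connectivity of boxes and of planes, are instances.
\<close>

lemma path_hom_convex: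
  fixes T :: "'v::real_normed_vector set"
  assumes T: "convex T" and K: "continuous_map (top_of_set T) X K"
    and f: "continuous_on {0..1} f" "f ` {0..1} \<subseteq> T" and g: "continuous_on {0..1} g" "g ` {0..1} \<subseteq> T"
    and ends: "f 0 = g 0" "f 1 = g 1"
    and p: "\<And>t. t \<in> {0..1} \<Longrightarrow> p t = K (f t)" and q: "\<And>t. t \<in> {0..1} \<Longrightarrow> q t = K (g t)"
  shows "path_hom X p q"
proof -
  have "homotopic_paths T f g"
  proof (rule homotopic_paths_linear)
    fix t :: real assume "t \<in> {0..1}"
    then have "f t \<in> T" "g t \<in> T" using f g by blast+
    then show "closed_segment (f t) (g t) \<subseteq> T" by (rule closed_segment_subset[OF _ _ T])
  qed (use f g ends in \<open>simp_all add: path_def pathstart_def pathfinish_def\<close>)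
  then have "path_hom (top_of_set T) f g"
    by (simp add: path_hom_def homotopic_paths_def pathstart_def pathfinish_def)
  from path_hom_compose[OF this K] show ?thesis
    by (rule path_hom_cong) (simp_all add: p q)
qed

lemma square_glue:
  assumes h1: "continuous_map (top_of_set unit_square) X h1" and h2: "continuous_map (top_of_set unit_square) X h2"
    and eq: "\<And>s. s \<in> {0..1} \<Longrightarrow> h1 (s, 1) = h2 (s, 0)"
  shows "continuous_map (top_of_set unit_square) X (\<lambda>z. if snd z \<le> 1/2 then h1 (fst z, 2 * snd z) else h2 (fst z, 2 * snd z - 1))"
proof (rule continuous_map_cases_le)
  have "continuous_map (top_of_set (unit_square \<inter> {z. snd z \<le> 1/2})) (top_of_set unit_square) (\<lambda>z. (fst z, 2 * snd z))"
    by (auto simp: continuous_map_subtopology_eu intro!: continuous_intros)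
  from continuous_map_compose[OF this h1]
  show "continuous_map (subtopology (top_of_set unit_square) {z \<in> topspace (top_of_set unit_square). snd z \<le> 1/2}) X (\<lambda>z. h1 (fst z, 2 * snd z))"
    by (simp add: o_def subtopology_subtopology Collect_conj_eq Int_assoc[symmetric] Times_Int_Times)
  have "continuous_map (top_of_set (unit_square \<inter> {z. 1/2 \<le> snd z})) (top_of_set unit_square) (\<lambda>z. (fst z, 2 * snd z - 1))"
    by (auto simp: continuous_map_subtopology_eu intro!: continuous_intros)
  from continuous_map_compose[OF this h2]
  show "continuous_map (subtopology (top_of_set unit_square) {z \<in> topspace (top_of_set unit_square). 1/2 \<le> snd z}) X (\<lambda>z. h2 (fst z, 2 * snd z - 1))"
    by (simp add: o_def subtopology_subtopology Collect_conj_eq Int_assoc[symmetric] Times_Int_Times)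
  show "h1 (fst z, 2 * snd z) = h2 (fst z, 2 * snd z - 1)" if z: "z \<in> topspace (top_of_set unit_square)" "snd z = 1/2" for z
  proof -
    have "fst z \<in> {0..1}" using z(1) by (auto simp: mem_Times_iff)
    moreover have e: "2 * snd z = 1" using z(2) by linarith
    ultimately show ?thesis using eq[of "fst z"] unfolding e by simp
  qed
qed (auto intro!: continuous_intros)

lemma path_hom_concat:
  assumes p: "path_hom X p p'" and q: "path_hom X q q'" and e: "p 1 = q 0"
  shows "path_hom X (concat_paths p q) (concat_paths p' q')"
proof -
  obtain h1 where h1: "continuous_map (top_of_set unit_square) X h1" "\<And>t. t \<in> {0..1} \<Longrightarrow> h1 (0, t) = p t"
    "\<And>t. t \<in> {0..1} \<Longrightarrow> h1 (1, t) = p' t" "\<And>s. s \<in> {0..1} \<Longrightarrow> h1 (s, 0) = p 0 \<and> h1 (s, 1) = p 1"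
    using p unfolding path_hom_iff by auto
  obtain h2 where h2: "continuous_map (top_of_set unit_square) X h2" "\<And>t. t \<in> {0..1} \<Longrightarrow> h2 (0, t) = q t"
    "\<And>t. t \<in> {0..1} \<Longrightarrow> h2 (1, t) = q' t" "\<And>s. s \<in> {0..1} \<Longrightarrow> h2 (s, 0) = q 0 \<and> h2 (s, 1) = q 1"
    using q unfolding path_hom_iff by auto
  define H where "H = (\<lambda>z. if snd z \<le> 1/2 then h1 (fst z, 2 * snd z) else h2 (fst z, 2 * snd z - 1))"
  have "continuous_map (top_of_set unit_square) X H"
    unfolding H_def by (rule square_glue[OF h1(1) h2(1)]) (simp add: h1(4) h2(4) e)
  then show ?thesis unfolding path_hom_iff
    by (intro exI[of _ H] conjI) (auto simp: H_def concat_paths_def h1 h2)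
qed

lemma pathin_concat: "pathin X p \<Longrightarrow> pathin X q \<Longrightarrow> p 1 = q 0 \<Longrightarrow> pathin X (concat_paths p q)"
  using path_hom_concat[OF path_hom_refl path_hom_refl] path_hom_pathin by blast

lemma concat_ends [simp]: "concat_paths p q 0 = p 0" "concat_paths p q 1 = q 1"
  by (simp_all add: concat_paths_def)

text \<open>
  Both bracketings run through the same path. The piecewise linear change of parameter \<open>?f\<close> is written as a minimum,
  which makes its continuity evident.
\<close>

lemma path_hom_assoc:
  assumes p: "pathin X p" "pathin X q" "pathin X r" and e: "p 1 = q 0" "q 1 = r 0"
  shows "path_hom X (concat_paths (concat_paths p q) r) (concat_paths p (concat_paths q r))"
proof -
  let ?f = "\<lambda>t::real. min (2 * t) (min (t + 1/4) ((t + 1) / 2))"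
  have K: "continuous_map (top_of_set {0..1}) X (concat_paths p (concat_paths q r))"
    using pathin_concat[OF p(1) pathin_concat[OF p(2,3) e(2)]] e(1) by (simp add: pathin_def)
  have eq: "concat_paths (concat_paths p q) r t = concat_paths p (concat_paths q r) (?f t)" for t
  proof -
    consider "t \<le> 1/4" | "1/4 < t" "t \<le> 1/2" | "1/2 < t" by linarith
    then show ?thesis
    proof cases
      case 1
      then have "?f t = 2 * t" by simp
      then show ?thesis using 1 by (simp add: concat_paths_def)
    next
      case 2
      then have "?f t = t + 1/4" by simp
      then show ?thesis using 2 by (simp add: concat_paths_def algebra_simps)
    next
      case 3
      then have "?f t = (t + 1) / 2" by simp
      moreover have "concat_paths p (concat_paths q r) ((t + 1) / 2) = concat_paths q r (2 * ((t + 1) / 2) - 1)"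
        unfolding concat_paths_def[of p] using 3 by simp
      moreover have "2 * ((t + 1) / 2) - 1 = t" by (simp add: field_simps)
      ultimately show ?thesis using 3 by (simp add: concat_paths_def)
    qed
  qed
  show ?thesis
    by (rule path_hom_convex[where T = "{0..1}" and f = ?f and g = id, OF _ K])
      (auto simp: eq min_le_iff_disj intro!: continuous_intros)
qed

lemma path_hom_unit_right:
  assumes "pathin X p" shows "path_hom X (concat_paths p (\<lambda>_. p 1)) p"
  by (rule path_hom_convex[where T = "{0..1}" and f = "\<lambda>t. min (2 * t) 1" and g = id and K = p])
    (use assms in \<open>auto simp: pathin_def concat_paths_def intro!: continuous_intros\<close>)

lemma path_hom_unit_left:
  assumes "pathin X p" shows "path_hom X (concat_paths (\<lambda>_. p 0) p) p"
  by (rule path_hom_convex[where T = "{0..1}" and f = "\<lambda>t. max 0 (2 * t - 1)" and g = id and K = p])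
    (use assms in \<open>auto simp: pathin_def concat_paths_def intro!: continuous_intros\<close>)

lemma path_hom_reverse:
  assumes "pathin X p" shows "path_hom X (concat_paths p (\<lambda>t. p (1 - t))) (\<lambda>_. p 0)"
proof -
  have "concat_paths p (\<lambda>t. p (1 - t)) t = p (min (2 * t) (2 - 2 * t))" for t
    by (cases "t \<le> 1/2") (simp_all add: concat_paths_def min_def)
  then show ?thesis
    by (intro path_hom_convex[where T = "{0..1}" and f = "\<lambda>t. min (2 * t) (2 - 2 * t)" and g = "\<lambda>_. 0" and K = p])
      (use assms in \<open>auto simp: pathin_def intro!: continuous_intros\<close>)
qed

definition subpath_of :: "real \<Rightarrow> real \<Rightarrow> (real \<Rightarrow> 'a) \<Rightarrow> real \<Rightarrow> 'a" where
  "subpath_of u v p = (\<lambda>t. p (u + (v - u) * t))"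

lemma subpath_bounds:
  fixes u v t :: real
  assumes "u \<in> {0..1}" "v \<in> {0..1}" "t \<in> {0..1}" shows "u + (v - u) * t \<in> {0..1}"
proof -
  have "(1 - t) *\<^sub>R u + t *\<^sub>R v \<in> {0..1}"
    by (rule convexD_alt) (use assms in auto)
  then show ?thesis by (simp add: algebra_simps)
qed

lemma pathin_compose_real:
  assumes "continuous_map (top_of_set T) X p" "continuous_on {0..1} f" "f ` {0..1} \<subseteq> T"
  shows "pathin X (\<lambda>t. p (f t))"
proof -
  have "continuous_map (top_of_set {0..1}) (top_of_set T) f" using assms(2,3) by (auto simp: continuous_map_subtopology_eu)
  from continuous_map_compose[OF this assms(1)] show ?thesis by (simp add: pathin_def o_def)
qed

lemma pathin_subpath:
  assumes "pathin X p" "u \<in> {0..1}" "v \<in> {0..1}" shows "pathin X (subpath_of u v p)"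
  unfolding subpath_of_def
  by (rule pathin_compose_real[OF assms(1)[unfolded pathin_def]])
    (use subpath_bounds[OF assms(2,3)] in \<open>auto intro!: continuous_intros\<close>)

lemma pathin_reverse: "pathin X p \<Longrightarrow> pathin X (\<lambda>t. p (1 - t))"
  unfolding pathin_def by (rule pathin_compose_real[unfolded pathin_def, of "{0..1}" X p "\<lambda>t. 1 - t"]) (auto intro!: continuous_intros)

lemma pathin_const: "x \<in> topspace X \<Longrightarrow> pathin X (\<lambda>_. x)"
  by (simp add: pathin_def)

section \<open>The universal cover\<close>

text \<open>
  Open sets that are path connected and simply connected relative to the whole space; these are the sets over
  which the universal cover is trivial.
\<close>

definition simple_open :: "'a topology \<Rightarrow> 'a set \<Rightarrow> bool" where
  "simple_open X V \<longleftrightarrow> openin X V \<and>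
     (\<forall>p\<in>V. \<forall>q\<in>V. \<exists>d. pathin (subtopology X V) d \<and> d 0 = p \<and> d 1 = q) \<and>
     (\<forall>d d'. pathin (subtopology X V) d \<longrightarrow> pathin (subtopology X V) d' \<longrightarrow> d 0 = d' 0 \<longrightarrow> d 1 = d' 1 \<longrightarrow> path_hom X d d')"

lemma simple_open_openin: "simple_open X V \<Longrightarrow> openin X V"
  and simple_open_path: "simple_open X V \<Longrightarrow> p \<in> V \<Longrightarrow> q \<in> V \<Longrightarrow> \<exists>d. pathin (subtopology X V) d \<and> d 0 = p \<and> d 1 = q"
  and simple_open_hom: "simple_open X V \<Longrightarrow> pathin (subtopology X V) d \<Longrightarrow> pathin (subtopology X V) d' \<Longrightarrow>
      d 0 = d' 0 \<Longrightarrow> d 1 = d' 1 \<Longrightarrow> path_hom X d d'"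
  by (simp_all add: simple_open_def)

lemma pathin_sub: "pathin (subtopology X V) d \<Longrightarrow> pathin X d"
  by (simp add: pathin_subtopology)

lemma pathin_sub_in: "pathin (subtopology X V) d \<Longrightarrow> t \<in> {0..1} \<Longrightarrow> d t \<in> V"
  by (simp add: pathin_subtopology)

lemma pathin_in_topspace:
  assumes "pathin X p" "t \<in> {0..1}" shows "p t \<in> topspace X"
proof -
  have "p ` {0..1} \<subseteq> topspace X"
    using continuous_map_image_subset_topspace[OF assms(1)[unfolded pathin_def]] by simp
  then show ?thesis using assms(2) by blast
qed

locale based_space =
  fixes X :: "'a topology" and x0 :: 'a
  assumes x0: "x0 \<in> topspace X"
    and simple_base: "openin X W \<Longrightarrow> p \<in> W \<Longrightarrow> \<exists>V. simple_open X V \<and> p \<in> V \<and> V \<subseteq> W"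
begin

text \<open>
  The class is formed in the homotopy of arbitrary paths and not of loops, so that points of the universal
  cover and elements of the fundamental group are objects of the same type.
\<close>

definition path_class :: "(real \<Rightarrow> 'a) \<Rightarrow> (real \<Rightarrow> 'a) set" where
  "path_class \<gamma> = {q. path_hom X \<gamma> q}"

definition path_classes :: "(real \<Rightarrow> 'a) set set" where
  "path_classes = {path_class \<gamma> | \<gamma>. pathin X \<gamma> \<and> \<gamma> 0 = x0}"

definition rep :: "(real \<Rightarrow> 'a) set \<Rightarrow> real \<Rightarrow> 'a" where
  "rep e = (SOME \<gamma>. \<gamma> \<in> e)"

definition proj :: "(real \<Rightarrow> 'a) set \<Rightarrow> 'a" where
  "proj e = rep e 1"

text \<open>
  Continuation of a homotopy class along a path that starts at its end point.
\<close>

definition extend :: "(real \<Rightarrow> 'a) set \<Rightarrow> (real \<Rightarrow> 'a) \<Rightarrow> (real \<Rightarrow> 'a) set" where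
  "extend e d = path_class (concat_paths (rep e) d)"

lemma path_class_eqI: "path_hom X p q \<Longrightarrow> path_class p = path_class q"
  unfolding path_class_def using path_hom_trans path_hom_sym by blast

lemma path_class_eqD: "pathin X p \<Longrightarrow> path_class p = path_class q \<Longrightarrow> path_hom X p q"
  unfolding path_class_def using path_hom_refl path_hom_sym by blast

lemma rep_path_class: "pathin X p \<Longrightarrow> path_hom X p (rep (path_class p))"
  unfolding rep_def path_class_def by (metis (mono_tags) mem_Collect_eq path_hom_refl someI)

lemma proj_path_class [simp]: "pathin X p \<Longrightarrow> proj (path_class p) = p 1"
  unfolding proj_def using path_hom_ends[OF rep_path_class] by blast

lemma path_class_in: "pathin X p \<Longrightarrow> p 0 = x0 \<Longrightarrow> path_class p \<in> path_classes"
  unfolding path_classes_def by blast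

lemma rep:
  assumes "e \<in> path_classes" shows "pathin X (rep e)" "rep e 0 = x0" "path_class (rep e) = e" "rep e 1 = proj e"
proof -
  obtain p where p: "e = path_class p" "pathin X p" "p 0 = x0" using assms unfolding path_classes_def by blast
  have h: "path_hom X p (rep e)" unfolding p(1) by (rule rep_path_class[OF p(2)])
  show "pathin X (rep e)" "rep e 0 = x0" using path_hom_pathin[OF h] path_hom_ends[OF h] p(3) by simp_all
  show "path_class (rep e) = e" using path_class_eqI[OF h] p(1) by simp
  show "rep e 1 = proj e" by (simp add: proj_def)
qed

lemma proj_in: "e \<in> path_classes \<Longrightarrow> proj e \<in> topspace X"
  using pathin_in_topspace[OF rep(1), of e 1] rep(4)[of e] by simp

lemma extend_path_class:
  assumes "pathin X p" "pathin X d" "p 1 = d 0" shows "extend (path_class p) d = path_class (concat_paths p d)"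
proof -
  have "path_hom X (concat_paths p d) (concat_paths (rep (path_class p)) d)"
    by (rule path_hom_concat[OF rep_path_class[OF assms(1)] path_hom_refl[OF assms(2)] assms(3)])
  then show ?thesis unfolding extend_def by (rule path_class_eqI[symmetric])
qed

lemma extend_in:
  assumes "e \<in> path_classes" "pathin X d" "d 0 = proj e"
  shows "extend e d \<in> path_classes" "proj (extend e d) = d 1"
proof -
  have "pathin X (concat_paths (rep e) d)" by (rule pathin_concat) (use rep[OF assms(1)] assms in simp_all)
  then show "extend e d \<in> path_classes" "proj (extend e d) = d 1"
    unfolding extend_def using rep(2)[OF assms(1)] by (simp_all add: path_class_in)
qed

lemma extend_cong:
  assumes "e \<in> path_classes" "path_hom X d d'" "d 0 = proj e" shows "extend e d = extend e d'"
  unfolding extend_def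
  by (rule path_class_eqI[OF path_hom_concat[OF path_hom_refl assms(2)]]) (use rep[OF assms(1)] assms(3) in simp_all)

lemma extend_extend:
  assumes "e \<in> path_classes" "pathin X d" "pathin X d'" "d 0 = proj e" "d 1 = d' 0"
  shows "extend (extend e d) d' = extend e (concat_paths d d')"
proof -
  note r = rep[OF assms(1)]
  have p: "pathin X (concat_paths (rep e) d)" by (rule pathin_concat) (use r assms in simp_all)
  have "extend (extend e d) d' = path_class (concat_paths (concat_paths (rep e) d) d')"
    unfolding extend_def[of e d] by (rule extend_path_class[OF p assms(3)]) (use assms in simp)
  also have "\<dots> = path_class (concat_paths (rep e) (concat_paths d d'))"
    by (rule path_class_eqI[OF path_hom_assoc]) (use r assms in simp_all)
  finally show ?thesis by (simp add: extend_def)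
qed

lemma extend_const: assumes "e \<in> path_classes" shows "extend e (\<lambda>_. proj e) = e"
proof -
  have "path_class (concat_paths (rep e) (\<lambda>_. proj e)) = path_class (rep e)"
    using path_class_eqI[OF path_hom_unit_right[OF rep(1)[OF assms]]] rep(4)[OF assms] by simp
  then show ?thesis using rep(3)[OF assms] by (simp add: extend_def)
qed

definition stable_nbhd :: "(real \<Rightarrow> 'a) set set \<Rightarrow> (real \<Rightarrow> 'a) set \<Rightarrow> 'a set \<Rightarrow> bool" where
  "stable_nbhd W e V \<longleftrightarrow> openin X V \<and> proj e \<in> V \<and>
     (\<forall>d. pathin (subtopology X V) d \<longrightarrow> d 0 = proj e \<longrightarrow> extend e d \<in> W)"

text \<open>
  A set of classes is open if it contains all short continuations of its members.
\<close>

definition cover :: "(real \<Rightarrow> 'a) set topology" where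
  "cover = topology (\<lambda>W. W \<subseteq> path_classes \<and> (\<forall>e\<in>W. \<exists>V. stable_nbhd W e V))"

lemma stable_nbhd_mono: "stable_nbhd W e V \<Longrightarrow> W \<subseteq> W' \<Longrightarrow> stable_nbhd W' e V"
  unfolding stable_nbhd_def by blast

lemma openin_cover: "openin cover W \<longleftrightarrow> W \<subseteq> path_classes \<and> (\<forall>e\<in>W. \<exists>V. stable_nbhd W e V)"
proof -
  have "istopology (\<lambda>W. W \<subseteq> path_classes \<and> (\<forall>e\<in>W. \<exists>V. stable_nbhd W e V))"
    unfolding istopology_def
  proof (intro conjI allI impI)
    fix S T assume S: "S \<subseteq> path_classes \<and> (\<forall>e\<in>S. \<exists>V. stable_nbhd S e V)" and T: "T \<subseteq> path_classes \<and> (\<forall>e\<in>T. \<exists>V. stable_nbhd T e V)"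
    show "S \<inter> T \<subseteq> path_classes" using S by blast
    show "\<forall>e\<in>S \<inter> T. \<exists>V. stable_nbhd (S \<inter> T) e V"
    proof
      fix e assume e: "e \<in> S \<inter> T"
      obtain V where V: "stable_nbhd S e V" using S e by blast
      obtain V' where V': "stable_nbhd T e V'" using T e by blast
      have "pathin (subtopology X V) d \<and> pathin (subtopology X V') d" if "pathin (subtopology X (V \<inter> V')) d" for d
        using that by (simp add: pathin_subtopology)
      then have "stable_nbhd (S \<inter> T) e (V \<inter> V')"
        using V V' unfolding stable_nbhd_def by blast
      then show "\<exists>V. stable_nbhd (S \<inter> T) e V" by (rule exI)
    qed
  next
    fix K assume K: "\<forall>S\<in>K. S \<subseteq> path_classes \<and> (\<forall>e\<in>S. \<exists>V. stable_nbhd S e V)"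
    then show "\<Union>K \<subseteq> path_classes" by blast
    show "\<forall>e\<in>\<Union>K. \<exists>V. stable_nbhd (\<Union>K) e V"
    proof
      fix e assume "e \<in> \<Union>K"
      then obtain S where S: "S \<in> K" "e \<in> S" by blast
      then obtain V where "stable_nbhd S e V" using K by blast
      then have "stable_nbhd (\<Union>K) e V" by (rule stable_nbhd_mono) (use S in blast)
      then show "\<exists>V. stable_nbhd (\<Union>K) e V" by (rule exI)
    qed
  qed
  then show ?thesis unfolding cover_def by (simp add: topology_inverse')
qed

lemma topspace_cover: "topspace cover = path_classes"
proof
  show "topspace cover \<subseteq> path_classes" using openin_topspace[of cover] unfolding openin_cover by blast
  have "stable_nbhd path_classes e (topspace X)" if "e \<in> path_classes" for e
    unfolding stable_nbhd_def using that extend_in(1)[OF that] proj_in[OF that] by auto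
  then have "openin cover path_classes" unfolding openin_cover by blast
  then show "path_classes \<subseteq> topspace cover" by (rule openin_subset)
qed

lemma continuous_proj: "continuous_map cover X proj"
  unfolding continuous_map_def
proof (intro conjI allI impI)
  show "proj \<in> topspace cover \<rightarrow> topspace X" using proj_in by (simp add: topspace_cover)
  fix U assume U: "openin X U"
  have "stable_nbhd {e \<in> path_classes. proj e \<in> U} e U" if e: "e \<in> path_classes" "proj e \<in> U" for e
    unfolding stable_nbhd_def
  proof (intro conjI allI impI)
    fix d assume d: "pathin (subtopology X U) d" "d 0 = proj e"
    have "d 1 \<in> U" by (rule pathin_sub_in[OF d(1)]) simp
    then show "extend e d \<in> {e \<in> path_classes. proj e \<in> U}" using extend_in[OF e(1) pathin_sub[OF d(1)] d(2)] by simp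
  qed (use U e in simp_all)
  then show "openin cover {e \<in> topspace cover. proj e \<in> U}" unfolding openin_cover topspace_cover by blast
qed

definition sheet :: "'a set \<Rightarrow> (real \<Rightarrow> 'a) set \<Rightarrow> (real \<Rightarrow> 'a) set set" where
  "sheet V e = {extend e d | d. pathin (subtopology X V) d \<and> d 0 = proj e}"

lemma sheet_subset: "e \<in> path_classes \<Longrightarrow> sheet V e \<subseteq> path_classes"
  unfolding sheet_def using extend_in(1) pathin_sub by blast

lemma proj_sheet: "e \<in> path_classes \<Longrightarrow> e' \<in> sheet V e \<Longrightarrow> proj e' \<in> V"
  unfolding sheet_def using extend_in(2) pathin_sub pathin_sub_in[of X V _ 1] by force

lemma sheet_self: "openin X V \<Longrightarrow> e \<in> path_classes \<Longrightarrow> proj e \<in> V \<Longrightarrow> e \<in> sheet V e"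
proof -
  assume "openin X V" "e \<in> path_classes" "proj e \<in> V"
  moreover from this have "pathin (subtopology X V) (\<lambda>_. proj e)" using proj_in by (simp add: pathin_subtopology pathin_const)
  ultimately show "e \<in> sheet V e" unfolding sheet_def using extend_const[symmetric] by blast
qed

lemma openin_sheet:
  assumes "openin X V" "e \<in> path_classes" shows "openin cover (sheet V e)"
  unfolding openin_cover
proof (intro conjI ballI)
  show "sheet V e \<subseteq> path_classes" by (rule sheet_subset[OF assms(2)])
  fix e' assume e': "e' \<in> sheet V e"
  then obtain d where d: "e' = extend e d" "pathin (subtopology X V) d" "d 0 = proj e" unfolding sheet_def by blast
  have pe': "proj e' = d 1" using extend_in(2)[OF assms(2) pathin_sub[OF d(2)] d(3)] d(1) by simp
  have "stable_nbhd (sheet V e) e' V"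
    unfolding stable_nbhd_def
  proof (intro conjI allI impI)
    show "proj e' \<in> V" by (rule proj_sheet[OF assms(2) e'])
    fix d' assume d': "pathin (subtopology X V) d'" "d' 0 = proj e'"
    have "extend e' d' = extend e (concat_paths d d')"
      unfolding d(1) by (rule extend_extend[OF assms(2) pathin_sub[OF d(2)] pathin_sub[OF d'(1)] d(3)]) (use pe' d' in simp)
    moreover have "pathin (subtopology X V) (concat_paths d d')"
      by (rule pathin_concat[OF d(2) d'(1)]) (use pe' d' in simp)
    ultimately show "extend e' d' \<in> sheet V e" unfolding sheet_def using d(3) by auto
  qed (rule assms(1))
  then show "\<exists>V'. stable_nbhd (sheet V e) e' V'" by (rule exI)
qed

lemma proj_inj_sheet:
  assumes "simple_open X V" "e \<in> path_classes" shows "inj_on proj (sheet V e)"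
proof (rule inj_onI)
  fix e1 e2 assume "e1 \<in> sheet V e" "e2 \<in> sheet V e" and eq: "proj e1 = proj e2"
  then obtain d1 d2 where d: "e1 = extend e d1" "pathin (subtopology X V) d1" "d1 0 = proj e"
      "e2 = extend e d2" "pathin (subtopology X V) d2" "d2 0 = proj e" unfolding sheet_def by blast
  have "d1 1 = d2 1" using eq d extend_in(2)[OF assms(2) pathin_sub] by simp
  then have "path_hom X d1 d2" using simple_open_hom[OF assms(1) d(2,5)] d(3,6) by simp
  from extend_cong[OF assms(2) this d(3)] show "e1 = e2" using d(1,4) by simp
qed

lemma proj_onto_sheet:
  assumes "simple_open X V" "e \<in> path_classes" "proj e \<in> V" "q \<in> V" shows "\<exists>e'\<in>sheet V e. proj e' = q"
proof -
  obtain d where d: "pathin (subtopology X V) d" "d 0 = proj e" "d 1 = q" using simple_open_path[OF assms(1,3,4)] by blast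
  then show ?thesis using extend_in(2)[OF assms(2) pathin_sub[OF d(1)] d(2)] unfolding sheet_def by blast
qed

lemma openin_proj_image:
  assumes "openin cover W" shows "openin X (proj ` W)"
proof (subst openin_subopen, intro ballI)
  fix p assume "p \<in> proj ` W"
  then obtain e where e: "e \<in> W" "p = proj e" by blast
  then obtain V where V: "stable_nbhd W e V" and ec: "e \<in> path_classes" using assms unfolding openin_cover by blast
  from V have "openin X V" "p \<in> V" using e(2) by (simp_all add: stable_nbhd_def)
  from simple_base[OF this] obtain V' where V': "simple_open X V'" "p \<in> V'" "V' \<subseteq> V" by (elim exE conjE)
  have "V' \<subseteq> proj ` W"
  proof
    fix q assume q: "q \<in> V'"
    obtain d where d: "pathin (subtopology X V') d" "d 0 = p" "d 1 = q" using simple_open_path[OF V'(1,2) q] by blast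
    have "pathin (subtopology X V) d" using d(1) V'(3) by (auto simp: pathin_subtopology)
    then have "extend e d \<in> W" using V d(2) e(2) unfolding stable_nbhd_def by blast
    moreover have "proj (extend e d) = q" using extend_in(2)[OF ec pathin_sub[OF d(1)]] d e(2) by simp
    ultimately show "q \<in> proj ` W" by blast
  qed
  then show "\<exists>T. openin X T \<and> p \<in> T \<and> T \<subseteq> proj ` W" using V' simple_open_openin by blast
qed

text \<open>
  The projection restricts to a homeomorphism of the sheet onto \<open>V\<close>, with continuous inverse since it is an
  open map.
\<close>

lemma connectedin_sheet:
  assumes V: "simple_open X V" and e: "e \<in> path_classes" "proj e \<in> V" and P: "connectedin X P" "P \<subseteq> V"
  shows "connectedin cover {e' \<in> sheet V e. proj e' \<in> P}"
proof -
  define s where "s = inv_into (sheet V e) proj"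
  have onto: "proj ` sheet V e = V"
    using proj_sheet[OF e(1)] proj_onto_sheet[OF V e] by blast
  have s: "s q \<in> sheet V e" "proj (s q) = q" if "q \<in> V" for q
    using that onto inv_into_into f_inv_into_f unfolding s_def by metis+
  have s': "s (proj e') = e'" if "e' \<in> sheet V e" for e'
    unfolding s_def by (rule inv_into_f_f[OF proj_inj_sheet[OF V e(1)] that])
  have VX: "topspace (subtopology X V) = V" using openin_subset[OF simple_open_openin[OF V]] by auto
  have "continuous_map (subtopology X V) cover s"
    unfolding continuous_map_def VX
  proof (intro conjI allI impI)
    show "s \<in> V \<rightarrow> topspace cover" using s sheet_subset[OF e(1)] topspace_cover by blast
    fix W assume W: "openin cover W"
    have "{q \<in> V. s q \<in> W} = proj ` (W \<inter> sheet V e)"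
    proof
      show "{q \<in> V. s q \<in> W} \<subseteq> proj ` (W \<inter> sheet V e)" using s by force
      show "proj ` (W \<inter> sheet V e) \<subseteq> {q \<in> V. s q \<in> W}" using s' onto by force
    qed
    moreover have "openin X (proj ` (W \<inter> sheet V e))"
      by (rule openin_proj_image[OF openin_Int[OF W openin_sheet[OF simple_open_openin[OF V] e(1)]]])
    ultimately have "openin X {q \<in> V. s q \<in> W}" by metis
    then show "openin (subtopology X V) {q \<in> V. s q \<in> W}"
      unfolding openin_open_subtopology[OF simple_open_openin[OF V]] by (intro conjI) (assumption, rule Collect_subset)
  qed
  moreover have "connectedin (subtopology X V) P" using P by (simp add: connectedin_subtopology)
  ultimately have "connectedin cover (s ` P)" by (rule connectedin_continuous_map_image)
  moreover have "s ` P = {e' \<in> sheet V e. proj e' \<in> P}"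
  proof
    show "s ` P \<subseteq> {e' \<in> sheet V e. proj e' \<in> P}" using s P(2) by (auto dest: subsetD)
    show "{e' \<in> sheet V e. proj e' \<in> P} \<subseteq> s ` P" using s' by force
  qed
  ultimately show ?thesis by simp
qed

text \<open>
  The lift of a path starting at the base point, at time \<open>t\<close>, is the class of its initial segment.
\<close>

definition path_lift :: "(real \<Rightarrow> 'a) \<Rightarrow> real \<Rightarrow> (real \<Rightarrow> 'a) set" where
  "path_lift \<gamma> t = path_class (subpath_of 0 t \<gamma>)"

text \<open>
  Lifts depend continuously on the path. Near \<open>(s0, t0)\<close> the lift at \<open>(s, t)\<close> is the lift at \<open>(s0, t0)\<close> continued along the image
  of a straight segment; this is because in the square, the broken line through \<open>(s0, t0)\<close> is homotopic to the one that
  first moves along the bottom edge, on which \<open>h\<close> is constant, and then up to \<open>(s, t)\<close>.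
\<close>

lemma path_lift_homotopy_continuous:
  assumes h: "continuous_map (top_of_set unit_square) X h" and h0: "\<And>s. s \<in> {0..1} \<Longrightarrow> h (s, 0) = x0"
  shows "continuous_map (top_of_set unit_square) cover (\<lambda>z. path_lift (\<lambda>t. h (fst z, t)) (snd z))"
proof -
  let ?H = "\<lambda>z. path_lift (\<lambda>t. h (fst z, t)) (snd z)"
  have pathin_h: "pathin X (\<lambda>u. h (c u))" if "continuous_on {0..1} c" "c ` {0..1} \<subseteq> unit_square" for c
    by (rule pathin_compose_real[OF h that])
  have ray_in: "(s, t * u) \<in> unit_square" if "s \<in> {0..1}" "t \<in> {0..1}" "u \<in> {0..1}" for s t u :: real
    using that by (auto intro: mult_le_one)
  have ray: "pathin X (\<lambda>u. h (s, t * u))" if "s \<in> {0..1}" "t \<in> {0..1}" for s t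
  proof (rule pathin_h)
    show "continuous_on {0..1} (\<lambda>u. (s, t * u))" by (intro continuous_intros)
    show "(\<lambda>u. (s, t * u)) ` {0..1} \<subseteq> unit_square" by (intro image_subsetI ray_in[OF that])
  qed
  have H: "?H (s, t) = path_class (\<lambda>u. h (s, t * u))" for s t by (simp add: path_lift_def subpath_of_def)
  show ?thesis
    unfolding continuous_map_def
  proof (intro conjI allI impI)
    show "?H \<in> topspace (top_of_set unit_square) \<rightarrow> topspace cover"
    proof (rule funcsetI)
      fix z assume "z \<in> topspace (top_of_set unit_square)"
      moreover obtain s t where z: "z = (s, t)" by (cases z)
      ultimately have st: "s \<in> {0..1}" "t \<in> {0..1}" by simp_all
      have "path_class (\<lambda>u. h (s, t * u)) \<in> path_classes" by (rule path_class_in[OF ray[OF st]]) (simp add: h0[OF st(1)])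
      then show "?H z \<in> topspace cover" unfolding z H topspace_cover .
    qed
    fix W assume W: "openin cover W"
    show "openin (top_of_set unit_square) {z \<in> topspace (top_of_set unit_square). ?H z \<in> W}"
    proof (subst openin_subopen, intro ballI)
      fix z0 assume "z0 \<in> {z \<in> topspace (top_of_set unit_square). ?H z \<in> W}"
      moreover obtain s0 t0 where z0: "z0 = (s0, t0)" by (cases z0)
      ultimately have st0: "s0 \<in> {0..1}" "t0 \<in> {0..1}" and "?H (s0, t0) \<in> W" by auto
      define e0 where "e0 = ?H (s0, t0)"
      have e0W: "e0 \<in> W" using \<open>?H (s0, t0) \<in> W\<close> by (simp add: e0_def)
      have e0: "e0 = path_class (\<lambda>u. h (s0, t0 * u))" using H by (simp add: e0_def)
      have pe0: "proj e0 = h (s0, t0)" unfolding e0 using ray[OF st0] by simp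
      obtain V where V: "openin X V" "proj e0 \<in> V" "\<And>d. pathin (subtopology X V) d \<Longrightarrow> d 0 = proj e0 \<Longrightarrow> extend e0 d \<in> W"
        using W e0W unfolding openin_cover stable_nbhd_def by blast
      have "openin (top_of_set unit_square) {z \<in> unit_square. h z \<in> V}"
        using h V(1) unfolding continuous_map_def by simp
      moreover have "z0 \<in> {z \<in> unit_square. h z \<in> V}" using z0 st0 V(2) pe0 by simp
      ultimately obtain r where r: "r > 0" "ball z0 r \<inter> unit_square \<subseteq> {z \<in> unit_square. h z \<in> V}"
        unfolding openin_contains_ball by blast
      define N where "N = unit_square \<inter> ball z0 r"
      have cN: "convex N" unfolding N_def by (intro convex_Int convex_Times convex_ball convex_real_interval)
      have "?H z \<in> W" if z: "z \<in> N" for z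
      proof -
        obtain s t where zst: "z = (s, t)" by (cases z)
        have st: "s \<in> {0..1}" "t \<in> {0..1}" using z zst by (auto simp: N_def)
        define seg where "seg u = (s0 + u * (s - s0), t0 + u * (t - t0))" for u
        have segN: "seg u \<in> N" if "u \<in> {0..1}" for u
        proof -
          have "z0 \<in> N" using z0 st0 r(1) by (simp add: N_def)
          from convexD_alt[OF cN this z, of u] have "(1 - u) *\<^sub>R z0 + u *\<^sub>R z \<in> N" using that by simp
          then show ?thesis by (simp add: z0 zst seg_def algebra_simps)
        qed
        have segc: "continuous_on {0..1} seg" unfolding seg_def by (intro continuous_intros)
        define d where "d = (\<lambda>u. h (seg u))"
        have segS: "seg ` {0..1} \<subseteq> unit_square"
        proof (rule image_subsetI)
          fix u :: real assume "u \<in> {0..1}"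
          from segN[OF this] show "seg u \<in> unit_square" unfolding N_def by (rule IntD1)
        qed
        have dX: "pathin X d" unfolding d_def by (rule pathin_h[OF segc segS])
        have "d u \<in> V" if "u \<in> {0..1}" for u
        proof -
          have "seg u \<in> ball z0 r \<inter> unit_square" using segN[OF that] unfolding N_def by (subst Int_commute)
          then have "seg u \<in> {z \<in> unit_square. h z \<in> V}" by (rule subsetD[OF r(2)])
          then show ?thesis by (simp add: d_def)
        qed
        then have dV: "pathin (subtopology X V) d" using dX by (simp add: pathin_subtopology)
        have d0: "d 0 = h (s0, t0)" by (simp add: d_def seg_def)
        have "extend e0 d = path_class (concat_paths (\<lambda>u. h (s0, t0 * u)) d)"
          unfolding e0 by (rule extend_path_class[OF ray[OF st0] dX]) (simp add: d0)
        also have "\<dots> = path_class (\<lambda>u. h (s, t * u))"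
        proof (rule path_class_eqI)
          let ?f = "concat_paths (\<lambda>u. (s0, t0 * u)) seg"
          \<comment> \<open>First along the bottom edge, then up the vertical line at \<open>s\<close>.\<close>
          let ?g = "concat_paths (\<lambda>u. (s0 + u * (s - s0), 0)) (\<lambda>u. (s, t * u))"
          have "pathin (top_of_set unit_square) (\<lambda>u. (s0, t0 * u))"
            using ray_in[OF st0] by (auto simp: pathin_def continuous_map_subtopology_eu intro!: continuous_intros)
          moreover have "pathin (top_of_set unit_square) seg"
            unfolding pathin_def continuous_map_subtopology_eu using segc segS by (simp add: image_subset_iff_funcset)
          ultimately have f: "pathin (top_of_set unit_square) ?f" by (rule pathin_concat) (simp add: seg_def)
          have "s0 + u * (s - s0) \<in> {0..1}" if "u \<in> {0..1}" for u
            using segN[OF that] by (simp add: N_def seg_def)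
          then have "pathin (top_of_set unit_square) (\<lambda>u. (s0 + u * (s - s0), 0))"
            by (auto simp: pathin_def continuous_map_subtopology_eu intro!: continuous_intros)
          moreover have "pathin (top_of_set unit_square) (\<lambda>u. (s, t * u))"
            using ray_in[OF st] by (auto simp: pathin_def continuous_map_subtopology_eu intro!: continuous_intros)
          ultimately have g: "pathin (top_of_set unit_square) ?g" by (rule pathin_concat) simp
          have "path_hom X (\<lambda>u. h (?f u)) (\<lambda>u. h (?g u))"
          proof (rule path_hom_convex[OF _ h])
            show "convex unit_square" by (intro convex_Times convex_real_interval)
            show "continuous_on {0..1} ?f" "?f ` {0..1} \<subseteq> unit_square" "continuous_on {0..1} ?g" "?g ` {0..1} \<subseteq> unit_square"
              using f g unfolding pathin_def continuous_map_subtopology_eu by (simp_all only: image_subset_iff_funcset)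
            show "?f 0 = ?g 0" "?f 1 = ?g 1" by (simp_all add: seg_def)
          qed (rule refl)+
          moreover have "concat_paths (\<lambda>u. h (s0, t0 * u)) d u = h (?f u)" for u
            by (simp add: concat_paths_def d_def)
          moreover have "concat_paths (\<lambda>_. x0) (\<lambda>u. h (s, t * u)) u = h (?g u)" if "u \<in> {0..1}" for u
          proof (cases "u \<le> 1/2")
            case True
            have "s0 + 2 * u * (s - s0) \<in> {0..1}"
              using segN[of "2 * u"] True that by (simp add: N_def seg_def)
            then show ?thesis using True h0 by (simp add: concat_paths_def)
          qed (simp add: concat_paths_def)
          ultimately have 1: "path_hom X (concat_paths (\<lambda>u. h (s0, t0 * u)) d) (concat_paths (\<lambda>_. x0) (\<lambda>u. h (s, t * u)))"
            by (elim path_hom_cong) simp_all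
          have "path_hom X (concat_paths (\<lambda>_. x0) (\<lambda>u. h (s, t * u))) (\<lambda>u. h (s, t * u))"
            using path_hom_unit_left[OF ray[OF st]] h0[OF st(1)] by simp
          with 1 show "path_hom X (concat_paths (\<lambda>u. h (s0, t0 * u)) d) (\<lambda>u. h (s, t * u))" by (rule path_hom_trans)
        qed
        finally have "extend e0 d = ?H z" unfolding zst H .
        then show ?thesis using V(3)[OF dV] d0 pe0 by simp
      qed
      then have "N \<subseteq> {z \<in> topspace (top_of_set unit_square). ?H z \<in> W}" by (auto simp: N_def)
      moreover have "openin (top_of_set unit_square) N" unfolding N_def by (simp add: openin_open_Int)
      moreover have "z0 \<in> N" using z0 st0 r(1) by (simp add: N_def)
      ultimately show "\<exists>T. openin (top_of_set unit_square) T \<and> z0 \<in> T \<and> T \<subseteq> {z \<in> topspace (top_of_set unit_square). ?H z \<in> W}"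
        by (intro exI[of _ N] conjI)
    qed
  qed
qed

lemma path_lift_0: "\<gamma> 0 = x0 \<Longrightarrow> path_lift \<gamma> 0 = path_class (\<lambda>_. x0)"
  by (simp add: path_lift_def subpath_of_def)

lemma path_lift_1: "path_lift \<gamma> 1 = path_class \<gamma>"
  by (simp add: path_lift_def subpath_of_def)

lemma path_lift_continuous:
  assumes "pathin X \<gamma>" "\<gamma> 0 = x0" shows "pathin cover (path_lift \<gamma>)"
proof -
  have "continuous_map (top_of_set unit_square) X (\<lambda>z. \<gamma> (snd z))"
  proof -
    have "continuous_map (top_of_set unit_square) (top_of_set {0..1}) (snd :: real \<times> real \<Rightarrow> real)"
      by (auto simp: continuous_map_subtopology_eu intro!: continuous_intros)
    from continuous_map_compose[OF this] assms(1) show ?thesis by (simp add: pathin_def o_def)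
  qed
  from path_lift_homotopy_continuous[OF this] have "continuous_map (top_of_set unit_square) cover (\<lambda>z. path_lift \<gamma> (snd z))"
    using assms(2) by simp
  moreover have "continuous_on {0..1} (\<lambda>t::real. (0::real, t))" by (intro continuous_intros)
  moreover have "(\<lambda>t::real. (0::real, t)) ` {0..1} \<subseteq> unit_square" by auto
  ultimately have "pathin cover (\<lambda>t. path_lift \<gamma> (snd (0::real, t)))" by (rule pathin_compose_real)
  then show ?thesis by simp
qed

lemma connected_cover: "connected_space cover"
proof -
  have "path_component_of cover (path_class (\<lambda>_. x0)) e" if e: "e \<in> path_classes" for e
  proof -
    obtain \<gamma> where g: "pathin X \<gamma>" "\<gamma> 0 = x0" "e = path_class \<gamma>" using e unfolding path_classes_def by blast
    show ?thesis unfolding path_component_of_def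
      using path_lift_continuous[OF g(1,2)] path_lift_0[of \<gamma>, OF g(2)] path_lift_1 g(3) by blast
  qed
  then have "path_connected_space cover"
    unfolding path_connected_space_iff_path_component topspace_cover
    using path_component_of_sym path_component_of_trans by metis
  then show ?thesis by (rule path_connected_imp_connected_space)
qed

end

section \<open>Local systems on the universal cover\<close>

text \<open>
  A section, over the parameter set \<open>T\<close>, of the pullback along \<open>c\<close> of the local system \<open>S\<close>.
\<close>

definition section_over :: "('e set \<times> ('e \<Rightarrow> bool)) set \<Rightarrow> 'z::topological_space set \<Rightarrow> ('z \<Rightarrow> 'e) \<Rightarrow> ('z \<Rightarrow> bool) \<Rightarrow> bool" where
  "section_over S T c \<sigma> \<longleftrightarrow> (\<forall>z\<in>T. \<forall>U s. (U, s) \<in> S \<longrightarrow> c z \<in> U \<longrightarrow>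
     (\<exists>N. open N \<and> z \<in> N \<and> (\<forall>w\<in>N \<inter> T. c w \<in> U \<and> (\<sigma> w = s (c w)) = (\<sigma> z = s (c z)))))"

lemma section_overD:
  assumes "section_over S T c \<sigma>" "z \<in> T" "(U, s) \<in> S" "c z \<in> U"
  shows "\<exists>N. open N \<and> z \<in> N \<and> (\<forall>w. w \<in> N \<longrightarrow> w \<in> T \<longrightarrow> c w \<in> U \<and> (\<sigma> w = s (c w)) = (\<sigma> z = s (c z)))"
proof -
  have "\<exists>N. open N \<and> z \<in> N \<and> (\<forall>w\<in>N \<inter> T. c w \<in> U \<and> (\<sigma> w = s (c w)) = (\<sigma> z = s (c z)))"
    by (rule assms(1)[unfolded section_over_def, THEN bspec, rule_format, OF assms(2-4)])
  then show ?thesis by (simp only: Ball_def Int_iff imp_conjL)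
qed

lemma section_overI:
  assumes "\<And>z U s. z \<in> T \<Longrightarrow> (U, s) \<in> S \<Longrightarrow> c z \<in> U \<Longrightarrow>
     \<exists>N. open N \<and> z \<in> N \<and> (\<forall>w\<in>N \<inter> T. c w \<in> U \<and> (\<sigma> w = s (c w)) = (\<sigma> z = s (c z)))"
  shows "section_over S T c \<sigma>"
  unfolding section_over_def by (intro ballI allI impI assms)

lemma section_subset:
  assumes "section_over S T c \<sigma>" "T' \<subseteq> T" shows "section_over S T' c \<sigma>"
proof (rule section_overI)
  fix z U s assume z: "z \<in> T'" "(U, s) \<in> S" "c z \<in> U"
  then have zT: "z \<in> T" using assms(2) by blast
  obtain N where N: "open N" "z \<in> N" "\<forall>w. w \<in> N \<longrightarrow> w \<in> T \<longrightarrow> c w \<in> U \<and> (\<sigma> w = s (c w)) = (\<sigma> z = s (c z))"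
    using section_overD[OF assms(1) zT z(2,3)] by (elim exE conjE)
  show "\<exists>N. open N \<and> z \<in> N \<and> (\<forall>w\<in>N \<inter> T'. c w \<in> U \<and> (\<sigma> w = s (c w)) = (\<sigma> z = s (c z)))"
  proof (intro exI[of _ N] conjI ballI N(1,2))
    fix w assume "w \<in> N \<inter> T'"
    then have "w \<in> N" "w \<in> T" using assms(2) by blast+
    from N(3)[rule_format, OF this] show "c w \<in> U" "(\<sigma> w = s (c w)) = (\<sigma> z = s (c z))" by (rule conjunct1, rule conjunct2)
  qed
qed

lemma section_flip:
  assumes "section_over S T c \<sigma>" shows "section_over S T c (\<lambda>z. \<sigma> z \<noteq> b)"
proof (rule section_overI)
  fix z U s assume z: "z \<in> T" "(U, s) \<in> S" "c z \<in> U"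
  obtain N where N0: "open N" "z \<in> N" "\<forall>w. w \<in> N \<longrightarrow> w \<in> T \<longrightarrow> c w \<in> U \<and> (\<sigma> w = s (c w)) = (\<sigma> z = s (c z))"
      using section_overD[OF assms z] by (elim exE conjE)
    note N = N0(1,2) N0(3)[rule_format]
  show "\<exists>N. open N \<and> z \<in> N \<and> (\<forall>w\<in>N \<inter> T. c w \<in> U \<and> ((\<sigma> w \<noteq> b) = s (c w)) = ((\<sigma> z \<noteq> b) = s (c z)))"
  proof (intro exI[of _ N] conjI ballI N(1,2))
    fix w assume "w \<in> N \<inter> T"
    then have w: "c w \<in> U" "(\<sigma> w = s (c w)) = (\<sigma> z = s (c z))" using N(3)[of w] by (elim IntE; simp)+
    show "c w \<in> U" by (rule w(1))
    show "((\<sigma> w \<noteq> b) = s (c w)) = ((\<sigma> z \<noteq> b) = s (c z))" using w(2) by argo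
  qed
qed

lemma section_compose:
  assumes "section_over S T c \<sigma>" "continuous_on T' g" "g ` T' \<subseteq> T"
  shows "section_over S T' (\<lambda>w. c (g w)) (\<lambda>w. \<sigma> (g w))"
proof (rule section_overI)
  fix z U s assume z: "z \<in> T'" "(U, s) \<in> S" "c (g z) \<in> U"
  have gzT: "g z \<in> T" using z(1) assms(3) by blast
  obtain N where N0: "open N" "g z \<in> N" "\<forall>w. w \<in> N \<longrightarrow> w \<in> T \<longrightarrow> c w \<in> U \<and> (\<sigma> w = s (c w)) = (\<sigma> (g z) = s (c (g z)))"
      using section_overD[OF assms(1) gzT z(2,3)] by (elim exE conjE)
    note N = N0(1,2) N0(3)[rule_format]
  obtain A where A: "open A" "A \<inter> T' = g -` N \<inter> T'"
    using assms(2) N(1) unfolding continuous_on_open_invariant by blast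
  have AN: "g w \<in> N" "g w \<in> T" if "w \<in> A \<inter> T'" for w
  proof -
    have "w \<in> g -` N \<inter> T'" using that A(2) by (rule rev_subsetD[OF _ equalityD1])
    then show "g w \<in> N" "g w \<in> T" using assms(3) by auto
  qed
  have "z \<in> g -` N \<inter> T'" using N(2) z(1) by simp
  then have "z \<in> A \<inter> T'" unfolding A(2) .
  then have "z \<in> A" by (rule IntD1)
  show "\<exists>A. open A \<and> z \<in> A \<and> (\<forall>w\<in>A \<inter> T'. c (g w) \<in> U \<and> (\<sigma> (g w) = s (c (g w))) = (\<sigma> (g z) = s (c (g z))))"
  proof (intro exI[of _ A] conjI A(1) \<open>z \<in> A\<close> ballI)
    fix w assume w: "w \<in> A \<inter> T'"
    show "c (g w) \<in> U" by (rule N(3)[OF AN[OF w], THEN conjunct1])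
    show "(\<sigma> (g w) = s (c (g w))) = (\<sigma> (g z) = s (c (g z)))" by (rule N(3)[OF AN[OF w], THEN conjunct2])
  qed
qed

locale local_system =
  fixes E :: "'e topology" and S :: "('e set \<times> ('e \<Rightarrow> bool)) set"
  assumes S_open: "(U, s) \<in> S \<Longrightarrow> openin E U"
    and S_cover: "p \<in> topspace E \<Longrightarrow> \<exists>U s. (U, s) \<in> S \<and> p \<in> U"
    and S_compat: "\<lbrakk>(U, s) \<in> S; (V, t) \<in> S; p \<in> U; p \<in> V\<rbrakk> \<Longrightarrow>
        \<exists>W. openin E W \<and> p \<in> W \<and> W \<subseteq> U \<inter> V \<and> (\<forall>q\<in>W. (s q = t q) = (s p = t p))"
begin

text \<open>
  Whether two sections agree is a locally constant property of the parameter.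
\<close>

lemma section_unique:
  assumes T: "connected T" and c: "c ` T \<subseteq> topspace E" and s: "section_over S T c \<sigma>" "section_over S T c \<tau>" and zw: "z \<in> T" "w \<in> T"
  shows "(\<sigma> z = \<tau> z) = (\<sigma> w = \<tau> w)"
proof (rule connectedin_locally_constant[of euclidean T "\<lambda>z. \<sigma> z = \<tau> z"])
  show "connectedin euclidean T" using T by simp
  fix p assume p: "p \<in> T"
  then have "c p \<in> topspace E" using c by blast
  from S_cover[OF this] obtain U u where U: "(U, u) \<in> S" "c p \<in> U" by (elim exE conjE)
  obtain N where N0: "open N" "p \<in> N" "\<forall>w. w \<in> N \<longrightarrow> w \<in> T \<longrightarrow> c w \<in> U \<and> (\<sigma> w = u (c w)) = (\<sigma> p = u (c p))"
      using section_overD[OF s(1) p U] by (elim exE conjE)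
    note N = N0(1,2) N0(3)[rule_format]
  obtain M where M0: "open M" "p \<in> M" "\<forall>w. w \<in> M \<longrightarrow> w \<in> T \<longrightarrow> c w \<in> U \<and> (\<tau> w = u (c w)) = (\<tau> p = u (c p))"
      using section_overD[OF s(2) p U] by (elim exE conjE)
    note M = M0(1,2) M0(3)[rule_format]
  show "\<exists>W. openin euclidean W \<and> p \<in> W \<and> (\<forall>q\<in>W \<inter> T. (\<sigma> q = \<tau> q) = (\<sigma> p = \<tau> p))"
  proof (intro exI[of _ "N \<inter> M"] conjI ballI)
    show "openin euclidean (N \<inter> M)" using N(1) M(1) by (simp add: open_Int)
    show "p \<in> N \<inter> M" using N(2) M(2) by simp
    fix q assume q: "q \<in> N \<inter> M \<inter> T"
    have "(\<sigma> q = u (c q)) = (\<sigma> p = u (c p))" "(\<tau> q = u (c q)) = (\<tau> p = u (c p))"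
      using N(3)[of q] M(3)[of q] q by blast+
    then show "(\<sigma> q = \<tau> q) = (\<sigma> p = \<tau> p)" by argo
  qed
qed (rule zw)+

text \<open>
  If the intersection is connected, then after flipping one of the two sections they agree on it.
\<close>

lemma section_glue:
  assumes T: "closed T1" "closed T2" "connected (T1 \<inter> T2)" "T1 \<inter> T2 \<noteq> {}" and c: "c ` (T1 \<union> T2) \<subseteq> topspace E"
    and s: "section_over S T1 c \<sigma>" "section_over S T2 c \<tau>"
  shows "\<exists>\<rho>. section_over S (T1 \<union> T2) c \<rho>"
proof -
  obtain z0 where z0: "z0 \<in> T1 \<inter> T2" using T(4) by blast
  define \<tau>' where "\<tau>' z = (\<tau> z \<noteq> (\<sigma> z0 \<noteq> \<tau> z0))" for z
  have s': "section_over S T2 c \<tau>'" unfolding \<tau>'_def by (rule section_flip[OF s(2)])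
  have eq: "\<sigma> z = \<tau>' z" if "z \<in> T1 \<inter> T2" for z
  proof -
    have c': "c ` (T1 \<inter> T2) \<subseteq> topspace E" using c by blast
    have "(\<sigma> z = \<tau>' z) = (\<sigma> z0 = \<tau>' z0)"
      by (rule section_unique[OF T(3) c' section_subset[OF s(1)] section_subset[OF s'] that z0]) simp_all
    then show ?thesis unfolding \<tau>'_def by argo
  qed
  define \<rho> where "\<rho> z = (if z \<in> T1 then \<sigma> z else \<tau>' z)" for z
  have r1: "\<rho> z = \<sigma> z" if "z \<in> T1" for z using that by (simp add: \<rho>_def)
  have r2: "\<rho> z = \<tau>' z" if "z \<in> T2" for z using that eq[of z] by (simp add: \<rho>_def)
  have nb: "\<exists>N. open N \<and> z \<in> N \<and> (\<forall>w\<in>N \<inter> T'. c w \<in> U \<and> (\<rho> w = u (c w)) = (\<rho> z = u (c z)))"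
    if T': "closed T'" "section_over S T' c \<mu>" "\<And>z. z \<in> T' \<Longrightarrow> \<rho> z = \<mu> z" and U: "(U, u) \<in> S" "c z \<in> U" for T' \<mu> z U u
  proof (cases "z \<in> T'")
    case True
    obtain N where N0: "open N" "z \<in> N" "\<forall>w. w \<in> N \<longrightarrow> w \<in> T' \<longrightarrow> c w \<in> U \<and> (\<mu> w = u (c w)) = (\<mu> z = u (c z))"
      using section_overD[OF T'(2) True U] by (elim exE conjE)
    note N = N0(1,2) N0(3)[rule_format]
    show ?thesis
    proof (intro exI[of _ N] conjI ballI N(1,2))
      fix w assume w: "w \<in> N \<inter> T'"
      then show "c w \<in> U" "(\<rho> w = u (c w)) = (\<rho> z = u (c z))"
        using N(3)[of w] T'(3)[OF True] T'(3)[of w] by (elim IntE; simp)+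
    qed
  next
    case False
    then show ?thesis using T'(1) by (intro exI[of _ "- T'"]) (simp add: open_Compl)
  qed
  have "section_over S (T1 \<union> T2) c \<rho>"
  proof (rule section_overI)
    fix z U u assume U: "(U, u) \<in> S" "c z \<in> U"
    have "\<exists>N. open N \<and> z \<in> N \<and> (\<forall>w\<in>N \<inter> T1. c w \<in> U \<and> (\<rho> w = u (c w)) = (\<rho> z = u (c z)))"
      by (rule nb[OF T(1) s(1) _ U]) (rule r1)
    then obtain N where N: "open N" "z \<in> N" "\<forall>w\<in>N \<inter> T1. c w \<in> U \<and> (\<rho> w = u (c w)) = (\<rho> z = u (c z))"
      by (elim exE conjE)
    have "\<exists>N. open N \<and> z \<in> N \<and> (\<forall>w\<in>N \<inter> T2. c w \<in> U \<and> (\<rho> w = u (c w)) = (\<rho> z = u (c z)))"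
      by (rule nb[OF T(2) s' _ U]) (rule r2)
    then obtain M where M: "open M" "z \<in> M" "\<forall>w\<in>M \<inter> T2. c w \<in> U \<and> (\<rho> w = u (c w)) = (\<rho> z = u (c z))"
      by (elim exE conjE)
    have "c w \<in> U \<and> (\<rho> w = u (c w)) = (\<rho> z = u (c z))" if w: "w \<in> (N \<inter> M) \<inter> (T1 \<union> T2)" for w
    proof (cases "w \<in> T1")
      case True
      show ?thesis by (rule bspec[OF N(3)]) (use w True in simp)
    next
      case False
      show ?thesis by (rule bspec[OF M(3)]) (use w False in simp)
    qed
    then have b: "\<forall>w\<in>(N \<inter> M) \<inter> (T1 \<union> T2). c w \<in> U \<and> (\<rho> w = u (c w)) = (\<rho> z = u (c z))" by (rule ballI)
    show "\<exists>N. open N \<and> z \<in> N \<and> (\<forall>w\<in>N \<inter> (T1 \<union> T2). c w \<in> U \<and> (\<rho> w = u (c w)) = (\<rho> z = u (c z)))"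
      by (intro exI[of _ "N \<inter> M"] conjI b open_Int IntI N(1,2) M(1,2))
  qed
  then show ?thesis by (intro exI[of _ \<rho>])
qed

lemma section_local:
  assumes c: "continuous_map euclidean E c"
  shows "\<exists>N \<sigma>. open N \<and> z \<in> N \<and> section_over S N c \<sigma>"
proof -
  have pre: "open {w. c w \<in> W}" if "openin E W" for W
    using c that unfolding continuous_map_def by simp
  have "c z \<in> topspace E" using continuous_map_image_subset_topspace[OF c] by auto
  from S_cover[OF this] obtain U s where U: "(U, s) \<in> S" "c z \<in> U" by (elim exE conjE)
  have "section_over S {w. c w \<in> U} c (\<lambda>w. s (c w))"
  proof (rule section_overI)
    fix w V t assume w: "w \<in> {w. c w \<in> U}" "(V, t) \<in> S" "c w \<in> V"
    from S_compat[OF U(1) w(2) _ w(3)] w(1) obtain W where W: "openin E W" "c w \<in> W" "W \<subseteq> U \<inter> V"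
      "\<forall>q\<in>W. (s q = t q) = (s (c w) = t (c w))" by auto
    show "\<exists>N. open N \<and> w \<in> N \<and> (\<forall>v\<in>N \<inter> {w. c w \<in> U}. c v \<in> V \<and> (s (c v) = t (c v)) = (s (c w) = t (c w)))"
    proof (intro exI[of _ "{w. c w \<in> W}"] conjI ballI pre[OF W(1)])
      fix v assume "v \<in> {w. c w \<in> W} \<inter> {w. c w \<in> U}"
      then have v: "c v \<in> W" by simp
      show "c v \<in> V" using v W(3) by blast
      show "(s (c v) = t (c v)) = (s (c w) = t (c w))" by (rule bspec[OF W(4) v])
    qed (use W(2) in simp)
  qed
  then show ?thesis using pre[OF S_open[OF U(1)]] U(2) by (intro exI[of _ "{w. c w \<in> U}"] exI conjI) simp_all
qed

text \<open>
  Local systems over a square are trivial: sections over adjacent rectangles are glued along their common edge, first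
  in the vertical direction to obtain sections over thin strips, then in the horizontal direction.
\<close>

lemma section_square:
  fixes c :: "real \<times> real \<Rightarrow> 'e"
  assumes c: "continuous_map euclidean E c"
  shows "\<exists>\<sigma>. section_over S unit_square c \<sigma>"
proof -
  have cE: "c ` T \<subseteq> topspace E" for T using continuous_map_image_subset_topspace[OF c] by auto
  have glue: "\<exists>\<rho>. section_over S (T1 \<union> T2) c \<rho>"
    if "closed T1" "closed T2" "convex (T1 \<inter> T2)" "T1 \<inter> T2 \<noteq> {}" "section_over S T1 c \<sigma>" "section_over S T2 c \<tau>" for T1 T2 \<sigma> \<tau>
    by (rule section_glue[OF that(1,2) convex_connected[OF that(3)] that(4) cE that(5,6)])
  \<comment> \<open>A section over a thin vertical strip around \<open>x\<close>, by bisection of the vertical interval.\<close>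
  have strip: "\<exists>r>0. \<exists>\<sigma>. section_over S ({x - r..x + r} \<times> {0..1}) c \<sigma>" for x :: real
  proof (rule Bolzano[where a = 0 and b = 1 and P = "\<lambda>a b. \<exists>r>0. \<exists>\<sigma>. section_over S ({x - r..x + r} \<times> {a..b}) c \<sigma>"])
    fix a b d :: real
    assume "\<exists>r>0. \<exists>\<sigma>. section_over S ({x - r..x + r} \<times> {a..b}) c \<sigma>" "\<exists>r>0. \<exists>\<sigma>. section_over S ({x - r..x + r} \<times> {b..d}) c \<sigma>"
      and ab: "a \<le> b" "b \<le> d"
    then obtain r1 \<sigma> r2 \<tau> where r: "r1 > 0" "section_over S ({x - r1..x + r1} \<times> {a..b}) c \<sigma>" "r2 > 0" "section_over S ({x - r2..x + r2} \<times> {b..d}) c \<tau>"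
      by (elim exE conjE)
    define r where "r = min r1 r2"
    let ?T1 = "{x - r..x + r} \<times> {a..b}" and ?T2 = "{x - r..x + r} \<times> {b..d}"
    have "?T1 \<inter> ?T2 = {x - r..x + r} \<times> {b}" using ab by auto
    moreover have "r > 0" using r by (simp add: r_def)
    ultimately have "convex (?T1 \<inter> ?T2)" "?T1 \<inter> ?T2 \<noteq> {}" by (auto intro: convex_Times)
    moreover have "section_over S ?T1 c \<sigma>" by (rule section_subset[OF r(2)]) (auto simp: r_def)
    moreover have "section_over S ?T2 c \<tau>" by (rule section_subset[OF r(4)]) (auto simp: r_def)
    ultimately have "\<exists>\<rho>. section_over S (?T1 \<union> ?T2) c \<rho>" by (intro glue) (auto intro: closed_Times)
    moreover have "?T1 \<union> ?T2 = {x - r..x + r} \<times> {a..d}" using ab by auto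
    ultimately show "\<exists>r>0. \<exists>\<sigma>. section_over S ({x - r..x + r} \<times> {a..d}) c \<sigma>" using \<open>r > 0\<close> by auto
  next
    fix y :: real
    obtain N \<sigma> where N: "open N" "(x, y) \<in> N" "section_over S N c \<sigma>" using section_local[OF c] by blast
    obtain A B where AB': "open A" "open B" "(x, y) \<in> A \<times> B" "A \<times> B \<subseteq> N" by (rule open_prod_elim[OF N(1,2)])
    then have AB: "open A" "x \<in> A" "open B" "y \<in> B" "A \<times> B \<subseteq> N" by simp_all
    obtain r where r: "r > 0" "cball x r \<subseteq> A" using AB open_contains_cball by metis
    obtain d where d: "d > 0" "cball y d \<subseteq> B" using AB open_contains_cball by metis
    have sub: "{x - r..x + r} \<times> {a..b} \<subseteq> N" if "a \<le> y \<and> y \<le> b \<and> b - a < d" for a b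
    proof -
      have "{x - r..x + r} \<subseteq> A" using r(2) by (simp add: cball_eq_atLeastAtMost)
      moreover have "{a..b} \<subseteq> cball y d" using that by (auto simp: cball_eq_atLeastAtMost)
      ultimately show ?thesis using d(2) AB(5) by blast
    qed
    show "\<exists>d>0. \<forall>a b. a \<le> y \<and> y \<le> b \<and> b - a < d \<longrightarrow> (\<exists>r>0. \<exists>\<sigma>. section_over S ({x - r..x + r} \<times> {a..b}) c \<sigma>)"
    proof (rule exI[of _ d], rule conjI, rule d(1), intro allI impI)
      fix a b assume "a \<le> y \<and> y \<le> b \<and> b - a < d"
      from section_subset[OF N(3) sub[OF this]] show "\<exists>r>0. \<exists>\<sigma>. section_over S ({x - r..x + r} \<times> {a..b}) c \<sigma>"
        using r(1) by (intro exI[of _ r] conjI exI[of _ \<sigma>])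
    qed
  qed simp
  show ?thesis
  proof (rule Bolzano[where a = 0 and b = 1 and P = "\<lambda>a b. \<exists>\<sigma>. section_over S ({a..b} \<times> {0..1}) c \<sigma>"])
    fix a b d :: real
    assume "\<exists>\<sigma>. section_over S ({a..b} \<times> {0..1}) c \<sigma>" "\<exists>\<sigma>. section_over S ({b..d} \<times> {0..1}) c \<sigma>" and ab: "a \<le> b" "b \<le> d"
    then obtain \<sigma> \<tau> where s: "section_over S ({a..b} \<times> {0..1}) c \<sigma>" "section_over S ({b..d} \<times> {0..1}) c \<tau>" by (elim exE)
    let ?T1 = "{a..b} \<times> {0..1::real}" and ?T2 = "{b..d} \<times> {0..1::real}"
    have "?T1 \<inter> ?T2 = {b} \<times> {0..1}" using ab by auto
    then have "convex (?T1 \<inter> ?T2)" "?T1 \<inter> ?T2 \<noteq> {}" by (auto intro: convex_Times)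
    with s have "\<exists>\<rho>. section_over S (?T1 \<union> ?T2) c \<rho>" by (intro glue) (auto intro: closed_Times)
    moreover have "?T1 \<union> ?T2 = {a..d} \<times> {0..1}" using ab by auto
    ultimately show "\<exists>\<sigma>. section_over S ({a..d} \<times> {0..1}) c \<sigma>" by simp
  next
    fix x :: real
    obtain r \<sigma> where r: "r > 0" "section_over S ({x - r..x + r} \<times> {0..1}) c \<sigma>" using strip by blast
    have sub: "{a..b} \<times> {0..1} \<subseteq> {x - r..x + r} \<times> {0..1::real}" if "a \<le> x \<and> x \<le> b \<and> b - a < r" for a b
      using that by auto
    show "\<exists>d>0. \<forall>a b. a \<le> x \<and> x \<le> b \<and> b - a < d \<longrightarrow> (\<exists>\<sigma>. section_over S ({a..b} \<times> {0..1}) c \<sigma>)"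
    proof (rule exI[of _ r], rule conjI, rule r(1), intro allI impI)
      fix a b assume "a \<le> x \<and> x \<le> b \<and> b - a < r"
      from section_subset[OF r(2) sub[OF this]] show "\<exists>\<sigma>. section_over S ({a..b} \<times> {0..1}) c \<sigma>" by (intro exI[of _ \<sigma>])
    qed
  qed simp
qed

lemma section_const: "section_over S T (\<lambda>_. e) (\<lambda>_. b)"
  by (rule section_overI) (auto intro: exI[of _ UNIV])

end

locale cover_local_system = based_space X x0 + local_system "based_space.cover X x0" S
  for X :: "'a topology" and x0 and S
begin

text \<open>
  The retraction of the plane to the unit square, used to extend maps from the square to the plane.
\<close>

definition clamp01 :: "real \<times> real \<Rightarrow> real \<times> real" where
  "clamp01 z = (max 0 (min 1 (fst z)), max 0 (min 1 (snd z)))"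

lemma section_homotopy:
  assumes h: "continuous_map (top_of_set unit_square) X h" and h0: "\<And>s. s \<in> {0..1} \<Longrightarrow> h (s, 0) = x0"
  shows "\<exists>\<sigma>. section_over S unit_square (\<lambda>z. path_lift (\<lambda>t. h (fst z, t)) (snd z)) \<sigma>"
proof -
  let ?H = "\<lambda>z. path_lift (\<lambda>t. h (fst z, t)) (snd z)"
  have H: "continuous_map (top_of_set unit_square) cover ?H" by (rule path_lift_homotopy_continuous[OF h h0])
  have "continuous_on UNIV clamp01" unfolding clamp01_def by (intro continuous_intros)
  moreover have "range clamp01 \<subseteq> unit_square" by (auto simp: clamp01_def)
  ultimately have "continuous_map euclidean (top_of_set unit_square) clamp01"
    using continuous_map_subtopology_eu[of UNIV unit_square clamp01] by auto
  from continuous_map_compose[OF this H] have "continuous_map euclidean cover (?H \<circ> clamp01)" .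
  from section_square[OF this] obtain \<sigma> where s: "section_over S unit_square (?H \<circ> clamp01) \<sigma>" by (elim exE)
  have cl: "clamp01 z = z" if "z \<in> unit_square" for z using that by (auto simp: clamp01_def mem_Times_iff)
  have "section_over S unit_square ?H \<sigma>"
  proof (rule section_overI)
    fix z U u assume z: "z \<in> unit_square" "(U, u) \<in> S" "?H z \<in> U"
    then have zU: "(?H \<circ> clamp01) z \<in> U" by (simp add: cl)
    obtain N where N0: "open N" "z \<in> N" "\<forall>w. w \<in> N \<longrightarrow> w \<in> unit_square \<longrightarrow> (?H \<circ> clamp01) w \<in> U \<and> (\<sigma> w = u ((?H \<circ> clamp01) w)) = (\<sigma> z = u ((?H \<circ> clamp01) z))"
      using section_overD[OF s z(1,2) zU] by (elim exE conjE)
    note N = N0(1,2) N0(3)[rule_format]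
    have "?H w \<in> U \<and> (\<sigma> w = u (?H w)) = (\<sigma> z = u (?H z))" if w: "w \<in> N \<inter> unit_square" for w
      using N(3)[OF IntD1[OF w] IntD2[OF w]] unfolding o_def cl[OF z(1)] cl[OF IntD2[OF w]] .
    then have b: "\<forall>w\<in>N \<inter> unit_square. ?H w \<in> U \<and> (\<sigma> w = u (?H w)) = (\<sigma> z = u (?H z))" by (rule ballI)
    show "\<exists>N. open N \<and> z \<in> N \<and> (\<forall>w\<in>N \<inter> unit_square. ?H w \<in> U \<and> (\<sigma> w = u (?H w)) = (\<sigma> z = u (?H z)))"
      by (intro exI[of _ N] conjI b N(1,2))
  qed
  then show ?thesis by (intro exI[of _ \<sigma>])
qed

lemma section_path_lift_exists:
  assumes "pathin X \<gamma>" "\<gamma> 0 = x0" shows "\<exists>\<sigma>. section_over S {0..1} (path_lift \<gamma>) \<sigma>"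
proof -
  have "continuous_map (top_of_set unit_square) (top_of_set {0..1}) (snd :: real \<times> real \<Rightarrow> real)"
    by (auto simp: continuous_map_subtopology_eu intro!: continuous_intros)
  from continuous_map_compose[OF this, of X \<gamma>] assms(1)
  have "continuous_map (top_of_set unit_square) X (\<lambda>z. \<gamma> (snd z))" by (simp add: pathin_def o_def)
  from section_homotopy[OF this] assms(2) obtain \<sigma> where s: "section_over S unit_square (\<lambda>z. path_lift \<gamma> (snd z)) \<sigma>" by auto
  have "section_over S {0..1} (\<lambda>t. path_lift \<gamma> (snd (0::real, t))) (\<lambda>t. \<sigma> (0, t))"
    by (rule section_compose[OF s]) (auto intro!: continuous_intros)
  then have "section_over S {0..1} (path_lift \<gamma>) (\<lambda>t. \<sigma> (0, t))" by simp
  then show ?thesis by (intro exI[of _ "\<lambda>t. \<sigma> (0, t)"])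
qed

lemma path_lift_image: "pathin X \<gamma> \<Longrightarrow> \<gamma> 0 = x0 \<Longrightarrow> path_lift \<gamma> ` {0..1} \<subseteq> topspace cover"
  using continuous_map_image_subset_topspace[of "top_of_set {0..1}" cover "path_lift \<gamma>"] path_lift_continuous[of \<gamma>]
  by (simp add: pathin_def)

text \<open>
  The lift of the homotopy carries a section over the square. On the two horizontal edges the lift is
  constant, hence so is the section; and on the vertical edges it agrees with the given sections up to a flip.
\<close>

lemma section_homotopy_invariant:
  assumes h: "path_hom X \<gamma> \<gamma>'" "\<gamma> 0 = x0" and s: "section_over S {0..1} (path_lift \<gamma>) \<sigma>" "section_over S {0..1} (path_lift \<gamma>') \<tau>"
  shows "(\<sigma> 1 = \<sigma> 0) = (\<tau> 1 = \<tau> 0)"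
proof -
  obtain h where h': "continuous_map (top_of_set unit_square) X h" "\<forall>t\<in>{0..1}. h (0, t) = \<gamma> t" "\<forall>t\<in>{0..1}. h (1, t) = \<gamma>' t"
      "\<forall>s\<in>{0..1}. h (s, 0) = \<gamma> 0 \<and> h (s, 1) = \<gamma> 1"
    using h(1) unfolding path_hom_iff by (elim exE conjE)
  let ?H = "\<lambda>z. path_lift (\<lambda>t. h (fst z, t)) (snd z)"
  have h0: "h (s, 0) = x0" if "s \<in> {0..1}" for s using h'(4) that h(2) by simp
  have "\<exists>\<rho>. section_over S unit_square ?H \<rho>" by (rule section_homotopy[OF h'(1)]) (rule h0)
  then obtain \<rho> where r: "section_over S unit_square ?H \<rho>" by (elim exE)
  have Hc: "continuous_map (top_of_set unit_square) cover ?H" by (rule path_lift_homotopy_continuous[OF h'(1) h0])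
  have HE: "?H ` unit_square \<subseteq> topspace cover" using continuous_map_image_subset_topspace[OF Hc] by simp
  have gp: "pathin X \<gamma>" "pathin X \<gamma>'" "\<gamma>' 0 = x0" using path_hom_pathin[OF h(1)] path_hom_ends[OF h(1)] h(2) by simp_all
  have hp: "pathin X (\<lambda>t. h (s, t))" if "s \<in> {0..1}" for s
    by (rule pathin_compose_real[OF h'(1)]) (use that in \<open>auto intro!: continuous_intros\<close>)
  have conn: "connected {0..1::real}" by simp
  \<comment> \<open>On a vertical edge the section over the square is a section along the lift of that path.\<close>
  have edge: "(\<rho> (s, 1) = \<rho> (s, 0)) = (\<mu> 1 = \<mu> 0)"
    if "s \<in> {0..1}" "\<forall>t\<in>{0..1}. h (s, t) = g t" "pathin X g" "g 0 = x0" "section_over S {0..1} (path_lift g) \<mu>" for s g \<mu>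
  proof -
    have "section_over S {0..1} (\<lambda>t. ?H (s, t)) (\<lambda>t. \<rho> (s, t))"
      by (rule section_compose[OF r]) (use that(1) in \<open>auto intro!: continuous_intros\<close>)
    moreover have pl: "?H (s, t) = path_lift g t" if t: "t \<in> {0..1}" for t
    proof -
      have m: "t * u \<in> {0..1}" if "u \<in> {0..1}" for u using that t by (auto intro: mult_le_one)
      have "path_hom X (subpath_of 0 t g) (subpath_of 0 t g)"
        by (rule path_hom_refl[OF pathin_subpath[OF \<open>pathin X g\<close>]]) (use t in simp_all)
      then have "path_hom X (subpath_of 0 t (\<lambda>t. h (s, t))) (subpath_of 0 t g)"
        by (rule path_hom_cong) (use \<open>\<forall>t\<in>{0..1}. h (s, t) = g t\<close> m in \<open>simp_all add: subpath_of_def\<close>)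
      then show ?thesis unfolding path_lift_def fst_conv snd_conv by (rule path_class_eqI)
    qed
    ultimately have r': "section_over S {0..1} (path_lift g) (\<lambda>t. \<rho> (s, t))" unfolding section_over_def by simp
    have "(\<rho> (s, 1) = \<mu> 1) = (\<rho> (s, 0) = \<mu> 0)"
      by (rule section_unique[OF conn path_lift_image[OF that(3,4)] r' that(5)]) simp_all
    then show ?thesis by argo
  qed
  have const: "\<rho> (1, t) = \<rho> (0, t)" if t: "t \<in> {0..1}" "\<And>s. s \<in> {0..1} \<Longrightarrow> ?H (s, t) = e" for t e
  proof -
    have "section_over S {0..1} (\<lambda>s. ?H (s, t)) (\<lambda>s. \<rho> (s, t))"
      by (rule section_compose[OF r]) (use t(1) in \<open>auto intro!: continuous_intros\<close>)
    then have r': "section_over S {0..1} (\<lambda>_. e) (\<lambda>s. \<rho> (s, t))" unfolding section_over_def using t(2) by simp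
    have "(0, t) \<in> unit_square" using t(1) by simp
    then have "?H (0, t) \<in> topspace cover" by (rule subsetD[OF HE imageI])
    then have eE: "(\<lambda>_. e) ` {0..1::real} \<subseteq> topspace cover" using t(2)[of 0] by auto
    have "(\<rho> (1, t) = True) = (\<rho> (0, t) = True)"
      by (rule section_unique[OF conn eE r' section_const]) simp_all
    then show ?thesis by simp
  qed
  have "\<rho> (1, 0) = \<rho> (0, 0)"
    by (rule const) (use h0 path_lift_0 in simp_all)
  moreover have "\<rho> (1, 1) = \<rho> (0, 1)"
  proof (rule const)
    fix s :: real assume s: "s \<in> {0..1}"
    let ?k = "\<lambda>z. h (s * fst z, snd z)"
    have "path_hom X \<gamma> (\<lambda>t. h (s, t))"
      unfolding path_hom_iff
    proof (intro exI[of _ ?k] conjI ballI)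
      have m: "s * u \<in> {0..1}" if "u \<in> {0..1}" for u using that s by (auto intro: mult_le_one)
      have "continuous_map (top_of_set unit_square) (top_of_set unit_square) (\<lambda>z. (s * fst z, snd z))"
        unfolding continuous_map_subtopology_eu using m by (auto intro!: continuous_intros)
      from continuous_map_compose[OF this h'(1)] show "continuous_map (top_of_set unit_square) X ?k" by (simp add: o_def)
      fix u :: real assume u: "u \<in> {0..1}"
      show "?k (u, 0) = \<gamma> 0" "?k (u, 1) = \<gamma> 1" using h'(4) m[OF u] by simp_all
    qed (use h'(2) in simp_all)
    then show "?H (s, 1) = path_class \<gamma>" unfolding path_lift_1 fst_conv snd_conv by (rule path_class_eqI[symmetric])
  qed simp
  moreover have "(\<rho> (0, 1) = \<rho> (0, 0)) = (\<sigma> 1 = \<sigma> 0)" by (rule edge[OF _ h'(2) gp(1) h(2) s(1)]) simp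
  moreover have "(\<rho> (1, 1) = \<rho> (1, 0)) = (\<tau> 1 = \<tau> 0)" by (rule edge[OF _ h'(3) gp(2,3) s(2)]) simp
  ultimately show ?thesis by argo
qed

text \<open>
  The global section obtained by continuing the value \<open>False\<close> at the base point along a representative path. By homotopy
  invariance neither the representative nor the section chosen along it matters.
\<close>

definition continuation :: "(real \<Rightarrow> 'a) set \<Rightarrow> bool" where
  "continuation e \<longleftrightarrow> (\<exists>\<sigma>. section_over S {0..1} (path_lift (rep e)) \<sigma> \<and> \<sigma> 1 \<noteq> \<sigma> 0)"

lemma continuation_eq:
  assumes g: "pathin X \<gamma>" "\<gamma> 0 = x0" and s: "section_over S {0..1} (path_lift \<gamma>) \<sigma>"
  shows "continuation (path_class \<gamma>) \<longleftrightarrow> \<sigma> 1 \<noteq> \<sigma> 0"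
proof -
  have e: "path_class \<gamma> \<in> path_classes" by (rule path_class_in[OF g])
  have inv: "(\<sigma> 1 = \<sigma> 0) = (\<tau> 1 = \<tau> 0)" if "section_over S {0..1} (path_lift (rep (path_class \<gamma>))) \<tau>" for \<tau>
    by (rule section_homotopy_invariant[OF rep_path_class[OF g(1)] g(2) s that])
  obtain \<tau> where t: "section_over S {0..1} (path_lift (rep (path_class \<gamma>))) \<tau>"
    using section_path_lift_exists[OF rep(1,2)[OF e]] by (elim exE)
  show ?thesis
  proof
    assume "continuation (path_class \<gamma>)" then show "\<sigma> 1 \<noteq> \<sigma> 0" unfolding continuation_def using inv by auto
  next
    assume "\<sigma> 1 \<noteq> \<sigma> 0" then show "continuation (path_class \<gamma>)" unfolding continuation_def using inv[OF t] t by auto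
  qed
qed

text \<open>
  Continuing along \<open>d\<close> inside \<open>U\<close> changes the section in step with the local section \<open>s\<close>. The technical
  content is that the second half of the lift of the concatenation is the lift of \<open>d\<close> at the class of \<open>\<gamma>\<close>.
\<close>

lemma continuation_extend:
  assumes U: "(U, s) \<in> S" and g: "pathin X \<gamma>" "\<gamma> 0 = x0" and d: "pathin X d" "d 0 = \<gamma> 1"
    and inU: "\<And>t. t \<in> {0..1} \<Longrightarrow> path_class (concat_paths \<gamma> (subpath_of 0 t d)) \<in> U"
  shows "(continuation (path_class (concat_paths \<gamma> d)) = s (path_class (concat_paths \<gamma> d))) = (continuation (path_class \<gamma>) = s (path_class \<gamma>))"
proof -
  let ?g = "concat_paths \<gamma> d"
  have gp: "pathin X ?g" "?g 0 = x0" using pathin_concat[OF g(1) d(1)] d(2) g(2) by simp_all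
  obtain \<sigma> where s: "section_over S {0..1} (path_lift ?g) \<sigma>" using section_path_lift_exists[OF gp] by (elim exE)
  have half1: "path_lift ?g (t / 2) = path_lift \<gamma> t" if t: "t \<in> {0..1}" for t
  proof -
    have m: "t * u \<in> {0..1}" if "u \<in> {0..1}" for u using that t by (auto intro: mult_le_one)
    have "path_hom X (subpath_of 0 t \<gamma>) (subpath_of 0 t \<gamma>)"
      by (rule path_hom_refl[OF pathin_subpath[OF g(1)]]) (use t in simp_all)
    then have "path_hom X (subpath_of 0 (t / 2) ?g) (subpath_of 0 t \<gamma>)"
      by (rule path_hom_cong) (use m in \<open>auto simp: subpath_of_def concat_paths_def\<close>)
    then show ?thesis unfolding path_lift_def by (rule path_class_eqI)
  qed
  \<comment> \<open>The initial segment of the concatenation up to time \<open>(1 + t) / 2\<close> is \<open>\<gamma>\<close> followed by a part of \<open>d\<close>, up to the change of parameter from \<open>?f\<close> to \<open>?k\<close>.\<close>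
  have half2: "path_lift ?g ((1 + t) / 2) = path_class (concat_paths \<gamma> (subpath_of 0 t d))" if t: "t \<in> {0..1}" for t
  proof -
    let ?f = "\<lambda>u. (1 + t) / 2 * u" and ?k = "concat_paths (\<lambda>u. u / 2) (\<lambda>u. 1/2 + t * u / 2)"
    have K: "continuous_map (top_of_set {0..1}) X ?g" using gp(1) by (simp add: pathin_def)
    have kp: "pathin (top_of_set {0..1}) ?k"
    proof (rule pathin_concat)
      show "pathin (top_of_set {0..1}) (\<lambda>u::real. u / 2)"
        unfolding pathin_def continuous_map_subtopology_eu by (auto intro!: continuous_intros)
      have m: "1/2 + t * u / 2 \<in> {0..1}" if "u \<in> {0..1}" for u
      proof -
        have "t * u \<le> 1" "0 \<le> t * u" using that t by (auto intro: mult_le_one)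
        then show ?thesis by simp
      qed
      show "pathin (top_of_set {0..1}) (\<lambda>u. 1/2 + t * u / 2)"
        unfolding pathin_def continuous_map_subtopology_eu
      proof
        show "continuous_on {0..1} (\<lambda>u. 1/2 + t * u / 2)" by (intro continuous_intros) simp_all
        show "(\<lambda>u. 1/2 + t * u / 2) \<in> {0..1} \<rightarrow> {0..1}" by (rule funcsetI) (rule m)
      qed
    qed simp
    have "path_hom X (\<lambda>u. ?g (?f u)) (\<lambda>u. ?g (?k u))"
    proof (rule path_hom_convex[OF _ K, of ?f ?k])
      show "continuous_on {0..1} ?f" by (intro continuous_intros)
      have "(1 + t) / 2 * u \<le> 1" "0 \<le> (1 + t) / 2 * u" if "u \<in> {0..1}" for u
        using that t mult_le_one[of "(1 + t) / 2" u] by simp_all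
      then show "?f ` {0..1} \<subseteq> {0..1}" by auto
      show "continuous_on {0..1} ?k" "?k ` {0..1} \<subseteq> {0..1}"
        using kp unfolding pathin_def continuous_map_subtopology_eu by (simp_all only: image_subset_iff_funcset)
    qed (simp_all add: concat_paths_def add_divide_distrib)
    moreover have "concat_paths \<gamma> (subpath_of 0 t d) u = ?g (?k u)" if "u \<in> {0..1}" for u
    proof (cases "u \<le> 1/2")
      case True then show ?thesis by (simp add: concat_paths_def)
    next
      case False
      then have pos: "0 \<le> t * (2 * u - 1)" using t by simp
      show ?thesis
      proof (cases "t * (2 * u - 1) = 0")
        case True
        then have "?k u = 1/2" using False by (simp add: concat_paths_def)
        then have "?g (?k u) = ?g (1/2)" by (rule arg_cong)
        moreover have "?g (1/2) = \<gamma> 1" by (simp add: concat_paths_def)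
        ultimately have "?g (?k u) = \<gamma> 1" by (rule trans)
        then show ?thesis using True False d(2) by (simp add: concat_paths_def subpath_of_def)
      next
        case False2: False
        have "?k u = 1/2 + t * (2 * u - 1) / 2" using False by (simp add: concat_paths_def)
        then have "?g (?k u) = ?g (1/2 + t * (2 * u - 1) / 2)" by (rule arg_cong)
        moreover have "?g x = d (2 * x - 1)" if "\<not> x \<le> 1/2" for x
          using that by (simp add: concat_paths_def)
        moreover have "\<not> 1/2 + t * (2 * u - 1) / 2 \<le> 1/2" using pos False2 by simp
        moreover have "2 * (1/2 + t * (2 * u - 1) / 2) - 1 = t * (2 * u - 1)" by (simp add: distrib_left)
        ultimately have "?g (?k u) = d (t * (2 * u - 1))" by metis
        then show ?thesis using False by (simp add: concat_paths_def subpath_of_def)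
      qed
    qed
    ultimately have "path_hom X (\<lambda>u. ?g (?f u)) (concat_paths \<gamma> (subpath_of 0 t d))"
      by (elim path_hom_cong) simp_all
    then have "path_hom X (subpath_of 0 ((1 + t) / 2) ?g) (concat_paths \<gamma> (subpath_of 0 t d))"
      by (simp add: subpath_of_def)
    then show ?thesis unfolding path_lift_def by (rule path_class_eqI)
  qed
  have "section_over S {0..1} (\<lambda>t. path_lift ?g (t / 2)) (\<lambda>t. \<sigma> (t / 2))"
    by (rule section_compose[OF s]) (auto intro!: continuous_intros)
  then have "section_over S {0..1} (path_lift \<gamma>) (\<lambda>t. \<sigma> (t / 2))" unfolding section_over_def using half1 by simp
  from continuation_eq[OF g this] have v1: "continuation (path_class \<gamma>) \<longleftrightarrow> \<sigma> (1/2) \<noteq> \<sigma> 0" by simp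
  have v2: "continuation (path_class ?g) \<longleftrightarrow> \<sigma> 1 \<noteq> \<sigma> 0" by (rule continuation_eq[OF gp s])
  have "(\<sigma> 1 = s (path_lift ?g 1)) = (\<sigma> (1/2) = s (path_lift ?g (1/2)))"
  proof (rule connectedin_locally_constant[of euclidean "{1/2..1::real}" "\<lambda>t. \<sigma> t = s (path_lift ?g t)"])
    fix t :: real assume t: "t \<in> {1/2..1}"
    then have t': "2 * t - 1 \<in> {0..1}" "t \<in> {0..1}" by auto
    have tU: "path_lift ?g t \<in> U" using inU[OF t'(1)] half2[OF t'(1)] by simp
    obtain N where N0: "open N" "t \<in> N" "\<forall>w. w \<in> N \<longrightarrow> w \<in> {0..1} \<longrightarrow> path_lift ?g w \<in> U \<and> (\<sigma> w = s (path_lift ?g w)) = (\<sigma> t = s (path_lift ?g t))"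
      using section_overD[OF s t'(2) U tU] by (elim exE conjE)
    note N = N0(1,2) N0(3)[rule_format]
    show "\<exists>W. openin euclidean W \<and> t \<in> W \<and> (\<forall>q\<in>W \<inter> {1/2..1}. (\<sigma> q = s (path_lift ?g q)) = (\<sigma> t = s (path_lift ?g t)))"
    proof (intro exI[of _ N] conjI ballI)
      fix q assume "q \<in> N \<inter> {1/2..1}"
      then have "q \<in> N" "q \<in> {0..1}" by auto
      from N(3)[OF this] show "(\<sigma> q = s (path_lift ?g q)) = (\<sigma> t = s (path_lift ?g t))" by (rule conjunct2)
    qed (use N in simp_all)
  qed simp_all
  moreover have "path_lift ?g (1/2) = path_class \<gamma>" using half1[of 1] path_lift_1 by simp
  moreover have "path_lift ?g 1 = path_class ?g" by (rule path_lift_1)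
  ultimately have "(\<sigma> 1 = s (path_class ?g)) = (\<sigma> (1/2) = s (path_class \<gamma>))" by simp
  then show ?thesis unfolding v1 v2 by (cases "\<sigma> 1"; cases "\<sigma> (1/2)"; cases "\<sigma> 0"; cases "s (path_class ?g)"; cases "s (path_class \<gamma>)") simp_all
qed

lemma continuation_section:
  assumes U: "(U, s) \<in> S" and e: "e \<in> U"
  shows "\<exists>W. openin cover W \<and> e \<in> W \<and> W \<subseteq> U \<and> (\<forall>q\<in>W. (continuation q = s q) = (continuation e = s e))"
proof -
  have oU: "openin cover U" by (rule S_open[OF U])
  have ec: "e \<in> path_classes" using oU e unfolding openin_cover by blast
  obtain V where V: "stable_nbhd U e V" using oU e unfolding openin_cover by blast
  have oV: "openin X V" "proj e \<in> V" using V by (simp_all add: stable_nbhd_def)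
  have stable: "extend e d \<in> U" if "pathin (subtopology X V) d" "d 0 = proj e" for d
    using V that unfolding stable_nbhd_def by simp
  note r = rep[OF ec]
  have "(continuation q = s q) = (continuation e = s e)" if q: "q \<in> sheet V e" for q
  proof -
    obtain d where d: "q = extend e d" "pathin (subtopology X V) d" "d 0 = proj e" using q unfolding sheet_def by blast
    have "(continuation (path_class (concat_paths (rep e) d)) = s (path_class (concat_paths (rep e) d))) = (continuation (path_class (rep e)) = s (path_class (rep e)))"
    proof (rule continuation_extend[OF U r(1,2) pathin_sub[OF d(2)]])
      fix t :: real assume t: "t \<in> {0..1}"
      have "pathin (subtopology X V) (subpath_of 0 t d)" by (rule pathin_subpath[OF d(2)]) (use t in simp_all)
      from stable[OF this] show "path_class (concat_paths (rep e) (subpath_of 0 t d)) \<in> U"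
        using d(3) by (simp add: extend_def subpath_of_def)
    qed (use d(3) r(4) in simp)
    then show ?thesis unfolding r(3) d(1) extend_def .
  qed
  moreover have "sheet V e \<subseteq> U" unfolding sheet_def using stable by blast
  moreover have "openin cover (sheet V e)" "e \<in> sheet V e" using openin_sheet sheet_self oV ec by blast+
  ultimately show ?thesis by (intro exI[of _ "sheet V e"] conjI ballI)
qed

end

context based_space
begin

theorem Z2_trivial_cover: "Z2_trivial cover"
  unfolding Z2_trivial_def
proof (intro allI impI)
  fix S :: "((real \<Rightarrow> 'a) set set \<times> ((real \<Rightarrow> 'a) set \<Rightarrow> bool)) set"
  assume 1: "\<forall>U s. (U, s) \<in> S \<longrightarrow> openin cover U" and 2: "\<forall>p\<in>topspace cover. \<exists>U s. (U, s) \<in> S \<and> p \<in> U"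
    and 3: "\<forall>U s V t p. (U, s) \<in> S \<longrightarrow> (V, t) \<in> S \<longrightarrow> p \<in> U \<longrightarrow> p \<in> V \<longrightarrow>
        (\<exists>W. openin cover W \<and> p \<in> W \<and> W \<subseteq> U \<inter> V \<and> (\<forall>q\<in>W. (s q = t q) = (s p = t p)))"
  interpret cover_local_system X x0 S
  proof unfold_locales
    show "openin cover U" if "(U, s) \<in> S" for U s by (rule 1[rule_format, OF that])
    show "\<exists>U s. (U, s) \<in> S \<and> p \<in> U" if "p \<in> topspace cover" for p by (rule bspec[OF 2 that])
    show "\<exists>W. openin cover W \<and> p \<in> W \<and> W \<subseteq> U \<inter> V \<and> (\<forall>q\<in>W. (s q = t q) = (s p = t p))"
      if "(U, s) \<in> S" "(V, t) \<in> S" "p \<in> U" "p \<in> V" for U s V t p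
      using 3 that by simp
  qed
  show "\<exists>f. \<forall>U s p. (U, s) \<in> S \<longrightarrow> p \<in> U \<longrightarrow>
      (\<exists>W. openin cover W \<and> p \<in> W \<and> W \<subseteq> U \<and> (\<forall>q\<in>W. (f q = s q) = (f p = s p)))"
    using continuation_section by (intro exI[of _ continuation] allI impI)
qed

end

section \<open>Deck transformations of the lifted foliation\<close>

text \<open>
  A foliated space with the data of its leaves that are used on the universal cover: \<open>leafwise\<close> paths, which are the paths continuous in
  the leaf topology, and \<open>leaf_label\<close>, which assigns to a point its leaf. Two conditions carry the geometry: leafwise loops are null
  homotopic, as leaves are simply connected, and a leaf meets small charts in at most one plaque, as leaves are closed.
\<close>

locale simple_foliated = foliated_space X C for X :: "'a topology" and C +
  fixes x0 :: 'a and leafwise :: "(real \<Rightarrow> 'a) \<Rightarrow> bool" and leaf_label :: "'a \<Rightarrow> 'a set"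
  assumes base_point: "x0 \<in> topspace X"
    and chart_simple: "(U, y) \<in> C \<Longrightarrow> simple_open X U"
    and leafwise_const: "p \<in> topspace X \<Longrightarrow> leafwise (\<lambda>_. p)"
    and leafwise_concat: "\<lbrakk>leafwise d; leafwise d'; d 1 = d' 0\<rbrakk> \<Longrightarrow> leafwise (concat_paths d d')"
    and leafwise_plaque: "\<lbrakk>(U, y) \<in> C; p \<in> U; q \<in> U; y p = y q\<rbrakk> \<Longrightarrow>
        \<exists>d. pathin (subtopology X U) d \<and> d 0 = p \<and> d 1 = q \<and> leafwise d"
    and leafwise_null: "\<lbrakk>leafwise d; d 0 = d 1\<rbrakk> \<Longrightarrow> path_hom X d (\<lambda>_. d 0)"
    and leafwise_pathin: "leafwise d \<Longrightarrow> pathin X d"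
    and leaf_label_plaque: "\<lbrakk>(U, y) \<in> C; p \<in> U; q \<in> U; y p = y q\<rbrakk> \<Longrightarrow> leaf_label p = leaf_label q"
    and leaf_label_self: "p \<in> leaf_label p"
    and leaf_label_discrete: "\<lbrakk>p \<in> topspace X; q \<in> topspace X\<rbrakk> \<Longrightarrow>
        \<exists>U y. (U, y) \<in> C \<and> q \<in> U \<and> (\<forall>r\<in>U \<inter> leaf_label p. \<forall>s\<in>U \<inter> leaf_label p. y r = y s)"
begin

sublocale based_space X x0
proof
  show "x0 \<in> topspace X" by (rule base_point)
  fix W p assume "openin X W" "p \<in> W"
  from charts_base[OF this] obtain U y where U: "(U, y) \<in> C" "p \<in> U" "U \<subseteq> W" by (elim exE conjE)
  then show "\<exists>V. simple_open X V \<and> p \<in> V \<and> V \<subseteq> W" by (intro exI[of _ U] conjI chart_simple)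
qed

text \<open>
  The coordinate \<open>z\<close> is prescribed on its sheet only. If it were required to be \<open>y \<circ> proj\<close> everywhere, deck
  transformations would not permute these pairs.
\<close>

definition lifted_charts :: "((real \<Rightarrow> 'a) set set \<times> ((real \<Rightarrow> 'a) set \<Rightarrow> real)) set" where
  "lifted_charts = {(sheet U e, z) | U y e z. (U, y) \<in> C \<and> e \<in> path_classes \<and> proj e \<in> U \<and> (\<forall>e'\<in>sheet U e. z e' = y (proj e'))}"

lemma lifted_chartI: "(U, y) \<in> C \<Longrightarrow> e \<in> path_classes \<Longrightarrow> proj e \<in> U \<Longrightarrow> (\<And>e'. e' \<in> sheet U e \<Longrightarrow> z e' = y (proj e')) \<Longrightarrow>
    (sheet U e, z) \<in> lifted_charts"
  unfolding lifted_charts_def by blast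

lemma lifted_chartE:
  assumes "(V, z) \<in> lifted_charts"
  obtains U y e where "V = sheet U e" "(U, y) \<in> C" "e \<in> path_classes" "proj e \<in> U" "\<And>e'. e' \<in> V \<Longrightarrow> z e' = y (proj e')"
  using assms unfolding lifted_charts_def by blast

lemma sheet_extend:
  assumes "e \<in> path_classes" "e' \<in> sheet V e" "pathin (subtopology X V) d'" "d' 0 = proj e'"
  shows "extend e' d' \<in> sheet V e"
proof -
  obtain d where d: "e' = extend e d" "pathin (subtopology X V) d" "d 0 = proj e" using assms(2) unfolding sheet_def by blast
  have pe': "d 1 = d' 0" using extend_in(2)[OF assms(1) pathin_sub[OF d(2)] d(3)] d(1) assms(4) by simp
  have "extend e' d' = extend e (concat_paths d d')"
    unfolding d(1) by (rule extend_extend[OF assms(1) pathin_sub[OF d(2)] pathin_sub[OF assms(3)] d(3) pe'])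
  moreover have "pathin (subtopology X V) (concat_paths d d')" by (rule pathin_concat[OF d(2) assms(3) pe'])
  ultimately show ?thesis unfolding sheet_def using d(3) by auto
qed

sublocale cov: connected_foliated_space cover lifted_charts
proof unfold_locales
  fix V z assume "(V, z) \<in> lifted_charts"
  then obtain U y e where V: "V = sheet U e" "(U, y) \<in> C" "e \<in> path_classes" "proj e \<in> U" "\<And>e'. e' \<in> V \<Longrightarrow> z e' = y (proj e')"
    by (rule lifted_chartE) blast
  have sU: "simple_open X U" by (rule chart_simple[OF V(2)])
  have pU: "proj e' \<in> U" if "e' \<in> V" for e' using proj_sheet[OF V(3)] that V(1) by simp
  show oV: "openin cover V" unfolding V(1) by (rule openin_sheet[OF chart_openin[OF V(2)] V(3)])
  have "{e' \<in> sheet U e. proj e' \<in> U} = V" using pU V(1) by auto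
  then show "connectedin cover V" using connectedin_sheet[OF sU V(3,4) chart_connected[OF V(2)] order_refl] by simp
  have "continuous_map (subtopology cover V) (subtopology X U) proj"
    using continuous_map_from_subtopology[OF continuous_proj] pU
    by (intro continuous_map_into_subtopology) auto
  from continuous_map_compose[OF this chart_continuous[OF V(2)]]
  show "continuous_map (subtopology cover V) euclideanreal z"
    by (rule continuous_map_eq) (use V(5) in auto)
  show "open (z ` W)" if W: "openin cover W" "W \<subseteq> V" for W
  proof -
    have "z ` W = y ` proj ` W" using V(5) W(2) by (auto simp: image_image intro!: image_cong)
    moreover have "proj ` W \<subseteq> U" using pU W(2) by blast
    ultimately show ?thesis using chart_open_map[OF V(2) openin_proj_image[OF W(1)]] by simp
  qed
  show "connectedin cover {q \<in> V. z q = t}" for t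
  proof -
    have "{q \<in> V. z q = t} = {e' \<in> sheet U e. proj e' \<in> {q \<in> U. y q = t}}" using V(1,5) pU by auto
    moreover have "connectedin cover {e' \<in> sheet U e. proj e' \<in> {q \<in> U. y q = t}}"
      by (rule connectedin_sheet[OF sU V(3,4) plaque_connected[OF V(2)]]) blast
    ultimately show ?thesis by simp
  qed
  show "(V, \<lambda>q. - z q) \<in> lifted_charts"
    unfolding V(1) by (rule lifted_chartI[OF chart_reverse[OF V(2)] V(3,4)]) (use V in simp)
  show "\<exists>W h. openin cover W \<and> p \<in> W \<and> W \<subseteq> V \<inter> V' \<and> (\<forall>q\<in>W. z' q = h (z q))"
    if V': "(V', z') \<in> lifted_charts" and p: "p \<in> V" "p \<in> V'" for V' z' p
  proof -
    obtain U' y' e' where V'': "V' = sheet U' e'" "(U', y') \<in> C" "e' \<in> path_classes" "proj e' \<in> U'" "\<And>e''. e'' \<in> V' \<Longrightarrow> z' e'' = y' (proj e'')"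
      by (rule lifted_chartE[OF V']) blast
    have "proj p \<in> U'" using proj_sheet[OF V''(3)] p(2) V''(1) by simp
    from charts_coherent[OF V(2) V''(2) pU[OF p(1)] this]
    obtain W h where W: "openin X W" "proj p \<in> W" "W \<subseteq> U \<inter> U'" "\<forall>q\<in>W. y' q = h (y q)" by (elim exE conjE)
    have "openin cover {e \<in> topspace cover. proj e \<in> W}" using continuous_proj W(1) unfolding continuous_map_def by simp
    then have o: "openin cover ({e \<in> topspace cover. proj e \<in> W} \<inter> (V \<inter> V'))"
      using oV openin_sheet[OF chart_openin[OF V''(2)] V''(3)] unfolding V''(1) by (intro openin_Int)
    have "z' q = h (z q)" if q: "q \<in> {e \<in> topspace cover. proj e \<in> W} \<inter> (V \<inter> V')" for q
      using bspec[OF W(4), of "proj q"] V(5)[of q] V''(5)[of q] q by simp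
    moreover have "p \<in> topspace cover" using p(1) openin_subset[OF oV] by blast
    ultimately show ?thesis using o W(2) p
      by (intro exI[of _ "{e \<in> topspace cover. proj e \<in> W} \<inter> (V \<inter> V')"] exI[of _ h] conjI ballI) auto
  qed
next
  fix W p assume W: "openin cover W" "p \<in> W"
  then have pc: "p \<in> path_classes" unfolding openin_cover by blast
  obtain N where N: "stable_nbhd W p N" using W unfolding openin_cover by blast
  then have "openin X N" "proj p \<in> N" by (simp_all add: stable_nbhd_def)
  from charts_base[OF this] obtain U y where U: "(U, y) \<in> C" "proj p \<in> U" "U \<subseteq> N" by (elim exE conjE)
  have "extend p d \<in> W" if "pathin (subtopology X U) d" "d 0 = proj p" for d
  proof -
    have "pathin (subtopology X N) d" using that(1) U(3) by (auto simp: pathin_subtopology)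
    then show ?thesis using N that(2) unfolding stable_nbhd_def by simp
  qed
  then have "sheet U p \<subseteq> W" unfolding sheet_def by blast
  moreover have "p \<in> sheet U p" by (rule sheet_self[OF chart_openin[OF U(1)] pc U(2)])
  moreover have "(sheet U p, \<lambda>e. y (proj e)) \<in> lifted_charts" by (rule lifted_chartI[OF U(1) pc U(2)]) simp
  ultimately show "\<exists>U y. (U, y) \<in> lifted_charts \<and> p \<in> U \<and> U \<subseteq> W"
    by (intro exI[of _ "sheet U p"] exI[of _ "\<lambda>e. y (proj e)"] conjI)
next
  show "connected_space cover" by (rule connected_cover)
qed

text \<open>
  A leaf of the cover is traced by leafwise paths downstairs: each step inside a plaque of a sheet
  is a leafwise continuation.
\<close>

lemma cov_leaf_path:
  assumes e: "e \<in> path_classes" and e': "e' \<in> cov.leaf e"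
  shows "\<exists>d. leafwise d \<and> d 0 = proj e \<and> e' = extend e d"
proof -
  from e' have "cov.plaque_rel\<^sup>*\<^sup>* e e'" by (simp add: cov.leaf_def)
  then show ?thesis
  proof (induction rule: rtranclp_induct)
    case base
    show ?case
      by (intro exI[of _ "\<lambda>_. proj e"] conjI leafwise_const proj_in[OF e] extend_const[OF e, symmetric] refl)
  next
    case (step e1 e2)
    then obtain d where d: "leafwise d" "d 0 = proj e" "e1 = extend e d" by (elim exE conjE)
    have dX: "pathin X d" by (rule leafwise_pathin[OF d(1)])
    have pe1: "proj e1 = d 1" using extend_in(2)[OF e dX d(2)] d(3) by simp
    have e1c: "e1 \<in> path_classes" using extend_in(1)[OF e dX d(2)] d(3) by simp
    from step(2) obtain V z where V: "(V, z) \<in> lifted_charts" "e1 \<in> V" "e2 \<in> V" "z e1 = z e2"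
      unfolding cov.plaque_rel_def by (elim exE conjE)
    obtain U y e0 where U: "V = sheet U e0" "(U, y) \<in> C" "e0 \<in> path_classes" "proj e0 \<in> U" "\<And>e'. e' \<in> V \<Longrightarrow> z e' = y (proj e')"
      by (rule lifted_chartE[OF V(1)]) blast
    have "proj e1 \<in> U" "proj e2 \<in> U" "y (proj e1) = y (proj e2)"
      using proj_sheet[OF U(3)] V U(1) U(5)[OF V(2)] U(5)[OF V(3)] by simp_all
    from leafwise_plaque[OF U(2) this] obtain d' where d': "pathin (subtopology X U) d'" "d' 0 = proj e1" "d' 1 = proj e2" "leafwise d'"
      by (elim exE conjE)
    have "extend e1 d' \<in> sheet U e0" by (rule sheet_extend[OF U(3) _ d'(1,2)]) (use V(2) U(1) in simp)
    moreover have "proj (extend e1 d') = proj e2" using extend_in(2)[OF e1c pathin_sub[OF d'(1)] d'(2)] d'(3) by simp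
    ultimately have "extend e1 d' = e2"
      using inj_onD[OF proj_inj_sheet[OF chart_simple[OF U(2)] U(3)]] V(3) U(1) by simp
    moreover have "extend e1 d' = extend e (concat_paths d d')"
      unfolding d(3) by (rule extend_extend[OF e dX pathin_sub[OF d'(1)] d(2)]) (use pe1 d'(2) in simp)
    moreover have "leafwise (concat_paths d d')" by (rule leafwise_concat[OF d(1) d'(4)]) (use pe1 d'(2) in simp)
    ultimately show ?case using d(2) by (intro exI[of _ "concat_paths d d'"]) simp
  qed
qed

lemma leaf_label_cov_leaf: "e' \<in> cov.leaf e \<Longrightarrow> leaf_label (proj e') = leaf_label (proj e)"
proof -
  assume "e' \<in> cov.leaf e"
  then have "cov.plaque_rel\<^sup>*\<^sup>* e e'" by (simp add: cov.leaf_def)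
  then show ?thesis
  proof (induction rule: rtranclp_induct)
    case (step e1 e2)
    from step(2) obtain V z where V: "(V, z) \<in> lifted_charts" "e1 \<in> V" "e2 \<in> V" "z e1 = z e2"
      unfolding cov.plaque_rel_def by (elim exE conjE)
    obtain U y e0 where U: "V = sheet U e0" "(U, y) \<in> C" "e0 \<in> path_classes" "proj e0 \<in> U" "\<And>e'. e' \<in> V \<Longrightarrow> z e' = y (proj e')"
      by (rule lifted_chartE[OF V(1)]) blast
    have "proj e1 \<in> U" "proj e2 \<in> U" "y (proj e1) = y (proj e2)"
      using proj_sheet[OF U(3)] V U(1) U(5)[OF V(2)] U(5)[OF V(3)] by simp_all
    from leaf_label_plaque[OF U(2) this] show ?case using step.IH by simp
  qed simp
qed

text \<open>
  A whole orbit of leaves of the cover lies over one leaf downstairs, so discreteness passes to the orbit.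
\<close>

lemma cov_discrete:
  assumes "a \<in> path_classes" "p \<in> path_classes"
  shows "\<exists>V z. (V, z) \<in> lifted_charts \<and> p \<in> V \<and> (\<forall>q\<in>V. \<forall>r\<in>V. leaf_label (proj q) = leaf_label (proj a) \<longrightarrow> leaf_label (proj r) = leaf_label (proj a) \<longrightarrow> z q = z r)"
proof -
  obtain U y where U: "(U, y) \<in> C" "proj p \<in> U" "\<forall>r\<in>U \<inter> leaf_label (proj a). \<forall>s\<in>U \<inter> leaf_label (proj a). y r = y s"
    using leaf_label_discrete[OF proj_in[OF assms(1)] proj_in[OF assms(2)]] by (elim exE conjE)
  have "y (proj q) = y (proj r)" if "q \<in> sheet U p" "r \<in> sheet U p" "leaf_label (proj q) = leaf_label (proj a)" "leaf_label (proj r) = leaf_label (proj a)" for q r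
  proof (rule bspec[OF bspec[OF U(3)]])
    show "proj q \<in> U \<inter> leaf_label (proj a)" "proj r \<in> U \<inter> leaf_label (proj a)"
      using proj_sheet[OF assms(2) that(1)] proj_sheet[OF assms(2) that(2)] leaf_label_self that(3,4) by blast+
  qed
  moreover have "(sheet U p, \<lambda>e. y (proj e)) \<in> lifted_charts" by (rule lifted_chartI[OF U(1) assms(2) U(2)]) simp
  moreover have "p \<in> sheet U p" by (rule sheet_self[OF chart_openin[OF U(1)] assms(2) U(2)])
  ultimately show ?thesis by (intro exI[of _ "sheet U p"] exI[of _ "\<lambda>e. y (proj e)"] conjI ballI impI)
qed

lemma cov_separable: "cov.separable_leaves"
proof (rule cov.Z2_trivial_separable_leaves[OF Z2_trivial_cover])
  fix l assume "cov.is_leaf l"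
  then obtain a where a: "a \<in> path_classes" "l = cov.leaf a" unfolding cov.is_leaf_def topspace_cover by blast
  show "cov.locally_single l"
    unfolding cov.locally_single_def topspace_cover
  proof
    fix p assume "p \<in> path_classes"
    from cov_discrete[OF a(1) this] obtain V z where V: "(V, z) \<in> lifted_charts" "p \<in> V"
      "\<forall>q\<in>V. \<forall>r\<in>V. leaf_label (proj q) = leaf_label (proj a) \<longrightarrow> leaf_label (proj r) = leaf_label (proj a) \<longrightarrow> z q = z r" by (elim exE conjE)
    have "z q = z r" if "q \<in> l \<inter> V" "r \<in> l \<inter> V" for q r
      by (rule V(3)[rule_format]) (use that leaf_label_cov_leaf a(2) in blast)+
    then show "\<exists>U y. (U, y) \<in> lifted_charts \<and> p \<in> U \<and> (\<forall>q\<in>l \<inter> U. \<forall>r\<in>l \<inter> U. y q = y r)"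
      using V(1,2) by (intro exI[of _ V] exI[of _ z] conjI ballI)
  qed
qed

definition deck :: "(real \<Rightarrow> 'a) set \<Rightarrow> (real \<Rightarrow> 'a) set \<Rightarrow> (real \<Rightarrow> 'a) set" where
  "deck a e = path_class (concat_paths (rep a) (rep e))"

lemma loop_class_eq:
  assumes "p \<in> loops X x0" shows "loop_class X x0 p = path_class p"
proof -
  have p: "p 0 = x0" "p 1 = x0" using assms by (simp_all add: loops_def)
  have "q \<in> loops X x0" if "path_hom X p q" for q
    using path_hom_pathin[OF that] path_hom_ends[OF that] p by (simp add: loops_def)
  then show ?thesis unfolding loop_class_def path_class_def homotopic_loops_at_def path_hom_def p by blast
qed

lemma fundamental_carrier: "carrier (fundamental_group X x0) = path_class ` loops X x0"
  unfolding fundamental_group_def by (simp add: loop_class_eq)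

lemma carrier_rep:
  assumes "a \<in> carrier (fundamental_group X x0)"
  shows "a \<in> path_classes" "proj a = x0" "rep a \<in> loops X x0"
proof -
  obtain p where p: "a = path_class p" "pathin X p" "p 0 = x0" "p 1 = x0" using assms unfolding fundamental_carrier loops_def by blast
  show a: "a \<in> path_classes" using path_class_in p by simp
  show pa: "proj a = x0" using p by simp
  show "rep a \<in> loops X x0" using rep[OF a] pa by (simp add: loops_def)
qed

lemma fundamental_mult:
  assumes "a \<in> carrier (fundamental_group X x0)" "b \<in> carrier (fundamental_group X x0)"
  shows "a \<otimes>\<^bsub>fundamental_group X x0\<^esub> b = deck a b"
proof -
  note a = carrier_rep[OF assms(1)] and b = carrier_rep[OF assms(2)]
  have "loop_class X x0 (concat_paths p q) = deck a b" if "p \<in> a" "q \<in> b" for p q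
  proof -
    have "path_hom X (rep a) p" "path_hom X (rep b) q" using that rep(3)[OF a(1)] rep(3)[OF b(1)] unfolding path_class_def by blast+
    note h = this
    have ends: "p 0 = x0" "p 1 = x0" "q 0 = x0" "q 1 = x0"
      using path_hom_ends[OF h(1)] path_hom_ends[OF h(2)] a(3) b(3) by (simp_all add: loops_def)
    have l: "concat_paths p q \<in> loops X x0"
      using pathin_concat[of X p q] path_hom_pathin[OF h(1)] path_hom_pathin[OF h(2)] ends by (simp add: loops_def)
    have "path_hom X (concat_paths (rep a) (rep b)) (concat_paths p q)"
      by (rule path_hom_concat[OF h]) (use a(3) b(3) in \<open>simp add: loops_def\<close>)
    then show ?thesis unfolding loop_class_eq[OF l] deck_def by (rule path_class_eqI[symmetric])
  qed
  moreover have "rep a \<in> a" "rep b \<in> b"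
    using path_hom_refl[OF rep(1)[OF a(1)]] path_hom_refl[OF rep(1)[OF b(1)]] rep(3)[OF a(1)] rep(3)[OF b(1)] unfolding path_class_def by blast+
  ultimately have "(\<Union>p\<in>a. \<Union>q\<in>b. loop_class X x0 (concat_paths p q)) = deck a b" by blast
  then show ?thesis by (simp add: fundamental_group_def)
qed

lemma fundamental_one: "\<one>\<^bsub>fundamental_group X x0\<^esub> = path_class (\<lambda>_. x0)"
  using loop_class_eq[of "\<lambda>_. x0"] x0 by (simp add: fundamental_group_def loops_def pathin_const)

lemma deck_path_class:
  assumes "a \<in> carrier (fundamental_group X x0)" "pathin X p" "p 0 = x0"
  shows "deck a (path_class p) = path_class (concat_paths (rep a) p)"
  unfolding deck_def
  by (rule path_class_eqI[OF path_hom_concat[OF path_hom_refl path_hom_sym[OF rep_path_class]]])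
    (use carrier_rep[OF assms(1)] assms(2,3) path_hom_ends[OF rep_path_class[OF assms(2)]] in \<open>simp_all add: loops_def\<close>)

lemma deck_in:
  assumes "a \<in> carrier (fundamental_group X x0)" "e \<in> path_classes"
  shows "deck a e \<in> path_classes" "proj (deck a e) = proj e"
proof -
  note a = carrier_rep(3)[OF assms(1)] and e = rep[OF assms(2)]
  have "pathin X (concat_paths (rep a) (rep e))" by (rule pathin_concat) (use a e in \<open>simp_all add: loops_def\<close>)
  then show "deck a e \<in> path_classes" "proj (deck a e) = proj e"
    unfolding deck_def using a e(4) by (simp_all add: path_class_in loops_def)
qed

lemma deck_extend:
  assumes "a \<in> carrier (fundamental_group X x0)" "e \<in> path_classes" "pathin X d" "d 0 = proj e"
  shows "extend (deck a e) d = deck a (extend e d)"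
proof -
  note a = carrier_rep(3)[OF assms(1)] and e = rep[OF assms(2)]
  have ap: "pathin X (rep a)" "rep a 1 = rep e 0" using a e by (simp_all add: loops_def)
  have "extend (deck a e) d = path_class (concat_paths (concat_paths (rep a) (rep e)) d)"
    unfolding deck_def by (rule extend_path_class[OF pathin_concat[OF ap(1) e(1) ap(2)] assms(3)]) (use e assms(4) in simp)
  also have "\<dots> = path_class (concat_paths (rep a) (concat_paths (rep e) d))"
    by (rule path_class_eqI[OF path_hom_assoc[OF ap(1) e(1) assms(3) ap(2)]]) (use e assms(4) in simp)
  also have "\<dots> = deck a (extend e d)"
    unfolding extend_def by (rule deck_path_class[OF assms(1) pathin_concat[OF e(1) assms(3)], symmetric]) (use e assms(4) in simp_all)
  finally show ?thesis .
qed

lemma deck_mult: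
  assumes "a \<in> carrier (fundamental_group X x0)" "b \<in> carrier (fundamental_group X x0)" "e \<in> path_classes"
  shows "deck (a \<otimes>\<^bsub>fundamental_group X x0\<^esub> b) e = deck a (deck b e)"
proof -
  note b = carrier_rep[OF assms(2)] and e = rep[OF assms(3)]
  have "deck a (deck b e) = deck a (extend b (rep e))" by (simp add: deck_def extend_def)
  also have "\<dots> = extend (deck a b) (rep e)"
    by (rule deck_extend[OF assms(1) b(1) e(1), symmetric]) (use e b in simp)
  also have "\<dots> = deck (deck a b) e" by (simp add: deck_def extend_def)
  finally show ?thesis using fundamental_mult[OF assms(1,2)] by simp
qed

lemma deck_one: "e \<in> path_classes \<Longrightarrow> deck \<one>\<^bsub>fundamental_group X x0\<^esub> e = e"
proof -
  assume e: "e \<in> path_classes"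
  note r = rep[OF e]
  have c: "pathin X (\<lambda>_. x0)" using x0 by (simp add: pathin_const)
  have "deck (path_class (\<lambda>_. x0)) e = extend (path_class (\<lambda>_. x0)) (rep e)" by (simp add: deck_def extend_def)
  also have "\<dots> = path_class (concat_paths (\<lambda>_. x0) (rep e))" by (rule extend_path_class[OF c r(1)]) (use r in simp)
  also have "\<dots> = e" using path_class_eqI[OF path_hom_unit_left[OF r(1)]] r(2,3) by simp
  finally show ?thesis by (simp add: fundamental_one)
qed

lemma deck_sheet:
  assumes "a \<in> carrier (fundamental_group X x0)" "e \<in> path_classes"
  shows "deck a ` sheet U e = sheet U (deck a e)"
proof -
  have "deck a (extend e d) = extend (deck a e) d" if "pathin (subtopology X U) d" "d 0 = proj e" for d
    using deck_extend[OF assms pathin_sub[OF that(1)] that(2)] by simp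
  then show ?thesis unfolding sheet_def deck_in(2)[OF assms] by (auto simp: image_iff)
qed

lemma deck_openin:
  assumes a: "a \<in> carrier (fundamental_group X x0)" and W: "openin cover W"
  shows "openin cover (deck a ` W)"
  unfolding openin_cover
proof (intro conjI ballI)
  have Wc: "W \<subseteq> path_classes" using W unfolding openin_cover by blast
  then show "deck a ` W \<subseteq> path_classes" using deck_in(1)[OF a] by blast
  fix e' assume "e' \<in> deck a ` W"
  then obtain e where e: "e \<in> W" "e' = deck a e" by blast
  have ec: "e \<in> path_classes" using e Wc by blast
  obtain V where V: "stable_nbhd W e V" using W e unfolding openin_cover by blast
  have "extend e' d \<in> deck a ` W" if "pathin (subtopology X V) d" "d 0 = proj e'" for d
  proof -
    have d0: "d 0 = proj e" using that(2) e(2) deck_in(2)[OF a ec] by simp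
    have "extend e d \<in> W" using V that(1) d0 unfolding stable_nbhd_def by simp
    then show ?thesis unfolding e(2) using deck_extend[OF a ec pathin_sub[OF that(1)] d0] by simp
  qed
  then have "stable_nbhd (deck a ` W) e' V"
    using V e(2) deck_in(2)[OF a ec] unfolding stable_nbhd_def by simp
  then show "\<exists>V. stable_nbhd (deck a ` W) e' V" by (rule exI)
qed

text \<open>
  If \<open>a\<close> maps \<open>e\<close> into its leaf, then \<open>a e\<close> is the continuation of \<open>e\<close> along a leafwise loop. Such
  a loop is null homotopic, so \<open>a e = e\<close> and \<open>a\<close> is trivial.
\<close>

lemma deck_free:
  assumes a: "a \<in> carrier (fundamental_group X x0)" and e: "e \<in> path_classes" and l: "deck a e \<in> cov.leaf e"
  shows "a = \<one>\<^bsub>fundamental_group X x0\<^esub>"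
proof -
  note ar = carrier_rep[OF a] and er = rep[OF e]
  from cov_leaf_path[OF e l] obtain d where d: "leafwise d" "d 0 = proj e" "deck a e = extend e d" by (elim exE conjE)
  have dX: "pathin X d" by (rule leafwise_pathin[OF d(1)])
  have "d 1 = proj e" using extend_in(2)[OF e dX d(2)] d(3) deck_in(2)[OF a e] by simp
  then have "path_hom X d (\<lambda>_. proj e)" using leafwise_null[OF d(1)] d(2) by simp
  from extend_cong[OF e this d(2)] have "extend e d = e" using extend_const[OF e] by simp
  then have "path_class (concat_paths (rep a) (rep e)) = path_class (rep e)" using d(3) er(3) by (simp add: deck_def)
  moreover have ap: "pathin X (rep a)" "rep a 0 = x0" "rep a 1 = x0" using ar(3) by (simp_all add: loops_def)
  moreover have pc: "pathin X (concat_paths (rep a) (rep e))" by (rule pathin_concat[OF ap(1) er(1)]) (use ap er in simp)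
  ultimately have h: "path_hom X (concat_paths (rep a) (rep e)) (rep e)" by (intro path_class_eqD)
  let ?r = "\<lambda>t. rep e (1 - t)"
  have rp: "pathin X ?r" by (rule pathin_reverse[OF er(1)])
  have rev: "path_hom X (concat_paths (rep e) ?r) (\<lambda>_. x0)" using path_hom_reverse[OF er(1)] er(2) by simp
  have "path_hom X (concat_paths (rep a) (\<lambda>_. x0)) (rep a)" using path_hom_unit_right[OF ap(1)] ap(3) by simp
  then have "path_hom X (rep a) (concat_paths (rep a) (\<lambda>_. x0))" by (rule path_hom_sym)
  also have "path_hom X (concat_paths (rep a) (\<lambda>_. x0)) (concat_paths (rep a) (concat_paths (rep e) ?r))"
    by (rule path_hom_concat[OF path_hom_refl[OF ap(1)] path_hom_sym[OF rev]]) (use ap in simp)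
  also (path_hom_trans) have "path_hom X (concat_paths (rep a) (concat_paths (rep e) ?r)) (concat_paths (concat_paths (rep a) (rep e)) ?r)"
    by (rule path_hom_sym[OF path_hom_assoc[OF ap(1) er(1) rp]]) (use ap er in simp_all)
  also (path_hom_trans) have "path_hom X (concat_paths (concat_paths (rep a) (rep e)) ?r) (concat_paths (rep e) ?r)"
    by (rule path_hom_concat[OF h path_hom_refl[OF rp]]) simp
  also (path_hom_trans) note rev
  finally (path_hom_trans) have "path_class (rep a) = path_class (\<lambda>_. x0)" by (rule path_class_eqI)
  then show ?thesis using rep(3)[OF ar(1)] by (simp add: fundamental_one)
qed

theorem abelian_subgroup_cyclic:
  assumes H: "subgroup H (fundamental_group X x0)"
    and K: "comm_group ((fundamental_group X x0)\<lparr>carrier := H\<rparr>)"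
  shows "\<exists>h\<in>H. generate ((fundamental_group X x0)\<lparr>carrier := H\<rparr>) {h} = H"
proof -
  let ?K = "(fundamental_group X x0)\<lparr>carrier := H\<rparr>"
  have HG: "h \<in> carrier (fundamental_group X x0)" if "h \<in> H" for h using subgroup.subset[OF H] that by blast
  interpret K: comm_group ?K by (rule K)
  have inv: "deck (inv\<^bsub>?K\<^esub> h) (deck h e) = e" if h: "h \<in> H" and e: "e \<in> path_classes" for h e
  proof -
    have hi: "inv\<^bsub>?K\<^esub> h \<in> H" using K.inv_closed[of h] h by simp
    have "inv\<^bsub>?K\<^esub> h \<otimes>\<^bsub>?K\<^esub> h = \<one>\<^bsub>?K\<^esub>" using K.l_inv[of h] h by simp
    then have "inv\<^bsub>?K\<^esub> h \<otimes>\<^bsub>fundamental_group X x0\<^esub> h = \<one>\<^bsub>fundamental_group X x0\<^esub>" by simp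
    then show ?thesis using deck_mult[OF HG[OF hi] HG[OF h] e] deck_one[OF e] by simp
  qed
  have chart: "(deck h ` V, z \<circ> deck (inv\<^bsub>?K\<^esub> h)) \<in> lifted_charts" if h: "h \<in> H" and V: "(V, z) \<in> lifted_charts" for h V z
  proof -
    obtain U y e where U: "V = sheet U e" "(U, y) \<in> C" "e \<in> path_classes" "proj e \<in> U" "\<And>e'. e' \<in> V \<Longrightarrow> z e' = y (proj e')"
      by (rule lifted_chartE[OF V]) blast
    have sh: "deck h ` V = sheet U (deck h e)" unfolding U(1) by (rule deck_sheet[OF HG[OF h] U(3)])
    show ?thesis unfolding sh
    proof (rule lifted_chartI[OF U(2) deck_in(1)[OF HG[OF h] U(3)]])
      show "proj (deck h e) \<in> U" using deck_in(2)[OF HG[OF h] U(3)] U(4) by simp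
      fix e' assume "e' \<in> sheet U (deck h e)"
      then obtain e'' where e'': "e'' \<in> V" "e' = deck h e''" using sh by blast
      have ec: "e'' \<in> path_classes" using sheet_subset[OF U(3)] e''(1) U(1) by blast
      show "(z \<circ> deck (inv\<^bsub>?K\<^esub> h)) e' = y (proj e')"
        using inv[OF h ec] U(5)[OF e''(1)] deck_in(2)[OF HG[OF h] ec] e''(2) by simp
    qed
  qed
  interpret foliated_action cover lifted_charts ?K deck
  proof unfold_locales
    fix h assume "h \<in> carrier ?K"
    then have h: "h \<in> H" by simp
    have hi: "inv\<^bsub>?K\<^esub> h \<in> H" using K.inv_closed[of h] h by simp
    have ii: "inv\<^bsub>?K\<^esub> (inv\<^bsub>?K\<^esub> h) = h" using K.inv_inv[of h] h by simp
    show "cov.automorphism (deck h) (deck (inv\<^bsub>?K\<^esub> h))"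
      unfolding cov.automorphism_def topspace_cover
    proof (intro conjI ballI allI impI)
      fix p assume p: "p \<in> path_classes"
      show "deck h p \<in> path_classes" by (rule deck_in(1)[OF HG[OF h] p])
      show "deck (inv\<^bsub>?K\<^esub> h) p \<in> path_classes" by (rule deck_in(1)[OF HG[OF hi] p])
      show "deck (inv\<^bsub>?K\<^esub> h) (deck h p) = p" by (rule inv[OF h p])
      show "deck h (deck (inv\<^bsub>?K\<^esub> h) p) = p" using inv[OF hi p] unfolding ii .
    next
      fix V assume V: "openin cover V"
      show "openin cover (deck h ` V)" by (rule deck_openin[OF HG[OF h] V])
      show "openin cover (deck (inv\<^bsub>?K\<^esub> h) ` V)" by (rule deck_openin[OF HG[OF hi] V])
    next
      fix U y assume U: "(U, y) \<in> lifted_charts"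
      show "(deck h ` U, y \<circ> deck (inv\<^bsub>?K\<^esub> h)) \<in> lifted_charts" by (rule chart[OF h U])
      show "(deck (inv\<^bsub>?K\<^esub> h) ` U, y \<circ> deck h) \<in> lifted_charts" using chart[OF hi U] unfolding ii .
    qed
    show "deck (h \<otimes>\<^bsub>?K\<^esub> k) p = deck h (deck k p)" if "k \<in> carrier ?K" "p \<in> topspace cover" for k p
      using deck_mult[OF HG[OF h] HG, of k p] that by (simp add: topspace_cover)
    show "h = \<one>\<^bsub>?K\<^esub>" if "p \<in> topspace cover" "deck h p \<in> cov.leaf p" for p
      using deck_free[OF HG[OF h], of p] that by (simp add: topspace_cover)
  next
    show "cov.separable_leaves" by (rule cov_separable)
  next
    fix a p assume "a \<in> topspace cover" "p \<in> topspace cover"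
    then have ap: "a \<in> path_classes" "p \<in> path_classes" by (simp_all add: topspace_cover)
    from cov_discrete[OF ap] obtain V z where V: "(V, z) \<in> lifted_charts" "p \<in> V"
      "\<forall>q\<in>V. \<forall>r\<in>V. leaf_label (proj q) = leaf_label (proj a) \<longrightarrow> leaf_label (proj r) = leaf_label (proj a) \<longrightarrow> z q = z r" by (elim exE conjE)
    have lvh: "leaf_label (proj q) = leaf_label (proj a)" if "h \<in> carrier ?K" "q \<in> V \<inter> cov.leaf (deck h a)" for h q
      using leaf_label_cov_leaf[of q "deck h a"] deck_in(2)[OF HG ap(1), of h] that by simp
    have "z q = z r" if "h \<in> carrier ?K" "k \<in> carrier ?K" "q \<in> V \<inter> cov.leaf (deck h a)" "r \<in> V \<inter> cov.leaf (deck k a)" for h k q r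
      by (rule V(3)[rule_format, OF IntD1[OF that(3)] IntD1[OF that(4)] lvh[OF that(1,3)] lvh[OF that(2,4)]])
    then show "\<exists>U y. (U, y) \<in> lifted_charts \<and> p \<in> U \<and> (\<forall>h\<in>carrier ?K. \<forall>k\<in>carrier ?K.
        \<forall>q\<in>U \<inter> cov.leaf (deck h a). \<forall>r\<in>U \<inter> cov.leaf (deck k a). y q = y r)"
      using V(1,2) by (intro exI[of _ V] exI[of _ z] conjI ballI)
  qed
  have "path_class (\<lambda>_. x0) \<in> path_classes" by (rule path_class_in) (simp_all add: pathin_const x0)
  then have "topspace cover \<noteq> {}" unfolding topspace_cover by blast
  from cyclic_group[OF this] show ?thesis by simp
qed

end

section \<open>Foliations by closed planes: flow boxes\<close>

text \<open>
  Without isolated points, the closure \<open>K\<close> of \<open>T\<close> in a small ball would be countable and perfect, and the dense open sets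
  \<open>K - {k}\<close> would have empty intersection, against Baire's theorem.
\<close>

lemma countable_closed_isolated_point:
  fixes T I :: "real set"
  assumes T: "countable T" "T \<noteq> {}" "T \<subseteq> I" and I: "open I" "open (I - T)"
  shows "\<exists>t\<in>T. \<exists>e>0. \<forall>t'\<in>T. \<bar>t' - t\<bar> < e \<longrightarrow> t' = t"
proof (rule ccontr)
  assume "\<not> ?thesis"
  then have near: "\<exists>t'\<in>T. \<bar>t' - t\<bar> < e \<and> t' \<noteq> t" if "t \<in> T" "e > 0" for t e using that by blast
  obtain t0 where t0: "t0 \<in> T" using T(2) by blast
  then obtain r where r: "r > 0" "cball t0 r \<subseteq> I" using I(1) T(3) open_contains_cball by blast
  define K where "K = closure (T \<inter> ball t0 r)"
  have sub: "T \<inter> ball t0 r \<subseteq> K" unfolding K_def by (rule closure_subset)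
  have "K \<subseteq> cball t0 r" unfolding K_def by (rule closure_minimal) auto
  have KT: "K \<subseteq> T"
  proof
    fix x assume x: "x \<in> K"
    show "x \<in> T"
    proof (rule ccontr)
      assume "x \<notin> T"
      then have "x \<in> I - T" using x \<open>K \<subseteq> cball t0 r\<close> r(2) by blast
      moreover have "(I - T) \<inter> K = {}"
        unfolding K_def by (subst open_Int_closure_eq_empty[OF I(2)]) blast
      ultimately show False using x by blast
    qed
  qed
  have t0K: "t0 \<in> K" unfolding K_def using t0 r(1) closure_subset by force
  have dense: "K \<subseteq> closure (K - {k})" for k
  proof
    fix x assume x: "x \<in> K"
    show "x \<in> closure (K - {k})"
      unfolding closure_approachable
    proof (intro allI impI)
      fix e :: real assume "e > 0"
      then obtain t1 where t1: "t1 \<in> T" "t1 \<in> ball t0 r" "dist t1 x < e"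
        using x unfolding K_def closure_approachable by blast
      \<comment> \<open>Small enough for the neighbour \<open>t2\<close> of \<open>t1\<close> to remain in both balls; one of the two differs from \<open>k\<close>.\<close>
      define d where "d = min (e - dist t1 x) (r - dist t0 t1)"
      have "d > 0" using t1 by (simp add: d_def)
      then obtain t2 where t2: "t2 \<in> T" "\<bar>t2 - t1\<bar> < d" "t2 \<noteq> t1" using near[OF t1(1)] by blast
      have d: "\<bar>t2 - t1\<bar> < e - \<bar>t1 - x\<bar>" "\<bar>t2 - t1\<bar> < r - \<bar>t0 - t1\<bar>" using t2(2) by (simp_all add: d_def dist_real_def)
      have "dist t2 x < e" using d(1) unfolding dist_real_def by linarith
      moreover have "t2 \<in> ball t0 r" using d(2) unfolding mem_ball dist_real_def by linarith
      ultimately have "t1 \<in> K - {k} \<and> dist t1 x < e \<or> t2 \<in> K - {k} \<and> dist t2 x < e"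
        using subsetD[OF sub IntI[OF t1(1,2)]] subsetD[OF sub IntI[OF t2(1)]] t1(3) t2(3) by simp
      then show "\<exists>y\<in>K - {k}. dist y x < e" by (elim disjE conjE) (rule bexI, assumption, assumption)+
    qed
  qed
  have "K \<subseteq> closure (\<Inter>((\<lambda>k. K - {k}) ` K))"
  proof (rule Baire)
    show "closed K" by (simp add: K_def)
    show "countable ((\<lambda>k. K - {k}) ` K)" using countable_subset[OF KT T(1)] by simp
    fix S assume "S \<in> (\<lambda>k. K - {k}) ` K"
    then obtain k where S: "S = K - {k}" by blast
    have "openin (top_of_set K) (K - {k})" by (simp add: openin_delete)
    then show "openin (top_of_set K) S \<and> K \<subseteq> closure S" using dense S by simp
  qed
  moreover have "\<Inter>((\<lambda>k. K - {k}) ` K) = {}" using t0K by blast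
  ultimately show False using t0K by simp
qed

text \<open>
  The situation that the main theorem excludes for certain fundamental groups.
\<close>

locale planar_foliation =
  fixes N :: "'a topology" and A F :: "('a, real ^ 'n) chart set" and k :: 'n
  assumes planes: "foliation_by_planes N A k F" and closed_leaves: "\<And>L. L \<in> leaves N k F \<Longrightarrow> closedin N L"
begin

lemma fol: "foliation N A k F" using planes by (simp add: foliation_by_planes_def)

lemma F_chart: "c \<in> F \<Longrightarrow> chart_on N UNIV c" using fol by (simp add: foliation_def)

lemma F_openin: "(U, \<phi>) \<in> F \<Longrightarrow> openin N U" using F_chart[of "(U, \<phi>)"] by (simp add: chart_on_def)

lemma F_cover: "p \<in> topspace N \<Longrightarrow> \<exists>U \<phi>. (U, \<phi>) \<in> F \<and> p \<in> U"
  using fol unfolding foliation_def by force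

lemma F_coherent:
  assumes "(U, \<phi>) \<in> F" "(V, \<psi>) \<in> F" "p \<in> U" "p \<in> V"
  shows "\<exists>W h. openin N W \<and> p \<in> W \<and> W \<subseteq> U \<inter> V \<and> (\<forall>q\<in>W. \<psi> q $ k = h (\<phi> q $ k))"
proof -
  have "coherent N k (U, \<phi>) (V, \<psi>)" using fol assms(1,2) by (simp add: foliation_def)
  then show ?thesis using assms(3,4) unfolding coherent_def by blast
qed

lemma F_inverse:
  assumes "(U, \<phi>) \<in> F"
  obtains g where "open (\<phi> ` U)" "continuous_map (subtopology N U) (top_of_set (\<phi> ` U)) \<phi>"
    "continuous_map (top_of_set (\<phi> ` U)) N g" "\<And>x. x \<in> \<phi> ` U \<Longrightarrow> g x \<in> U \<and> \<phi> (g x) = x" "\<And>p. p \<in> U \<Longrightarrow> g (\<phi> p) = p"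
proof -
  have U: "openin N U" by (rule F_openin[OF assms])
  have o: "open (\<phi> ` U)" and h: "homeomorphic_map (subtopology N U) (top_of_set (\<phi> ` U)) \<phi>"
    using F_chart[OF assms] by (simp_all add: chart_on_def)
  have tU: "topspace (subtopology N U) = U" using openin_subset[OF U] by auto
  from h obtain g where g: "homeomorphic_maps (subtopology N U) (top_of_set (\<phi> ` U)) \<phi> g"
    unfolding homeomorphic_map_maps by blast
  then have gc: "continuous_map (top_of_set (\<phi> ` U)) (subtopology N U) g"
    and fc: "continuous_map (subtopology N U) (top_of_set (\<phi> ` U)) \<phi>"
    and 1: "\<And>p. p \<in> U \<Longrightarrow> g (\<phi> p) = p"
    unfolding homeomorphic_maps_def tU by simp_all
  have "g x \<in> U \<and> \<phi> (g x) = x" if "x \<in> \<phi> ` U" for x using that 1 by auto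
  then show thesis using that[OF o fc _ _ 1] gc by (simp add: continuous_map_in_subtopology)
qed

lemma F_open_image:
  assumes "(U, \<phi>) \<in> F" "openin N W" "W \<subseteq> U" shows "open (\<phi> ` W)"
proof -
  obtain g where g: "open (\<phi> ` U)" "continuous_map (top_of_set (\<phi> ` U)) N g"
     "\<And>x. x \<in> \<phi> ` U \<Longrightarrow> g x \<in> U \<and> \<phi> (g x) = x" "\<And>p. p \<in> U \<Longrightarrow> g (\<phi> p) = p"
    by (rule F_inverse[OF assms(1)]) blast
  have "\<phi> ` W = {x \<in> \<phi> ` U. g x \<in> W}" using g(3,4) assms(3) by force
  moreover have "openin (top_of_set (\<phi> ` U)) {x \<in> \<phi> ` U. g x \<in> W}"
    using g(2) assms(2) unfolding continuous_map_def by simp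
  ultimately have "openin (top_of_set (\<phi> ` U)) (\<phi> ` W)" by simp
  then show ?thesis using g(1) by (metis openin_open_eq)
qed

lemma F_preimage:
  assumes "(U, \<phi>) \<in> F" "open B" shows "openin N {p \<in> U. \<phi> p \<in> B}"
proof -
  obtain g where "continuous_map (subtopology N U) (top_of_set (\<phi> ` U)) \<phi>" by (rule F_inverse[OF assms(1)]) blast
  then have c: "continuous_map (subtopology N U) euclidean \<phi>" by (simp add: continuous_map_in_subtopology)
  have U: "openin N U" by (rule F_openin[OF assms(1)])
  have tU: "topspace (subtopology N U) = U" using openin_subset[OF U] by auto
  have "openin (subtopology N U) {p \<in> U. \<phi> p \<in> B}" using c assms(2) unfolding continuous_map_def tU by simp
  then show ?thesis using openin_open_subtopology[OF U] by blast
qed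

lemma open_coordinate_image:
  assumes "open S" shows "open ((\<lambda>x::real^'n. x $ k) ` S)"
proof (rule open_surjective_linear_image[OF assms])
  show "linear (\<lambda>x::real^'n. x $ k)" by (simp add: linear_iff)
  show "surj (\<lambda>x::real^'n. x $ k)"
  proof (rule surjI)
    show "(\<chi> i. t) $ k = t" for t :: real by simp
  qed
qed

lemma F_open_transverse_image:
  assumes "(U, \<phi>) \<in> F" "openin N W" "W \<subseteq> U" shows "open ((\<lambda>p. \<phi> p $ k) ` W)"
  using open_coordinate_image[OF F_open_image[OF assms]] by (simp add: image_image)

lemma F_transverse_preimage:
  assumes "(U, \<phi>) \<in> F" "open B" shows "openin N {p \<in> U. \<phi> p $ k \<in> B}"
proof -
  have "open {x::real^'n. x $ k \<in> B}"
    using open_vimage[OF assms(2), of "\<lambda>x::real^'n. x $ k"] by (simp add: vimage_def continuous_intros)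
  from F_preimage[OF assms(1) this] show ?thesis by simp
qed

definition box_chart :: "'a set \<Rightarrow> ('a \<Rightarrow> real ^ 'n) \<Rightarrow> (real ^ 'n) set \<Rightarrow> 'a set" where
  "box_chart U \<phi> B = {p \<in> U. \<phi> p \<in> B}"

text \<open>
  Foliated charts are cut down to convex boxes so that they and their plaques are connected and simply connected.
  Both signs of the transverse coordinate are included, so that charts can be reversed.
\<close>

definition flow_charts :: "('a set \<times> ('a \<Rightarrow> real)) set" where
  "flow_charts = {(box_chart U \<phi> B, \<lambda>p. s * \<phi> p $ k) | U \<phi> B s.
     (U, \<phi>) \<in> F \<and> open B \<and> convex B \<and> B \<subseteq> \<phi> ` U \<and> (s = 1 \<or> s = -1)}"

lemma flow_chartE:
  assumes "(V, y) \<in> flow_charts"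
  obtains U \<phi> B s where "V = box_chart U \<phi> B" "y = (\<lambda>p. s * \<phi> p $ k)" "(U, \<phi>) \<in> F" "open B" "convex B" "B \<subseteq> \<phi> ` U" "s = 1 \<or> s = -1"
proof -
  from assms obtain U \<phi> B s where "(V, y) = (box_chart U \<phi> B, \<lambda>p. s * \<phi> p $ k)"
    and *: "(U, \<phi>) \<in> F" "open B" "convex B" "B \<subseteq> \<phi> ` U" "s = 1 \<or> s = -1"
    unfolding flow_charts_def by (elim CollectE exE conjE)
  then show thesis by (intro that[OF _ _ *]) simp_all
qed

lemma flow_chartI:
  "\<lbrakk>(U, \<phi>) \<in> F; open B; convex B; B \<subseteq> \<phi> ` U; s = 1 \<or> s = -1\<rbrakk> \<Longrightarrow> (box_chart U \<phi> B, \<lambda>p. s * \<phi> p $ k) \<in> flow_charts"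
  unfolding flow_charts_def by blast

lemma box_chart_base:
  assumes "(U, \<phi>) \<in> F" "openin N W" "p \<in> W" "p \<in> U"
  shows "\<exists>B. open B \<and> convex B \<and> B \<subseteq> \<phi> ` U \<and> p \<in> box_chart U \<phi> B \<and> box_chart U \<phi> B \<subseteq> W"
proof -
  obtain g where g: "\<And>p. p \<in> U \<Longrightarrow> g (\<phi> p) = p" by (rule F_inverse[OF assms(1)]) blast
  have "open (\<phi> ` (W \<inter> U))" by (rule F_open_image[OF assms(1) openin_Int[OF assms(2) F_openin[OF assms(1)]]]) blast
  moreover have "\<phi> p \<in> \<phi> ` (W \<inter> U)" using assms by blast
  ultimately obtain r where r: "r > 0" "ball (\<phi> p) r \<subseteq> \<phi> ` (W \<inter> U)" using openE by blast
  have "box_chart U \<phi> (ball (\<phi> p) r) \<subseteq> W"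
  proof
    fix q assume q: "q \<in> box_chart U \<phi> (ball (\<phi> p) r)"
    then obtain q' where "q' \<in> W" "q' \<in> U" "\<phi> q = \<phi> q'" using r(2) unfolding box_chart_def by blast
    then show "q \<in> W" using g q unfolding box_chart_def by (metis (no_types, lifting) mem_Collect_eq)
  qed
  moreover have "p \<in> box_chart U \<phi> (ball (\<phi> p) r)" using assms(4) r(1) by (simp add: box_chart_def)
  moreover have "ball (\<phi> p) r \<subseteq> \<phi> ` U" using r(2) by blast
  ultimately show ?thesis by (intro exI[of _ "ball (\<phi> p) r"] conjI open_ball convex_ball)
qed

lemma box_chart_param:
  assumes "(U, \<phi>) \<in> F" "B \<subseteq> \<phi> ` U"
  obtains g where "continuous_map (top_of_set B) N g" "\<And>x. x \<in> B \<Longrightarrow> g x \<in> box_chart U \<phi> B \<and> \<phi> (g x) = x"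
    "\<And>p. p \<in> box_chart U \<phi> B \<Longrightarrow> g (\<phi> p) = p"
proof -
  obtain g where g: "continuous_map (top_of_set (\<phi> ` U)) N g"
     "\<And>x. x \<in> \<phi> ` U \<Longrightarrow> g x \<in> U \<and> \<phi> (g x) = x" "\<And>p. p \<in> U \<Longrightarrow> g (\<phi> p) = p"
    by (rule F_inverse[OF assms(1)]) blast
  have "continuous_map (top_of_set B) N g"
    using continuous_map_from_subtopology_mono[OF g(1) assms(2)] .
  moreover have "g x \<in> box_chart U \<phi> B \<and> \<phi> (g x) = x" if "x \<in> B" for x
    using g(2)[of x] that assms(2) by (auto simp: box_chart_def)
  moreover have "g (\<phi> p) = p" if "p \<in> box_chart U \<phi> B" for p using g(3) that by (simp add: box_chart_def)
  ultimately show thesis by (rule that)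
qed

lemma box_connected:
  assumes "(U, \<phi>) \<in> F" "B \<subseteq> \<phi> ` U" "convex B" "convex S"
  shows "connectedin N {p \<in> box_chart U \<phi> B. \<phi> p \<in> S}"
proof -
  obtain g where g: "continuous_map (top_of_set B) N g" "\<And>x. x \<in> B \<Longrightarrow> g x \<in> box_chart U \<phi> B \<and> \<phi> (g x) = x"
    "\<And>p. p \<in> box_chart U \<phi> B \<Longrightarrow> g (\<phi> p) = p" by (rule box_chart_param[OF assms(1,2)]) blast
  have "{p \<in> box_chart U \<phi> B. \<phi> p \<in> S} = g ` (B \<inter> S)"
  proof
    show "{p \<in> box_chart U \<phi> B. \<phi> p \<in> S} \<subseteq> g ` (B \<inter> S)"
      using g(3) by (force simp: box_chart_def)
    show "g ` (B \<inter> S) \<subseteq> {p \<in> box_chart U \<phi> B. \<phi> p \<in> S}" using g(2) by force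
  qed
  moreover have "connectedin (top_of_set B) (B \<inter> S)"
    using convex_connected[OF convex_Int[OF assms(3,4)]] by (simp add: connectedin_subtopology)
  ultimately show ?thesis using connectedin_continuous_map_image[OF g(1)] by simp
qed

sublocale foliated_space N flow_charts
proof unfold_locales
  fix V y assume V: "(V, y) \<in> flow_charts"
  then obtain U \<phi> B s where *: "V = box_chart U \<phi> B" "y = (\<lambda>p. s * \<phi> p $ k)" "(U, \<phi>) \<in> F" "open B" "convex B" "B \<subseteq> \<phi> ` U" "s = 1 \<or> s = -1"
    by (rule flow_chartE)
  have VU: "V \<subseteq> U" by (auto simp: *(1) box_chart_def)
  have s0: "s \<noteq> 0" using *(7) by auto
  show "openin N V" unfolding *(1) box_chart_def by (rule F_preimage[OF *(3,4)])
  show "connectedin N V" using box_connected[OF *(3,6,5) convex_UNIV] *(1) by simp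
  show "continuous_map (subtopology N V) euclideanreal y"
  proof -
    obtain g where "continuous_map (subtopology N U) (top_of_set (\<phi> ` U)) \<phi>" by (rule F_inverse[OF *(3)]) blast
    then have "continuous_map (subtopology N U) euclidean \<phi>" by (simp add: continuous_map_in_subtopology)
    then have "continuous_map (subtopology N V) euclidean \<phi>" using VU by (rule continuous_map_from_subtopology_mono)
    moreover have "continuous_map euclidean euclideanreal (\<lambda>x::real^'n. s * x $ k)" by (auto intro!: continuous_intros)
    ultimately have "continuous_map (subtopology N V) euclideanreal ((\<lambda>x. s * x $ k) \<circ> \<phi>)" by (rule continuous_map_compose)
    then show ?thesis by (simp add: *(2) o_def)
  qed
  show "open (y ` W)" if "openin N W" "W \<subseteq> V" for W
  proof -
    have "open ((\<lambda>p. \<phi> p $ k) ` W)" using F_open_transverse_image[OF *(3) that(1)] that(2) VU by blast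
    moreover have "y ` W = (\<lambda>t. s *\<^sub>R t) ` (\<lambda>p. \<phi> p $ k) ` W" by (simp add: *(2) image_image)
    ultimately show ?thesis using open_scaling[OF s0] by metis
  qed
  show "connectedin N {q \<in> V. y q = t}" for t
  proof -
    have "convex {x::real^'n. s * x $ k = t}"
    proof (rule convexI)
      fix x z :: "real^'n" and u v :: real
      assume "x \<in> {x. s * x $ k = t}" "z \<in> {x. s * x $ k = t}" and uv: "u + v = 1"
      then have e: "s * x $ k = t" "s * z $ k = t" by simp_all
      have "s * (u *\<^sub>R x + v *\<^sub>R z) $ k = u * (s * x $ k) + v * (s * z $ k)" by (simp add: algebra_simps)
      also have "\<dots> = t" using uv unfolding e by (metis distrib_right mult_1)
      finally show "u *\<^sub>R x + v *\<^sub>R z \<in> {x. s * x $ k = t}" by simp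
    qed
    from box_connected[OF *(3,6,5) this] show ?thesis by (simp add: *(1,2))
  qed
  show "(V, \<lambda>q. - y q) \<in> flow_charts"
  proof -
    have "(V, \<lambda>q. (- s) * \<phi> q $ k) \<in> flow_charts" unfolding *(1) by (rule flow_chartI[OF *(3-6)]) (use *(7) in auto)
    then show ?thesis by (simp add: *(2))
  qed
  show "\<exists>W h. openin N W \<and> p \<in> W \<and> W \<subseteq> V \<inter> V' \<and> (\<forall>q\<in>W. y' q = h (y q))"
    if V': "(V', y') \<in> flow_charts" and p: "p \<in> V" "p \<in> V'" for V' y' p
  proof -
    obtain U' \<phi>' B' s' where **: "V' = box_chart U' \<phi>' B'" "y' = (\<lambda>p. s' * \<phi>' p $ k)" "(U', \<phi>') \<in> F" "open B'" "convex B'" "B' \<subseteq> \<phi>' ` U'" "s' = 1 \<or> s' = -1"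
      by (rule flow_chartE[OF V'])
    have "p \<in> U" "p \<in> U'" using p by (auto simp: *(1) **(1) box_chart_def)
    from F_coherent[OF *(3) **(3) this] obtain W h where W: "openin N W" "p \<in> W" "W \<subseteq> U \<inter> U'" "\<forall>q\<in>W. \<phi>' q $ k = h (\<phi> q $ k)"
      by (elim exE conjE)
    have "openin N V" "openin N V'" unfolding *(1) **(1) box_chart_def using F_preimage *(3,4) **(3,4) by blast+
    then have o: "openin N (W \<inter> (V \<inter> V'))" using W(1) by blast
    have e: "s * y q = \<phi> q $ k" for q using *(7) unfolding *(2) by (elim disjE) simp_all
    have "y' q = s' * h (s * y q)" if "q \<in> W \<inter> (V \<inter> V')" for q
      unfolding **(2) e using bspec[OF W(4) IntD1[OF that]] by simp
    then show ?thesis using o W(2) p by (intro exI[of _ "W \<inter> (V \<inter> V')"] exI[of _ "\<lambda>t. s' * h (s * t)"] conjI ballI) auto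
  qed
next
  fix W p assume W: "openin N W" "p \<in> W"
  then have "p \<in> topspace N" using openin_subset by blast
  from F_cover[OF this] obtain U \<phi> where U: "(U, \<phi>) \<in> F" "p \<in> U" by (elim exE conjE)
  from box_chart_base[OF U(1) W U(2)] obtain B where B: "open B" "convex B" "B \<subseteq> \<phi> ` U" "p \<in> box_chart U \<phi> B" "box_chart U \<phi> B \<subseteq> W"
    by (elim exE conjE)
  have "(box_chart U \<phi> B, \<lambda>p. 1 * \<phi> p $ k) \<in> flow_charts" by (rule flow_chartI[OF U(1) B(1-3)]) simp
  then show "\<exists>U y. (U, y) \<in> flow_charts \<and> p \<in> U \<and> U \<subseteq> W"
    using B(4,5) by (intro exI[of _ "box_chart U \<phi> B"] exI[of _ "\<lambda>p. 1 * \<phi> p $ k"] conjI)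
qed

definition leaf_of :: "'a \<Rightarrow> 'a set" where
  "leaf_of p = {q. (same_plaque k F)\<^sup>*\<^sup>* p q}"

lemma leaf_of_in: "p \<in> topspace N \<Longrightarrow> leaf_of p \<in> leaves N k F"
  by (simp add: leaves_def leaf_of_def)

lemma leavesE:
  assumes "L \<in> leaves N k F" obtains p where "p \<in> topspace N" "L = leaf_of p"
proof -
  obtain p where "p \<in> topspace N" "L = {q. (same_plaque k F)\<^sup>*\<^sup>* p q}"
    using assms unfolding leaves_def by (elim imageE)
  then show thesis by (intro that[of p]) (simp_all add: leaf_of_def)
qed

lemma same_plaque_sym: "same_plaque k F p q \<Longrightarrow> same_plaque k F q p"
  unfolding same_plaque_def by blast

lemma leaf_of_self: "p \<in> leaf_of p" by (simp add: leaf_of_def)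

lemma leaf_of_eq: "q \<in> leaf_of p \<Longrightarrow> leaf_of q = leaf_of p"
proof -
  assume "q \<in> leaf_of p"
  then have 1: "(same_plaque k F)\<^sup>*\<^sup>* p q" by (simp add: leaf_of_def)
  moreover have "symp (same_plaque k F)" using same_plaque_sym by (simp add: symp_def)
  ultimately have 2: "(same_plaque k F)\<^sup>*\<^sup>* q p" using symp_rtranclp by (metis sympD)
  show ?thesis unfolding leaf_of_def using 1 2 by (auto intro: rtranclp_trans)
qed

lemma plaque_leaf_of: "c \<in> F \<Longrightarrow> p \<in> plaque k c t \<Longrightarrow> q \<in> plaque k c t \<Longrightarrow> leaf_of p = leaf_of q"
proof -
  assume "c \<in> F" "p \<in> plaque k c t" "q \<in> plaque k c t"
  then have "same_plaque k F p q" unfolding same_plaque_def by blast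
  then have "q \<in> leaf_of p" by (simp add: leaf_of_def r_into_rtranclp)
  then show ?thesis by (rule leaf_of_eq[symmetric])
qed

lemma mem_plaque: "p \<in> plaque k (U, \<phi>) t \<longleftrightarrow> p \<in> U \<and> \<phi> p $ k = t"
  by (simp add: plaque_def)

lemma plaque_subset_leaf: "(U, \<phi>) \<in> F \<Longrightarrow> p \<in> U \<Longrightarrow> plaque k (U, \<phi>) (\<phi> p $ k) \<subseteq> leaf_of p"
proof
  fix q assume U: "(U, \<phi>) \<in> F" "p \<in> U" and q: "q \<in> plaque k (U, \<phi>) (\<phi> p $ k)"
  have "p \<in> plaque k (U, \<phi>) (\<phi> p $ k)" using U(2) by (simp only: mem_plaque simp_thms)
  from plaque_leaf_of[OF U(1) this q] show "q \<in> leaf_of p" using leaf_of_self[of q] by (simp only:)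
qed

lemma leaf_eq_of_mem: "L \<in> leaves N k F \<Longrightarrow> p \<in> L \<Longrightarrow> L = leaf_of p"
  using leaf_of_eq by (elim leavesE) simp

lemma leaf_subset_topspace: "L \<in> leaves N k F \<Longrightarrow> L \<subseteq> topspace N"
  using closedin_subset[OF closed_leaves] .

end

section \<open>Foliations by closed planes: leaves\<close>

context planar_foliation
begin

text \<open>
  Near \<open>p\<close> its leaf stays in a single plaque. The chart is not prescribed, so that the property can be
  transported along plaques of other charts.
\<close>

definition isolated_at :: "'a \<Rightarrow> bool" where
  "isolated_at p \<longleftrightarrow> (\<exists>U \<phi> W. (U, \<phi>) \<in> F \<and> openin N W \<and> p \<in> W \<and> W \<subseteq> U \<and> (\<forall>q\<in>W \<inter> leaf_of p. \<phi> q $ k = \<phi> p $ k))"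

text \<open>
  The leaf near \<open>q\<close> has the same transverse coordinates as near \<open>p\<close>, since it is saturated by the plaques of the chart
  that contains both points.
\<close>

lemma isolated_at_plaque:
  assumes U': "(U', \<phi>') \<in> F" and pq: "p \<in> U'" "q \<in> U'" "\<phi>' p $ k = \<phi>' q $ k" and p: "isolated_at p"
  shows "isolated_at q"
proof -
  have lf: "leaf_of p = leaf_of q" using plaque_leaf_of[OF U', of p "\<phi>' q $ k" q] pq by (simp add: mem_plaque)
  from p obtain U \<phi> W where W: "(U, \<phi>) \<in> F" "openin N W" "p \<in> W" "W \<subseteq> U" "\<forall>r\<in>W \<inter> leaf_of p. \<phi> r $ k = \<phi> p $ k"
    unfolding isolated_at_def by (elim exE conjE)
  have "p \<in> U" using W(3,4) by blast
  from F_coherent[OF W(1) U' this pq(1)]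
  obtain W0 h where W0: "openin N W0" "p \<in> W0" "W0 \<subseteq> U \<inter> U'" "\<forall>r\<in>W0. \<phi>' r $ k = h (\<phi> r $ k)" by (elim exE conjE)
  define B where "B = (\<lambda>r. \<phi>' r $ k) ` (W \<inter> W0)"
  have "open B" unfolding B_def by (rule F_open_transverse_image[OF U' openin_Int[OF W(2) W0(1)]]) (use W0(3) in blast)
  define W2 where "W2 = {r \<in> U'. \<phi>' r $ k \<in> B}"
  have "openin N W2" unfolding W2_def by (rule F_transverse_preimage[OF U' \<open>open B\<close>])
  moreover have "\<phi>' p $ k \<in> B" unfolding B_def using W(3) W0(2) by blast
  then have "q \<in> W2" unfolding W2_def using pq by simp
  moreover have "W2 \<subseteq> U'" unfolding W2_def by blast
  moreover have "\<phi>' r $ k = \<phi>' q $ k" if r: "r \<in> W2 \<inter> leaf_of q" for r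
  proof -
    have r': "r \<in> U'" "\<phi>' r $ k \<in> B" "r \<in> leaf_of q" using r by (simp_all add: W2_def)
    then obtain s where s: "s \<in> W" "s \<in> W0" "\<phi>' r $ k = \<phi>' s $ k" unfolding B_def by blast
    have "s \<in> U'" using s(2) W0(3) by blast
    then have "leaf_of s = leaf_of r" using plaque_leaf_of[OF U', of s "\<phi>' r $ k" r] r'(1) s(3) by (simp add: mem_plaque)
    then have "s \<in> leaf_of p" using leaf_of_self[of s] leaf_of_eq[OF r'(3)] lf by simp
    then have "\<phi> s $ k = \<phi> p $ k" using W(5) s(1) by simp
    then have "\<phi>' s $ k = \<phi>' p $ k" using W0(2,4) s(2) by simp
    then show ?thesis using s(3) pq(3) by simp
  qed
  ultimately show ?thesis unfolding isolated_at_def using U' by (intro exI[of _ U'] exI[of _ \<phi>'] exI[of _ W2] conjI ballI)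
qed

lemma F_openin_subset: "(U, \<phi>) \<in> F \<Longrightarrow> U \<subseteq> topspace N"
  using openin_subset[OF F_openin] .

lemma leaf_generator:
  assumes "(U, \<phi>) \<in> F" "plaque k (U, \<phi>) t \<subseteq> L" "openin N S"
  shows "openin (leaf_topology N k F L) (S \<inter> plaque k (U, \<phi>) t)"
  unfolding leaf_topology_def
proof (rule topology_generated_by_Basis)
  have "openin (subtopology N (plaque k (U, \<phi>) t)) (S \<inter> plaque k (U, \<phi>) t)"
    using assms(3) unfolding openin_subtopology by blast
  then show "S \<inter> plaque k (U, \<phi>) t \<in> {W. \<exists>c\<in>F. \<exists>t. plaque k c t \<subseteq> L \<and> openin (subtopology N (plaque k c t)) W}"
    using assms(1,2) by blast
qed

lemma leaf_plaque_openin: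
  assumes "(U, \<phi>) \<in> F" "plaque k (U, \<phi>) t \<subseteq> L"
  shows "openin (leaf_topology N k F L) (plaque k (U, \<phi>) t)"
proof -
  have "topspace N \<inter> plaque k (U, \<phi>) t = plaque k (U, \<phi>) t"
    using F_openin_subset[OF assms(1)] by (auto simp: mem_plaque)
  then show ?thesis using leaf_generator[OF assms openin_topspace] by simp
qed

lemma topspace_leaf_topology:
  assumes "L \<in> leaves N k F" shows "topspace (leaf_topology N k F L) = L"
proof
  show "topspace (leaf_topology N k F L) \<subseteq> L"
    unfolding leaf_topology_def topology_generated_by_topspace using openin_subset by fastforce
  show "L \<subseteq> topspace (leaf_topology N k F L)"
  proof
    fix p assume p: "p \<in> L"
    then have "p \<in> topspace N" using leaf_subset_topspace[OF assms] by blast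
    from F_cover[OF this] obtain U \<phi> where U: "(U, \<phi>) \<in> F" "p \<in> U" by (elim exE conjE)
    have "plaque k (U, \<phi>) (\<phi> p $ k) \<subseteq> L" using plaque_subset_leaf[OF U] leaf_eq_of_mem[OF assms p] by simp
    from openin_subset[OF leaf_plaque_openin[OF U(1) this]] show "p \<in> topspace (leaf_topology N k F L)"
      using U(2) by (auto simp: mem_plaque)
  qed
qed

lemma leaf_inclusion_continuous:
  assumes "L \<in> leaves N k F" shows "continuous_map (leaf_topology N k F L) N id"
  unfolding continuous_map_def topspace_leaf_topology[OF assms]
proof (intro conjI allI impI)
  show "id \<in> L \<rightarrow> topspace N" using leaf_subset_topspace[OF assms] by auto
  fix S assume S: "openin N S"
  show "openin (leaf_topology N k F L) {x \<in> L. id x \<in> S}"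
  proof (subst openin_subopen, intro ballI)
    fix p assume "p \<in> {x \<in> L. id x \<in> S}"
    then have p: "p \<in> L" "p \<in> S" by simp_all
    then have "p \<in> topspace N" using leaf_subset_topspace[OF assms] by blast
    from F_cover[OF this] obtain U \<phi> where U: "(U, \<phi>) \<in> F" "p \<in> U" by (elim exE conjE)
    have sub: "plaque k (U, \<phi>) (\<phi> p $ k) \<subseteq> L" using plaque_subset_leaf[OF U] leaf_eq_of_mem[OF assms p(1)] by simp
    have "p \<in> S \<inter> plaque k (U, \<phi>) (\<phi> p $ k)" using p(2) U(2) by (simp add: mem_plaque)
    moreover have "S \<inter> plaque k (U, \<phi>) (\<phi> p $ k) \<subseteq> {x \<in> L. id x \<in> S}" using sub by auto
    ultimately show "\<exists>T. openin (leaf_topology N k F L) T \<and> p \<in> T \<and> T \<subseteq> {x \<in> L. id x \<in> S}"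
      using leaf_generator[OF U(1) sub S] by (intro exI[of _ "S \<inter> plaque k (U, \<phi>) (\<phi> p $ k)"] conjI)
  qed
qed

text \<open>
  The leaf topology has the open subsets of plaques of all charts as a subbasis. By coherence
  a path in a plaque of one chart stays locally in a plaque of any other.
\<close>

lemma leaf_path_in_plaque:
  assumes U: "(U, \<phi>) \<in> F" and sub: "plaque k (U, \<phi>) t \<subseteq> L" and d: "pathin N d" "\<And>u. u \<in> {0..1} \<Longrightarrow> d u \<in> plaque k (U, \<phi>) t"
  shows "pathin (leaf_topology N k F L) d"
  unfolding pathin_def leaf_topology_def
proof (rule continuous_on_generated_topo)
  fix W assume "W \<in> {W. \<exists>c\<in>F. \<exists>t. plaque k c t \<subseteq> L \<and> openin (subtopology N (plaque k c t)) W}"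
  then obtain c t' where c: "c \<in> F" "openin (subtopology N (plaque k c t')) W" by blast
  obtain V \<psi> where e: "c = (V, \<psi>)" by (cases c)
  have V: "(V, \<psi>) \<in> F" using c(1) e by simp
  obtain S where S: "openin N S" "W = S \<inter> plaque k (V, \<psi>) t'" using c(2) e unfolding openin_subtopology by blast
  show "openin (top_of_set {0..1}) (d -` W \<inter> topspace (top_of_set {0..1}))"
  proof (subst openin_subopen, intro ballI)
    fix u assume "u \<in> d -` W \<inter> topspace (top_of_set {0..1})"
    then have u: "u \<in> {0..1}" "d u \<in> S" "d u \<in> V" "\<psi> (d u) $ k = t'" unfolding S(2) by (simp_all add: mem_plaque)
    have du: "d u \<in> U" "\<phi> (d u) $ k = t" using d(2)[OF u(1)] by (simp_all add: mem_plaque)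
    from F_coherent[OF U V du(1) u(3)]
    obtain W0 h where W0: "openin N W0" "d u \<in> W0" "W0 \<subseteq> U \<inter> V" "\<forall>q\<in>W0. \<psi> q $ k = h (\<phi> q $ k)" by (elim exE conjE)
    define T where "T = {v \<in> {0..1}. d v \<in> S \<inter> W0}"
    have "openin (top_of_set {0..1}) T"
      using openin_continuous_map_preimage[OF d(1)[unfolded pathin_def] openin_Int[OF S(1) W0(1)]]
      unfolding T_def by (simp only: topspace_euclidean_subtopology)
    moreover have "u \<in> T" unfolding T_def using u W0(2) by simp
    moreover have "T \<subseteq> d -` W \<inter> topspace (top_of_set {0..1})"
    proof
      fix v assume "v \<in> T"
      then have v: "v \<in> {0..1}" "d v \<in> S" "d v \<in> W0" by (simp_all add: T_def)
      have "\<phi> (d v) $ k = t" using d(2)[OF v(1)] by (simp add: mem_plaque)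
      then have "\<psi> (d v) $ k = t'" using bspec[OF W0(4) v(3)] bspec[OF W0(4) W0(2)] du(2) u(4) by simp
      moreover have "d v \<in> V" using v(3) W0(3) by blast
      ultimately show "v \<in> d -` W \<inter> topspace (top_of_set {0..1})" unfolding S(2) using v by (simp add: mem_plaque)
    qed
    ultimately show "\<exists>T. openin (top_of_set {0..1}) T \<and> u \<in> T \<and> T \<subseteq> d -` W \<inter> topspace (top_of_set {0..1})"
      by (intro exI[of _ T] conjI)
  qed
next
  have "plaque k (U, \<phi>) t \<subseteq> topspace (leaf_topology N k F L)" by (rule openin_subset[OF leaf_plaque_openin[OF U sub]])
  then show "d ` topspace (top_of_set {0..1}) \<subseteq> \<Union>{W. \<exists>c\<in>F. \<exists>t. plaque k c t \<subseteq> L \<and> openin (subtopology N (plaque k c t)) W}"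
    unfolding leaf_topology_def topology_generated_by_topspace using d(2) by auto
qed

lemma leaf_homeomorphism:
  assumes "L \<in> leaves N k F"
  obtains g h where "continuous_map (leaf_topology N k F L) (top_of_set (hyperplane k)) g"
    "continuous_map (top_of_set (hyperplane k)) (leaf_topology N k F L) h" "\<And>p. p \<in> L \<Longrightarrow> h (g p) = p"
proof -
  have "C2_diffeomorphic (leaf_topology N k F L) (leaf_atlas k F L) (top_of_set (hyperplane k)) {(hyperplane k, id)}"
    using planes assms by (simp add: foliation_by_planes_def)
  then obtain g h where "homeomorphic_maps (leaf_topology N k F L) (top_of_set (hyperplane k)) g h"
    unfolding C2_diffeomorphic_def by blast
  then show thesis using that[of g h] unfolding homeomorphic_maps_def topspace_leaf_topology[OF assms] by blast
qed

text \<open>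
  The plaques of a leaf in a chart are disjoint and open in the leaf, which has a countable dense subset, being
  homeomorphic to a hyperplane.
\<close>

lemma leaf_transverse_countable:
  assumes L: "L \<in> leaves N k F" and U: "(U, \<phi>) \<in> F"
  shows "countable ((\<lambda>p. \<phi> p $ k) ` (U \<inter> L))"
proof -
  obtain g h where gh: "continuous_map (leaf_topology N k F L) (top_of_set (hyperplane k)) g"
    "continuous_map (top_of_set (hyperplane k)) (leaf_topology N k F L) h" "\<And>p. p \<in> L \<Longrightarrow> h (g p) = p"
    by (rule leaf_homeomorphism[OF L]) blast
  \<comment> \<open>Each plaque of the leaf contains the image of a point of \<open>D\<close>.\<close>
  obtain D where D: "countable D" "D \<subseteq> hyperplane k" "hyperplane k \<subseteq> closure D"
    by (rule separable)
  have "(\<lambda>p. \<phi> p $ k) ` (U \<inter> L) \<subseteq> (\<lambda>x. \<phi> (h x) $ k) ` D"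
  proof (rule image_subsetI)
    fix q assume q: "q \<in> U \<inter> L"
    let ?P = "plaque k (U, \<phi>) (\<phi> q $ k)"
    have "?P \<subseteq> L" using plaque_subset_leaf[OF U, of q] leaf_eq_of_mem[OF L, of q] q by simp
    from leaf_plaque_openin[OF U this] have "openin (top_of_set (hyperplane k)) {x \<in> hyperplane k. h x \<in> ?P}"
      using gh(2) unfolding continuous_map_def by simp
    then obtain S where S: "open S" "{x \<in> hyperplane k. h x \<in> ?P} = hyperplane k \<inter> S"
      unfolding openin_open by blast
    have gq: "g q \<in> hyperplane k"
      using gh(1) q unfolding continuous_map_def topspace_leaf_topology[OF L] by auto
    moreover have "h (g q) \<in> ?P" using gh(3)[of q] q by (simp add: mem_plaque)
    ultimately have "g q \<in> {x \<in> hyperplane k. h x \<in> ?P}" by simp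
    then have "g q \<in> S" unfolding S(2) by (rule IntD2)
    moreover have "g q \<in> closure D" using gq D(3) by blast
    ultimately have "S \<inter> D \<noteq> {}" using open_Int_closure_eq_empty[OF S(1), of D] by blast
    then obtain x where x: "x \<in> S" "x \<in> D" by blast
    then have "x \<in> hyperplane k \<inter> S" using D(2) by blast
    then have "h x \<in> ?P" unfolding S(2)[symmetric] by simp
    then have "\<phi> q $ k = \<phi> (h x) $ k" by (simp add: mem_plaque)
    then show "\<phi> q $ k \<in> (\<lambda>x. \<phi> (h x) $ k) ` D" using x(2) by (rule image_eqI)
  qed
  then show ?thesis using D(1) countable_image countable_subset by blast
qed

lemma leaf_isolated_point:
  assumes L: "L \<in> leaves N k F" shows "\<exists>q\<in>L. isolated_at q"
proof -
  obtain p where p: "p \<in> topspace N" "L = leaf_of p" by (rule leavesE[OF L])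
  from F_cover[OF p(1)] obtain U \<phi> where U: "(U, \<phi>) \<in> F" "p \<in> U" by (elim exE conjE)
  let ?y = "\<lambda>p. \<phi> p $ k"
  have cT: "countable (?y ` (U \<inter> L))" by (rule leaf_transverse_countable[OF L U(1)])
  have ne: "?y ` (U \<inter> L) \<noteq> {}" using U(2) p(2) leaf_of_self by blast
  have oI: "open (?y ` U)" by (rule F_open_transverse_image[OF U(1) F_openin[OF U(1)] order_refl])
  have "?y ` U - ?y ` (U \<inter> L) = ?y ` (U - L)"
  proof
    show "?y ` (U - L) \<subseteq> ?y ` U - ?y ` (U \<inter> L)"
    proof (rule image_subsetI)
      fix q assume q: "q \<in> U - L"
      have "?y q \<noteq> ?y r" if r: "r \<in> U \<inter> L" for r
      proof
        assume "?y q = ?y r"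
        then have "leaf_of q = leaf_of r" using plaque_leaf_of[OF U(1), of q "?y r" r] q r by (simp add: mem_plaque)
        then show False using leaf_of_self[of q] leaf_eq_of_mem[OF L, of r] q r by simp
      qed
      then show "?y q \<in> ?y ` U - ?y ` (U \<inter> L)" using q by blast
    qed
  qed blast
  moreover have "openin N (U - L)" by (rule openin_diff[OF F_openin[OF U(1)] closed_leaves[OF L]])
  ultimately have "open (?y ` U - ?y ` (U \<inter> L))" using F_open_transverse_image[OF U(1), of "U - L"] by simp
  from countable_closed_isolated_point[OF cT ne _ oI this]
  obtain t e where t: "t \<in> ?y ` (U \<inter> L)" "e > 0" "\<forall>t'\<in>?y ` (U \<inter> L). \<bar>t' - t\<bar> < e \<longrightarrow> t' = t" by blast
  then obtain q where q: "q \<in> U" "q \<in> L" "t = ?y q" by blast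
  let ?W = "{r \<in> U. ?y r \<in> ball t e}"
  have "openin N ?W" by (rule F_transverse_preimage[OF U(1) open_ball])
  moreover have "q \<in> ?W" using q t(2) by simp
  moreover have "?W \<subseteq> U" by (rule Collect_subset)
  moreover have "?y r = ?y q" if r: "r \<in> ?W \<inter> leaf_of q" for r
  proof -
    have r': "r \<in> U \<inter> L" "\<bar>?y r - t\<bar> < e" using r leaf_eq_of_mem[OF L q(2)] by (simp_all add: dist_real_def abs_minus_commute)
    have "?y r = t" by (rule t(3)[rule_format, OF imageI[OF r'(1)] r'(2)])
    then show ?thesis using q(3) by simp
  qed
  ultimately have "isolated_at q" unfolding isolated_at_def
    using U(1) by (intro exI[of _ U] exI[of _ \<phi>] exI[of _ ?W] conjI[OF _ conjI[OF _ conjI[OF _ conjI]]] ballI)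
  then show ?thesis using q(2) by (rule bexI)
qed

lemma isolated: assumes "p \<in> topspace N" shows "isolated_at p"
proof -
  have L: "leaf_of p \<in> leaves N k F" by (rule leaf_of_in[OF assms])
  from leaf_isolated_point[OF L] obtain q where q: "q \<in> leaf_of p" "isolated_at q" by (elim bexE)
  have "p \<in> leaf_of q" using leaf_of_eq[OF q(1)] leaf_of_self[of p] by simp
  then have "(same_plaque k F)\<^sup>*\<^sup>* q p" by (simp add: leaf_of_def)
  then show ?thesis
  proof (induction rule: rtranclp_induct)
    case base show ?case by (rule q(2))
  next
    case (step r s)
    from step(2) obtain c t where c: "c \<in> F" "r \<in> plaque k c t" "s \<in> plaque k c t" unfolding same_plaque_def by blast
    obtain U \<phi> where e: "c = (U, \<phi>)" by (cases c)
    show ?case by (rule isolated_at_plaque[of U \<phi> r s]) (use c e step.IH in \<open>simp_all add: mem_plaque\<close>)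
  qed
qed

definition leafwise :: "(real \<Rightarrow> 'a) \<Rightarrow> bool" where
  "leafwise d \<longleftrightarrow> (\<exists>L\<in>leaves N k F. pathin (leaf_topology N k F L) d)"

lemma F_continuous:
  assumes "(U, \<phi>) \<in> F" shows "continuous_map (subtopology N U) euclidean \<phi>"
proof -
  obtain g where "continuous_map (subtopology N U) (top_of_set (\<phi> ` U)) \<phi>" by (rule F_inverse[OF assms]) blast
  then show ?thesis by (simp add: continuous_map_in_subtopology)
qed

lemma box_segment:
  assumes "(U, \<phi>) \<in> F" "B \<subseteq> \<phi> ` U" "convex B" "p \<in> box_chart U \<phi> B" "q \<in> box_chart U \<phi> B"
  shows "\<exists>d. pathin (subtopology N (box_chart U \<phi> B)) d \<and> d 0 = p \<and> d 1 = q \<and>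
      (\<forall>u\<in>{0..1}. d u \<in> U \<and> \<phi> (d u) = (1 - u) *\<^sub>R \<phi> p + u *\<^sub>R \<phi> q)"
proof -
  obtain g where g: "continuous_map (top_of_set B) N g" "\<And>x. x \<in> B \<Longrightarrow> g x \<in> box_chart U \<phi> B \<and> \<phi> (g x) = x"
    "\<And>p. p \<in> box_chart U \<phi> B \<Longrightarrow> g (\<phi> p) = p" by (rule box_chart_param[OF assms(1,2)]) blast
  define f where "f u = (1 - u) *\<^sub>R \<phi> p + u *\<^sub>R \<phi> q" for u
  have pq: "\<phi> p \<in> B" "\<phi> q \<in> B" using assms(4,5) by (simp_all add: box_chart_def)
  have fB: "f u \<in> B" if "u \<in> {0..1}" for u
    unfolding f_def using convexD_alt[OF assms(3) pq, of u] that by simp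
  have "pathin N (\<lambda>u. g (f u))"
    by (rule pathin_compose_real[OF g(1)]) (auto simp: f_def[abs_def] intro!: continuous_intros fB[unfolded f_def] image_subsetI)
  then have "pathin (subtopology N (box_chart U \<phi> B)) (\<lambda>u. g (f u))"
    using g(2) fB by (simp add: pathin_subtopology)
  moreover have "g (f 0) = p" "g (f 1) = q" using g(3) assms(4,5) by (simp_all add: f_def)
  moreover have "g (f u) \<in> U \<and> \<phi> (g (f u)) = (1 - u) *\<^sub>R \<phi> p + u *\<^sub>R \<phi> q" if "u \<in> {0..1}" for u
    using g(2)[OF fB[OF that]] by (simp add: box_chart_def f_def)
  ultimately show ?thesis by (intro exI[of _ "\<lambda>u. g (f u)"] conjI[OF _ conjI[OF _ conjI]] ballI)
qed

lemma box_simple: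
  assumes "(U, \<phi>) \<in> F" "open B" "B \<subseteq> \<phi> ` U" "convex B"
  shows "simple_open N (box_chart U \<phi> B)"
  unfolding simple_open_def
proof (intro conjI ballI allI impI)
  let ?V = "box_chart U \<phi> B"
  show "openin N ?V" unfolding box_chart_def by (rule F_preimage[OF assms(1,2)])
  show "\<exists>d. pathin (subtopology N ?V) d \<and> d 0 = p \<and> d 1 = q" if "p \<in> ?V" "q \<in> ?V" for p q
    using box_segment[OF assms(1,3,4) that] by blast
  fix d d' assume d: "pathin (subtopology N ?V) d" "pathin (subtopology N ?V) d'" and e: "d 0 = d' 0" "d 1 = d' 1"
  obtain g where g: "continuous_map (top_of_set B) N g" "\<And>x. x \<in> B \<Longrightarrow> g x \<in> box_chart U \<phi> B \<and> \<phi> (g x) = x"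
    "\<And>p. p \<in> box_chart U \<phi> B \<Longrightarrow> g (\<phi> p) = p" by (rule box_chart_param[OF assms(1,3)]) blast
  have cont: "continuous_on {0..1} (\<lambda>u. \<phi> (c u))" if "pathin (subtopology N ?V) c" for c
  proof -
    have "continuous_map (subtopology N ?V) euclidean \<phi>"
      by (rule continuous_map_from_subtopology_mono[OF F_continuous[OF assms(1)]]) (auto simp: box_chart_def)
    from continuous_map_compose[OF that[unfolded pathin_def] this] show ?thesis by (simp add: o_def)
  qed
  have inB: "\<phi> (c u) \<in> B" "g (\<phi> (c u)) = c u" if "pathin (subtopology N ?V) c" "u \<in> {0..1}" for c u
    using pathin_sub_in[OF that] g(3) by (simp_all add: box_chart_def)
  show "path_hom N d d'"
    by (rule path_hom_convex[OF assms(4) g(1) cont[OF d(1)] _ cont[OF d(2)]])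
      (use inB(1)[OF d(1)] inB(1)[OF d(2)] inB(2)[OF d(1)] inB(2)[OF d(2)] e in \<open>simp_all add: image_subset_iff\<close>)
qed

text \<open>
  In the leaf, which is homeomorphic to a convex set, the loop is null homotopic; the inclusion of the leaf
  with its own topology is continuous.
\<close>

lemma leafwise_null_homotopic:
  assumes d: "leafwise d" "d 0 = d 1" shows "path_hom N d (\<lambda>_. d 0)"
proof -
  obtain L where L: "L \<in> leaves N k F" "pathin (leaf_topology N k F L) d" using d(1) unfolding leafwise_def by blast
  obtain g h where gh: "continuous_map (leaf_topology N k F L) (top_of_set (hyperplane k)) g"
    "continuous_map (top_of_set (hyperplane k)) (leaf_topology N k F L) h" "\<And>p. p \<in> L \<Longrightarrow> h (g p) = p"
    by (rule leaf_homeomorphism[OF L(1)]) blast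
  have h: "continuous_map (top_of_set (hyperplane k)) N h"
    using continuous_map_compose[OF gh(2) leaf_inclusion_continuous[OF L(1)]] by simp
  have gd: "continuous_map (top_of_set {0..1}) (top_of_set (hyperplane k)) (g \<circ> d)"
    by (rule continuous_map_compose[OF L(2)[unfolded pathin_def] gh(1)])
  have dL: "d u \<in> L" if "u \<in> {0..1}" for u
    using pathin_in_topspace[OF L(2) that] by (simp add: topspace_leaf_topology[OF L(1)])
  have "convex (hyperplane k :: (real^'n) set)"
    unfolding hyperplane_def by (rule convexI) simp
  moreover have "continuous_on {0..1} (\<lambda>u. g (d u))" "(\<lambda>u. g (d u)) ` {0..1} \<subseteq> hyperplane k"
    using gd unfolding continuous_map_subtopology_eu by (simp_all add: o_def image_subset_iff_funcset)
  moreover have "(\<lambda>_. g (d 0)) ` {0..1::real} \<subseteq> hyperplane k" using calculation(3) by auto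
  ultimately show ?thesis
    by (intro path_hom_convex[where T = "hyperplane k" and K = h and f = "\<lambda>u. g (d u)" and g = "\<lambda>_. g (d 0)"])
      (use h gh(3) dL d(2) in simp_all)
qed

lemma simple_foliated_charts:
  assumes "x \<in> topspace N" shows "simple_foliated N flow_charts x leafwise leaf_of"
proof unfold_locales
  show "x \<in> topspace N" by (rule assms)
next
  fix V y assume "(V, y) \<in> flow_charts"
  then obtain U \<phi> B s where *: "V = box_chart U \<phi> B" "y = (\<lambda>p. s * \<phi> p $ k)" "(U, \<phi>) \<in> F" "open B" "convex B" "B \<subseteq> \<phi> ` U" "s = 1 \<or> s = -1"
    by (rule flow_chartE)
  show "simple_open N V" unfolding *(1) by (rule box_simple[OF *(3,4,6,5)])
  fix p q assume pq: "p \<in> V" "q \<in> V" "y p = y q"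
  have e: "\<phi> p $ k = \<phi> q $ k" using pq(3) *(7) unfolding *(2) by auto
  have pqU: "p \<in> U" "q \<in> U" using pq by (simp_all add: *(1) box_chart_def)
  show "leaf_of p = leaf_of q" using plaque_leaf_of[OF *(3), of p "\<phi> q $ k" q] pqU e by (simp add: mem_plaque)
  have pV: "p \<in> box_chart U \<phi> B" "q \<in> box_chart U \<phi> B" using pq *(1) by simp_all
  obtain d where d: "pathin (subtopology N V) d" "d 0 = p" "d 1 = q" "\<forall>u\<in>{0..1}. d u \<in> U \<and> \<phi> (d u) = (1 - u) *\<^sub>R \<phi> p + u *\<^sub>R \<phi> q"
    using box_segment[OF *(3,6,5) pV] unfolding *(1)[symmetric] by (elim exE conjE)
  have in_plaque: "d u \<in> plaque k (U, \<phi>) (\<phi> p $ k)" if "u \<in> {0..1}" for u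
  proof -
    have du: "d u \<in> U" "\<phi> (d u) = (1 - u) *\<^sub>R \<phi> p + u *\<^sub>R \<phi> q" using bspec[OF d(4) that] by (rule conjunct1, rule conjunct2)
    from du(2) have "\<phi> (d u) $ k = (1 - u) * \<phi> p $ k + u * \<phi> q $ k"
      by (simp only: vector_add_component vector_scaleR_component real_scaleR_def)
    then have "\<phi> (d u) $ k = \<phi> p $ k" unfolding e[symmetric] by (simp add: algebra_simps)
    then show ?thesis unfolding mem_plaque using du(1) by (intro conjI)
  qed
  have "pathin (leaf_topology N k F (leaf_of p)) d"
    by (rule leaf_path_in_plaque[OF *(3) plaque_subset_leaf[OF *(3) pqU(1)] pathin_sub[OF d(1)]]) (rule in_plaque)
  then have "leafwise d" unfolding leafwise_def by (rule bexI) (rule leaf_of_in[OF subsetD[OF F_openin_subset[OF *(3)] pqU(1)]])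
  then show "\<exists>d. pathin (subtopology N V) d \<and> d 0 = p \<and> d 1 = q \<and> leafwise d" using d(1-3) by (intro exI[of _ d] conjI)
next
  fix p assume p: "p \<in> topspace N"
  have "pathin (leaf_topology N k F (leaf_of p)) (\<lambda>_. p)"
    by (rule pathin_const) (simp add: topspace_leaf_topology[OF leaf_of_in[OF p]] leaf_of_self)
  then show "leafwise (\<lambda>_. p)" unfolding leafwise_def using leaf_of_in[OF p] by (rule bexI)
  fix q assume q: "q \<in> topspace N"
  show "\<exists>U y. (U, y) \<in> flow_charts \<and> q \<in> U \<and> (\<forall>r\<in>U \<inter> leaf_of p. \<forall>s\<in>U \<inter> leaf_of p. y r = y s)"
  proof (cases "q \<in> leaf_of p")
    case True
    from isolated[OF q] obtain U \<phi> W where W: "(U, \<phi>) \<in> F" "openin N W" "q \<in> W" "W \<subseteq> U" "\<forall>r\<in>W \<inter> leaf_of q. \<phi> r $ k = \<phi> q $ k"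
      unfolding isolated_at_def by (elim exE conjE)
    have "q \<in> U" using W(3,4) by blast
    from box_chart_base[OF W(1-3) this] obtain B where B: "open B" "convex B" "B \<subseteq> \<phi> ` U" "q \<in> box_chart U \<phi> B" "box_chart U \<phi> B \<subseteq> W"
      by (elim exE conjE)
    have c: "(box_chart U \<phi> B, \<lambda>p. 1 * \<phi> p $ k) \<in> flow_charts" by (rule flow_chartI[OF W(1) B(1-3)]) simp
    have "\<phi> r $ k = \<phi> q $ k" if "r \<in> box_chart U \<phi> B \<inter> leaf_of p" for r
      by (rule bspec[OF W(5)]) (use that B(5) leaf_of_eq[OF True] in auto)
    then have "1 * \<phi> r $ k = 1 * \<phi> s $ k" if "r \<in> box_chart U \<phi> B \<inter> leaf_of p" "s \<in> box_chart U \<phi> B \<inter> leaf_of p" for r s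
      using that by metis
    then show ?thesis using c B(4) by (intro exI[of _ "box_chart U \<phi> B"] exI[of _ "\<lambda>p. 1 * \<phi> p $ k"] conjI ballI)
  next
    case False
    have "openin N (topspace N - leaf_of p)" by (rule openin_diff[OF openin_topspace closed_leaves[OF leaf_of_in[OF p]]])
    from charts_base[OF this, of q] False q obtain U y where "(U, y) \<in> flow_charts" "q \<in> U" "U \<subseteq> topspace N - leaf_of p" by blast
    then show ?thesis by (intro exI[of _ U] exI[of _ y]) blast
  qed
next
  fix d d' assume d: "leafwise d" "leafwise d'" "d 1 = d' 0"
  then obtain L L' where L: "L \<in> leaves N k F" "pathin (leaf_topology N k F L) d" "L' \<in> leaves N k F" "pathin (leaf_topology N k F L') d'"
    unfolding leafwise_def by blast
  have "d 1 \<in> L" "d' 0 \<in> L'"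
    using pathin_in_topspace[OF L(2), of 1] pathin_in_topspace[OF L(4), of 0] by (simp_all add: topspace_leaf_topology L)
  then have "L = L'" using leaf_eq_of_mem[OF L(1), of "d 1"] leaf_eq_of_mem[OF L(3), of "d 1"] unfolding d(3) by simp
  then have "pathin (leaf_topology N k F L) d'" using L(4) by simp
  from pathin_concat[OF L(2) this d(3)] show "leafwise (concat_paths d d')" unfolding leafwise_def using L(1) by (rule bexI)
next
  fix d assume d: "leafwise d"
  then obtain L where L: "L \<in> leaves N k F" "pathin (leaf_topology N k F L) d" unfolding leafwise_def by blast
  show "pathin N d" using pathin_compose[OF L(2) leaf_inclusion_continuous[OF L(1)]] by simp
  show "path_hom N d (\<lambda>_. d 0)" if "d 0 = d 1" by (rule leafwise_null_homotopic[OF d that])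
qed (rule leaf_of_self)

end

theorem corollary1:
  fixes N :: "'a topology"
    and A F :: "('a, real ^ 'n) chart set"
    and k :: 'n
    and x :: 'a
    and H :: "(real \<Rightarrow> 'a) set set"
  assumes "manifold N A"
    and "connected_space N"
    and "\<not> compact_space N"
    and "foliation_by_planes N A k F"
    and "x \<in> topspace N"
    and "subgroup H (fundamental_group N x)"
    and "comm_group ((fundamental_group N x)\<lparr>carrier := H\<rparr>)"
    and "torsion_free ((fundamental_group N x)\<lparr>carrier := H\<rparr>)"
    and "finitely_generated ((fundamental_group N x)\<lparr>carrier := H\<rparr>)"
    and "group_rank ((fundamental_group N x)\<lparr>carrier := H\<rparr>) > 1"
  shows "\<exists>L \<in> leaves N k F. \<not> closedin N L"
proof (rule ccontr)
  assume "\<not> ?thesis"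
  then interpret planar_foliation N A F k
    using assms(4) by unfold_locales blast+
  interpret simple_foliated N flow_charts x leafwise leaf_of
    by (rule simple_foliated_charts[OF assms(5)])
  let ?K = "(fundamental_group N x)\<lparr>carrier := H\<rparr>"
  from abelian_subgroup_cyclic[OF assms(6,7)] obtain h where h: "h \<in> H" "generate ?K {h} = H" by (elim bexE)
  have "group_rank ?K \<le> 1"
    unfolding group_rank_def by (rule Least_le) (use h in \<open>intro exI[of _ "{h}"], simp\<close>)
  then show False using assms(10) by simp
qed

end
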